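(* If $\Pi$ is a proof of $\delta \odot \Delta \vdash_{\mathsf{GS}} X$ or $\delta \odot \Delta ; \Gamma \vdash_{\mathsf{MS}} A$ with $\mathsf{CutRank}(\Pi) > 0$, then there is an algorithm which yields a cut-free proof $\Pi'$ of $\delta \odot \Delta \vdash_{\mathsf{GS}} X$ or $\delta \odot \Delta ; \Gamma \vdash_{\mathsf{MS}} A$ respectively.
   Context: Mixed Graded/Linear logic (mGL): grades come from a preordered semiring $(\mathcal{R},1,*,0,+,\leq)$ with $*,+$ monotone. Graded formulas $X ::= \mathsf{J} \mid X\boxtimes Y \mid \mathsf{Lin}\,A$; linear formulas $A ::= \mathsf{I} \mid A\otimes B \mid A\multimap B \mid \mathsf{Grd}_r X$. Judgments $\delta\odot\Delta\vdash_{\mathsf{GS}} X$ and $\delta\odot\Delta;\Gamma\vdash_{\mathsf{MS}} A$, with $\delta$ a grade vector paired with graded context $\Delta$, $\Gamma$ a linear context; the systems include approximation (subsumption) rules allowing grade vectors to be increased along $\leq$. Cuts include graded multicut rules: from $\delta_2\odot\Delta_2\vdash_{\mathsf{GS}} X$ and $(\delta_1,\delta,\delta_3)\odot(\Delta_1,X^n,\Delta_3)\vdash Y$ (with $X^n$ being $n$ copies of $X$, $\delta$ of length $n$) derive $(\delta_1,\bigoplus_{k=1}^n(\delta(k)*\delta_2),\delta_3)\odot(\Delta_1,\Delta_2,\Delta_3)\vdash Y$, where $\delta(k)$ is the $k$-th entry, $*$ scalar multiplication and $\bigoplus$ pointwise vector sum. $\mathsf{CutRank}(\Pi)$ is one more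 than the maximum syntax-tree height of cut formulas in $\Pi$ (0 if cut-free). *)

theory Defs
  imports Main
begin

section \<open>Grades, formulas and sequents\<close>

text \<open>The order is only a preorder, and \<open>0 = 1\<close> is not excluded; hence neither
  \<open>ordered_semiring\<close> nor \<open>semiring_1\<close> is used.\<close>

class preordered_semiring = semiring_0 + monoid_mult + preorder +
  assumes plus_mono: "a \<le> b \<Longrightarrow> c \<le> d \<Longrightarrow> a + c \<le> b + d"
    and times_mono: "a \<le> b \<Longrightarrow> c \<le> d \<Longrightarrow> a * c \<le> b * d"

datatype 'r gform = J | GTensor "'r gform" "'r gform" | Lin "'r lform"
  and 'r lform = I | Tensor "'r lform" "'r lform" | Lolli "'r lform" "'r lform" | Grd 'r "'r gform"

text \<open>A grade vector paired with a graded context, \<open>\<delta> \<odot> \<Delta>\<close>, is the list of its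
  (grade, formula) pairs; so both components have the same length by construction.\<close>

type_synonym 'r gctx = "('r \<times> 'r gform) list"

definition scale :: "'r::times \<Rightarrow> 'r gctx \<Rightarrow> 'r gctx" where
  "scale r \<Xi> = map (\<lambda>(s, X). (r * s, X)) \<Xi>"

definition copies :: "'r list \<Rightarrow> 'r gform \<Rightarrow> 'r gctx" where
  "copies \<delta> X = map (\<lambda>r. (r, X)) \<delta>"

text \<open>\<open>multiscale \<delta> (\<delta>\<^sub>2 \<odot> \<Delta>\<^sub>2)\<close> is \<open>(\<Oplus>\<^sub>k \<delta>(k) * \<delta>\<^sub>2) \<odot> \<Delta>\<^sub>2\<close>; for empty \<open>\<delta>\<close> all grades become \<open>0\<close>.\<close>

definition multiscale :: "'r::semiring_0 list \<Rightarrow> 'r gctx \<Rightarrow> 'r gctx" where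
  "multiscale \<delta> \<Xi> = map (\<lambda>(s, X). (\<Sum>r\<leftarrow>\<delta>. r * s, X)) \<Xi>"

definition gctx_le :: "'r::ord gctx \<Rightarrow> 'r gctx \<Rightarrow> bool" where
  "gctx_le = list_all2 (\<lambda>(r, X) (s, Y). r \<le> s \<and> X = Y)"

datatype 'r sequent =
    GS "'r gctx" "'r gform"
  | MS "'r gctx" "'r lform list" "'r lform"


section \<open>Inference rules\<close>

text \<open>\<open>rule_inst Ss S\<close>: the sequent \<open>S\<close> follows from the premises \<open>Ss\<close> by one rule
  other than a cut.\<close>

inductive rule_inst :: "'r::preordered_semiring sequent list \<Rightarrow> 'r sequent \<Rightarrow> bool" where
  \<comment> \<open>the graded system\<close>
  g_id: "rule_inst [] (GS [(1, X)] X)"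
| g_sub: "gctx_le \<Xi> \<Xi>' \<Longrightarrow> rule_inst [GS \<Xi> X] (GS \<Xi>' X)"
| g_weak: "rule_inst [GS (\<Xi>\<^sub>1 @ \<Xi>\<^sub>2) Y] (GS (\<Xi>\<^sub>1 @ [(0, X)] @ \<Xi>\<^sub>2) Y)"
| g_contr: "rule_inst [GS (\<Xi>\<^sub>1 @ [(r, X), (s, X)] @ \<Xi>\<^sub>2) Y] (GS (\<Xi>\<^sub>1 @ [(r + s, X)] @ \<Xi>\<^sub>2) Y)"
| g_exch: "rule_inst [GS (\<Xi>\<^sub>1 @ [(r, X), (s, Y)] @ \<Xi>\<^sub>2) Z] (GS (\<Xi>\<^sub>1 @ [(s, Y), (r, X)] @ \<Xi>\<^sub>2) Z)"
| g_unitR: "rule_inst [] (GS [] J)"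
| g_unitL: "rule_inst [GS (\<Xi>\<^sub>1 @ \<Xi>\<^sub>2) X] (GS (\<Xi>\<^sub>1 @ [(r, J)] @ \<Xi>\<^sub>2) X)"
| g_tensorR: "rule_inst [GS \<Xi>\<^sub>1 X, GS \<Xi>\<^sub>2 Y] (GS (\<Xi>\<^sub>1 @ \<Xi>\<^sub>2) (GTensor X Y))"
| g_tensorL: "rule_inst [GS (\<Xi>\<^sub>1 @ [(r, X), (r, Y)] @ \<Xi>\<^sub>2) Z] (GS (\<Xi>\<^sub>1 @ [(r, GTensor X Y)] @ \<Xi>\<^sub>2) Z)"
| g_linR: "rule_inst [MS \<Xi> [] A] (GS \<Xi> (Lin A))"
  \<comment> \<open>the mixed system: rules on the graded context\<close>
| m_sub: "gctx_le \<Xi> \<Xi>' \<Longrightarrow> rule_inst [MS \<Xi> \<Gamma> A] (MS \<Xi>' \<Gamma> A)"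
| m_weak: "rule_inst [MS (\<Xi>\<^sub>1 @ \<Xi>\<^sub>2) \<Gamma> A] (MS (\<Xi>\<^sub>1 @ [(0, X)] @ \<Xi>\<^sub>2) \<Gamma> A)"
| m_contr: "rule_inst [MS (\<Xi>\<^sub>1 @ [(r, X), (s, X)] @ \<Xi>\<^sub>2) \<Gamma> A] (MS (\<Xi>\<^sub>1 @ [(r + s, X)] @ \<Xi>\<^sub>2) \<Gamma> A)"
| m_gexch: "rule_inst [MS (\<Xi>\<^sub>1 @ [(r, X), (s, Y)] @ \<Xi>\<^sub>2) \<Gamma> A]
    (MS (\<Xi>\<^sub>1 @ [(s, Y), (r, X)] @ \<Xi>\<^sub>2) \<Gamma> A)"
| m_gunitL: "rule_inst [MS (\<Xi>\<^sub>1 @ \<Xi>\<^sub>2) \<Gamma> A] (MS (\<Xi>\<^sub>1 @ [(r, J)] @ \<Xi>\<^sub>2) \<Gamma> A)"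
| m_gtensorL: "rule_inst [MS (\<Xi>\<^sub>1 @ [(r, X), (r, Y)] @ \<Xi>\<^sub>2) \<Gamma> A]
    (MS (\<Xi>\<^sub>1 @ [(r, GTensor X Y)] @ \<Xi>\<^sub>2) \<Gamma> A)"
  \<comment> \<open>the mixed system: rules on linear formulas\<close>
| m_id: "rule_inst [] (MS [] [A] A)"
| m_lexch: "rule_inst [MS \<Xi> (\<Gamma>\<^sub>1 @ [A, B] @ \<Gamma>\<^sub>2) C] (MS \<Xi> (\<Gamma>\<^sub>1 @ [B, A] @ \<Gamma>\<^sub>2) C)"
| m_unitR: "rule_inst [] (MS [] [] I)"
| m_unitL: "rule_inst [MS \<Xi> (\<Gamma>\<^sub>1 @ \<Gamma>\<^sub>2) A] (MS \<Xi> (\<Gamma>\<^sub>1 @ [I] @ \<Gamma>\<^sub>2) A)"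
| m_tensorR: "rule_inst [MS \<Xi>\<^sub>1 \<Gamma>\<^sub>1 A, MS \<Xi>\<^sub>2 \<Gamma>\<^sub>2 B] (MS (\<Xi>\<^sub>1 @ \<Xi>\<^sub>2) (\<Gamma>\<^sub>1 @ \<Gamma>\<^sub>2) (Tensor A B))"
| m_tensorL: "rule_inst [MS \<Xi> (\<Gamma>\<^sub>1 @ [A, B] @ \<Gamma>\<^sub>2) C] (MS \<Xi> (\<Gamma>\<^sub>1 @ [Tensor A B] @ \<Gamma>\<^sub>2) C)"
| m_lolliR: "rule_inst [MS \<Xi> (\<Gamma> @ [A]) B] (MS \<Xi> \<Gamma> (Lolli A B))"
| m_lolliL: "rule_inst [MS \<Xi>\<^sub>2 \<Gamma>\<^sub>2 A, MS \<Xi>\<^sub>1 (\<Gamma>\<^sub>1 @ [B] @ \<Gamma>\<^sub>3) C]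
    (MS (\<Xi>\<^sub>1 @ \<Xi>\<^sub>2) (\<Gamma>\<^sub>1 @ [Lolli A B] @ \<Gamma>\<^sub>2 @ \<Gamma>\<^sub>3) C)"
  \<comment> \<open>the mixed system: the modalities\<close>
| m_linL: "rule_inst [MS \<Xi> (A # \<Gamma>) B] (MS (\<Xi> @ [(1, Lin A)]) \<Gamma> B)"
| m_grdR: "rule_inst [GS \<Xi> X] (MS (scale r \<Xi>) [] (Grd r X))"
| m_grdL: "rule_inst [MS (\<Xi> @ [(r, X)]) \<Gamma> A] (MS \<Xi> (Grd r X # \<Gamma>) A)"

text \<open>The graded cuts are multicuts; the ordinary cut on one occurrence of the cut formula is
  the case of a singleton \<open>\<delta>\<close>.\<close>

inductive gcut_inst ::
  "'r::preordered_semiring gform \<Rightarrow> 'r sequent \<Rightarrow> 'r sequent \<Rightarrow> 'r sequent \<Rightarrow> bool" for X where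
  g_cut: "gcut_inst X (GS \<Xi>\<^sub>2 X) (GS (\<Xi>\<^sub>1 @ copies \<delta> X @ \<Xi>\<^sub>3) Y)
    (GS (\<Xi>\<^sub>1 @ multiscale \<delta> \<Xi>\<^sub>2 @ \<Xi>\<^sub>3) Y)"
| m_gcut: "gcut_inst X (GS \<Xi>\<^sub>2 X) (MS (\<Xi>\<^sub>1 @ copies \<delta> X @ \<Xi>\<^sub>3) \<Gamma> A)
    (MS (\<Xi>\<^sub>1 @ multiscale \<delta> \<Xi>\<^sub>2 @ \<Xi>\<^sub>3) \<Gamma> A)"

inductive lcut_inst ::
  "'r lform \<Rightarrow> 'r sequent \<Rightarrow> 'r sequent \<Rightarrow> 'r sequent \<Rightarrow> bool" for A where
  m_lcut: "lcut_inst A (MS \<Xi>\<^sub>2 \<Gamma>\<^sub>2 A) (MS \<Xi>\<^sub>1 (\<Gamma>\<^sub>1 @ [A] @ \<Gamma>\<^sub>3) B)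
    (MS (\<Xi>\<^sub>1 @ \<Xi>\<^sub>2) (\<Gamma>\<^sub>1 @ \<Gamma>\<^sub>2 @ \<Gamma>\<^sub>3) B)"


section \<open>Derivations and cut rank\<close>

text \<open>Derivation trees whose nodes carry their end sequent; cut nodes also carry the cut formula.\<close>

datatype 'r derivation =
    Infer "'r sequent" "'r derivation list"
  | GCut "'r gform" "'r sequent" "'r derivation" "'r derivation"
  | LCut "'r lform" "'r sequent" "'r derivation" "'r derivation"

inductive proof_of :: "'r::preordered_semiring derivation \<Rightarrow> 'r sequent \<Rightarrow> bool" where
  "rule_inst Ss S \<Longrightarrow> list_all2 proof_of \<Pi>s Ss \<Longrightarrow> proof_of (Infer S \<Pi>s) S"
| "gcut_inst X S\<^sub>1 S\<^sub>2 S \<Longrightarrow> proof_of \<Pi>\<^sub>1 S\<^sub>1 \<Longrightarrow> proof_of \<Pi>\<^sub>2 S\<^sub>2 \<Longrightarrow> proof_of (GCut X S \<Pi>\<^sub>1 \<Pi>\<^sub>2) S"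
| "lcut_inst A S\<^sub>1 S\<^sub>2 S \<Longrightarrow> proof_of \<Pi>\<^sub>1 S\<^sub>1 \<Longrightarrow> proof_of \<Pi>\<^sub>2 S\<^sub>2 \<Longrightarrow> proof_of (LCut A S \<Pi>\<^sub>1 \<Pi>\<^sub>2) S"

primrec gheight :: "'r gform \<Rightarrow> nat" and lheight :: "'r lform \<Rightarrow> nat" where
  "gheight J = 0"
| "gheight (GTensor X Y) = Suc (max (gheight X) (gheight Y))"
| "gheight (Lin A) = Suc (lheight A)"
| "lheight I = 0"
| "lheight (Tensor A B) = Suc (max (lheight A) (lheight B))"
| "lheight (Lolli A B) = Suc (max (lheight A) (lheight B))"
| "lheight (Grd r X) = Suc (gheight X)"

primrec cut_heights :: "'r derivation \<Rightarrow> nat set" where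
  "cut_heights (Infer S \<Pi>s) = (\<Union>H \<in> set (map cut_heights \<Pi>s). H)"
| "cut_heights (GCut X S \<Pi>\<^sub>1 \<Pi>\<^sub>2) = insert (gheight X) (cut_heights \<Pi>\<^sub>1 \<union> cut_heights \<Pi>\<^sub>2)"
| "cut_heights (LCut A S \<Pi>\<^sub>1 \<Pi>\<^sub>2) = insert (lheight A) (cut_heights \<Pi>\<^sub>1 \<union> cut_heights \<Pi>\<^sub>2)"

definition CutRank :: "'r derivation \<Rightarrow> nat" where
  "CutRank \<Pi> = (if cut_heights \<Pi> = {} then 0 else 1 + Max (cut_heights \<Pi>))"

primrec cut_free :: "'r derivation \<Rightarrow> bool" where
  "cut_free (Infer S \<Pi>s) \<longleftrightarrow> list_all (\<lambda>b. b) (map cut_free \<Pi>s)"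
| "cut_free (GCut X S \<Pi>\<^sub>1 \<Pi>\<^sub>2) \<longleftrightarrow> False"
| "cut_free (LCut A S \<Pi>\<^sub>1 \<Pi>\<^sub>2) \<longleftrightarrow> False"

lemma cut_free_iff_CutRank: "cut_free \<Pi> \<longleftrightarrow> CutRank \<Pi> = 0"
proof -
  have "cut_free \<Pi> \<longleftrightarrow> cut_heights \<Pi> = {}"
    by (induction \<Pi>) (auto simp: list_all_iff)
  then show ?thesis by (simp add: CutRank_def)
qed


section \<open>Algorithms over a preordered semiring\<close>

text \<open>Algorithms are first-order recursive programs computing on finite binary trees whose leaves
  may hold grades. The grades are arbitrary elements of an arbitrary preordered semiring, so they
  are accessible only through its signature: the constants \<open>0\<close> and \<open>1\<close>, the operations, and tests
  for \<open>=\<close> and \<open>\<le>\<close> (which already checking an instance of the approximation rule requires). In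
  particular, a program contains no grades other than \<open>0\<close> and \<open>1\<close>.\<close>

datatype 'r tree = Leaf | Grade 'r | Pair "'r tree" "'r tree"

text \<open>In \<open>Call f es\<close>, \<open>f\<close> is the position in the program of the body of the called function, and
  in a body \<open>Arg i\<close> is the \<open>i\<close>-th argument. Conditionals have their branches last.\<close>

datatype expr =
    Arg nat | ELeaf | EPair expr expr | Fst expr | Snd expr
  | EZero | EOne | EPlus expr expr | ETimes expr expr
  | IfPair expr expr expr | IfEq expr expr expr expr | IfLe expr expr expr expr
  | Call nat "expr list"

type_synonym program = "expr list"

text \<open>Big-step semantics; an expression that gets stuck or diverges has no value.\<close>

inductive evaluates ::
  "program \<Rightarrow> 'r::preordered_semiring tree list \<Rightarrow> expr \<Rightarrow> 'r tree \<Rightarrow> bool" for P where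
  "i < length vs \<Longrightarrow> evaluates P vs (Arg i) (vs ! i)"
| "evaluates P vs ELeaf Leaf"
| "evaluates P vs e\<^sub>1 v\<^sub>1 \<Longrightarrow> evaluates P vs e\<^sub>2 v\<^sub>2 \<Longrightarrow> evaluates P vs (EPair e\<^sub>1 e\<^sub>2) (Pair v\<^sub>1 v\<^sub>2)"
| "evaluates P vs e (Pair v\<^sub>1 v\<^sub>2) \<Longrightarrow> evaluates P vs (Fst e) v\<^sub>1"
| "evaluates P vs e (Pair v\<^sub>1 v\<^sub>2) \<Longrightarrow> evaluates P vs (Snd e) v\<^sub>2"
| "evaluates P vs EZero (Grade 0)"
| "evaluates P vs EOne (Grade 1)"
| "evaluates P vs e\<^sub>1 (Grade r) \<Longrightarrow> evaluates P vs e\<^sub>2 (Grade s) \<Longrightarrow>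
    evaluates P vs (EPlus e\<^sub>1 e\<^sub>2) (Grade (r + s))"
| "evaluates P vs e\<^sub>1 (Grade r) \<Longrightarrow> evaluates P vs e\<^sub>2 (Grade s) \<Longrightarrow>
    evaluates P vs (ETimes e\<^sub>1 e\<^sub>2) (Grade (r * s))"
| "evaluates P vs e v \<Longrightarrow> evaluates P vs (if \<exists>v\<^sub>1 v\<^sub>2. v = Pair v\<^sub>1 v\<^sub>2 then e\<^sub>1 else e\<^sub>2) w \<Longrightarrow>
    evaluates P vs (IfPair e e\<^sub>1 e\<^sub>2) w"
| "evaluates P vs e v \<Longrightarrow> evaluates P vs e' v' \<Longrightarrow>
    evaluates P vs (if v = v' then e\<^sub>1 else e\<^sub>2) w \<Longrightarrow> evaluates P vs (IfEq e e' e\<^sub>1 e\<^sub>2) w"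
| "evaluates P vs e (Grade r) \<Longrightarrow> evaluates P vs e' (Grade s) \<Longrightarrow>
    evaluates P vs (if r \<le> s then e\<^sub>1 else e\<^sub>2) w \<Longrightarrow> evaluates P vs (IfLe e e' e\<^sub>1 e\<^sub>2) w"
| "f < length P \<Longrightarrow> list_all2 (evaluates P vs) es ws \<Longrightarrow> evaluates P ws (P ! f) w \<Longrightarrow>
    evaluates P vs (Call f es) w"

text \<open>The program \<open>P\<close>, started in its first function on input \<open>v\<close>, terminates with output \<open>w\<close>.\<close>

definition computes :: "program \<Rightarrow> 'r::preordered_semiring tree \<Rightarrow> 'r tree \<Rightarrow> bool" where
  "computes P v w \<longleftrightarrow> P \<noteq> [] \<and> evaluates P [v] (P ! 0) w"

inductive_cases evaluates_elims:
  "evaluates P vs (Arg i) w" "evaluates P vs ELeaf w" "evaluates P vs (EPair e\<^sub>1 e\<^sub>2) w"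
  "evaluates P vs (Fst e) w" "evaluates P vs (Snd e) w" "evaluates P vs EZero w"
  "evaluates P vs EOne w" "evaluates P vs (EPlus e\<^sub>1 e\<^sub>2) w" "evaluates P vs (ETimes e\<^sub>1 e\<^sub>2) w"
  "evaluates P vs (IfPair e e\<^sub>1 e\<^sub>2) w" "evaluates P vs (IfEq e e' e\<^sub>1 e\<^sub>2) w"
  "evaluates P vs (IfLe e e' e\<^sub>1 e\<^sub>2) w" "evaluates P vs (Call f es) w"

lemma evaluates_deterministic:
  "evaluates P vs e v \<Longrightarrow> evaluates P vs e w \<Longrightarrow> v = w"
proof (induction arbitrary: w rule: evaluates.induct)
  case (13 f vs es ws v)
  from "13.prems" obtain ws' where *: "list_all2 (evaluates P vs) es ws'" "evaluates P ws' (P ! f) w"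
    by (auto elim: evaluates_elims)
  have "ws = ws'"
    using "13.IH"(1) *(1) by (auto simp: list_all2_conv_all_nth intro!: nth_equalityI)
  then show ?case using "13.IH"(2) * by blast
qed (erule evaluates_elims; blast)+

lemma computes_deterministic: "computes P v w \<Longrightarrow> computes P v w' \<Longrightarrow> w = w'"
  unfolding computes_def using evaluates_deterministic by blast


section \<open>Derivations as trees\<close>

definition tree_of_list :: "'r tree list \<Rightarrow> 'r tree" where
  "tree_of_list vs = foldr Pair vs Leaf"

definition node :: "nat \<Rightarrow> 'r tree list \<Rightarrow> 'r tree" where
  "node k vs = Pair (tree_of_list (replicate k Leaf)) (tree_of_list vs)"

primrec tree_of_gform :: "'r gform \<Rightarrow> 'r tree" and tree_of_lform :: "'r lform \<Rightarrow> 'r tree" where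
  "tree_of_gform J = node 0 []"
| "tree_of_gform (GTensor X Y) = node 1 [tree_of_gform X, tree_of_gform Y]"
| "tree_of_gform (Lin A) = node 2 [tree_of_lform A]"
| "tree_of_lform I = node 0 []"
| "tree_of_lform (Tensor A B) = node 1 [tree_of_lform A, tree_of_lform B]"
| "tree_of_lform (Lolli A B) = node 2 [tree_of_lform A, tree_of_lform B]"
| "tree_of_lform (Grd r X) = node 3 [Grade r, tree_of_gform X]"

definition tree_of_gctx :: "'r gctx \<Rightarrow> 'r tree" where
  "tree_of_gctx \<Xi> = tree_of_list (map (\<lambda>(r, X). Pair (Grade r) (tree_of_gform X)) \<Xi>)"

primrec tree_of_sequent :: "'r sequent \<Rightarrow> 'r tree" where
  "tree_of_sequent (GS \<Xi> X) = node 0 [tree_of_gctx \<Xi>, tree_of_gform X]"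
| "tree_of_sequent (MS \<Xi> \<Gamma> A) =
    node 1 [tree_of_gctx \<Xi>, tree_of_list (map tree_of_lform \<Gamma>), tree_of_lform A]"

primrec tree_of_derivation :: "'r derivation \<Rightarrow> 'r tree" where
  "tree_of_derivation (Infer S \<Pi>s) =
    node 0 [tree_of_sequent S, tree_of_list (map tree_of_derivation \<Pi>s)]"
| "tree_of_derivation (GCut X S \<Pi>\<^sub>1 \<Pi>\<^sub>2) =
    node 1 [tree_of_gform X, tree_of_sequent S, tree_of_derivation \<Pi>\<^sub>1, tree_of_derivation \<Pi>\<^sub>2]"
| "tree_of_derivation (LCut A S \<Pi>\<^sub>1 \<Pi>\<^sub>2) =
    node 2 [tree_of_lform A, tree_of_sequent S, tree_of_derivation \<Pi>\<^sub>1, tree_of_derivation \<Pi>\<^sub>2]"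

lemma tree_of_list_inject: "tree_of_list vs = tree_of_list ws \<longleftrightarrow> vs = ws"
proof (induction vs arbitrary: ws)
  case Nil
  show ?case by (cases ws) (auto simp: tree_of_list_def)
next
  case (Cons v vs)
  then show ?case by (cases ws) (auto simp: tree_of_list_def)
qed

lemma node_inject: "node k vs = node l ws \<longleftrightarrow> k = l \<and> vs = ws"
  by (simp add: node_def tree_of_list_inject replicate_eq_replicate)

lemma tree_of_form_inject:
  fixes X X' :: "'r gform" and A A' :: "'r lform"
  shows "tree_of_gform X = tree_of_gform X' \<longleftrightarrow> X = X'"
  "tree_of_lform A = tree_of_lform A' \<longleftrightarrow> A = A'"
proof (induction X and A arbitrary: X' and A' rule: gform.induct lform.induct)
  case J then show ?case by (cases X') (simp_all add: node_inject)
next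
  case (GTensor X Y) then show ?case by (cases X') (simp_all add: node_inject)
next
  case (Lin A) then show ?case by (cases X') (simp_all add: node_inject)
next
  case I then show ?case by (cases A') (simp_all add: node_inject)
next
  case (Tensor A B) then show ?case by (cases A') (simp_all add: node_inject)
next
  case (Lolli A B) then show ?case by (cases A') (simp_all add: node_inject)
next
  case (Grd r X) then show ?case by (cases A') (simp_all add: node_inject)
qed

lemma tree_of_gctx_inject: "tree_of_gctx \<Xi> = tree_of_gctx \<Xi>' \<longleftrightarrow> \<Xi> = \<Xi>'"
proof -
  have "inj (\<lambda>(r :: 'a, X). Pair (Grade r) (tree_of_gform X))"
    by (auto intro!: injI simp: tree_of_form_inject)
  then show ?thesis
    by (simp add: tree_of_gctx_def tree_of_list_inject inj_map_eq_map)
qed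

lemma tree_of_sequent_inject: "tree_of_sequent S = tree_of_sequent S' \<longleftrightarrow> S = S'"
proof -
  have "inj (tree_of_lform :: 'a lform \<Rightarrow> _)"
    by (auto intro!: injI simp: tree_of_form_inject)
  then show ?thesis
    by (cases S; cases S') (simp_all add: node_inject tree_of_gctx_inject tree_of_form_inject
        tree_of_list_inject inj_map_eq_map)
qed

lemma tree_of_derivation_inject: "tree_of_derivation \<Pi> = tree_of_derivation \<Pi>' \<longleftrightarrow> \<Pi> = \<Pi>'"
proof (induction \<Pi> arbitrary: \<Pi>')
  case (Infer S \<Pi>s)
  have "map tree_of_derivation \<Pi>s = map tree_of_derivation \<Pi>s' \<longleftrightarrow> \<Pi>s = \<Pi>s'" for \<Pi>s'
    using Infer by (auto simp: list_eq_iff_nth_eq)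
  then show ?case
    by (cases \<Pi>') (simp_all add: node_inject tree_of_sequent_inject tree_of_list_inject)
next
  case (GCut X S \<Pi>\<^sub>1 \<Pi>\<^sub>2)
  then show ?case
    by (cases \<Pi>') (simp_all add: node_inject tree_of_sequent_inject tree_of_form_inject)
next
  case (LCut A S \<Pi>\<^sub>1 \<Pi>\<^sub>2)
  then show ?case
    by (cases \<Pi>') (simp_all add: node_inject tree_of_sequent_inject tree_of_form_inject)
qed

end

theory Submission
  imports Defs "HOL-Library.Poly_Mapping" "HOL-Library.Multiset"
begin

text \<open>A graded context is turned into a function from named formulas to grades. A graded cut then
  becomes the substitution \<open>f(v := 0) + f(v) * g\<close>, a linear operation on contexts, which covers the
  multicut; its admissibility, together with that of the linear cut, follows by induction on the cut
  formula, with an inner induction first on the right and then on the left derivation.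
  All grades occurring in the resulting cut-free proof lie in the subsemiring generated by the
      grades
  of the given proof. Hence the algorithm can be an unbounded search: it enumerates all trees whose
  leaves carry such grades, reads each of them as a certificate for a cut-free proof, and stops at
  the first proof with the required end sequent. It terminates because the cut-free proof exists.\<close>

text \<open>A search is preferred to running the cut reductions because then only the existence of a
  cut-free proof needs an argument, not a program for every permutation of list contexts. The price
  is the confinement of grades: a program can write down only 0 and 1, so the existence proof must
  also say which grades suffice. It can, because cut reductions only add and multiply the given
  grades. The usual obstacle is contraction, which duplicates the cut formula above the cut. With
  functions as contexts it is addition at one variable and leaves no trace as a rule, so a single
  cut formula with a weight is enough. Each inner induction hands its principal cases to the caller
  as hypotheses. Thus the induction on the left derivation can be started inside a principal case on
  the right, with the right premises held fixed, and no measure on pairs of derivations is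
  needed.\<close>

abbreviation (input) "lookup \<equiv> Poly_Mapping.lookup"
abbreviation (input) "single \<equiv> Poly_Mapping.single"
abbreviation (input) "keys \<equiv> Poly_Mapping.keys"

section \<open>Contexts as grade functions\<close>

text \<open>Absence of a formula from a context has to be distinguished from its presence with grade
  \<open>0\<close>: the calculus adds occurrences of grade \<open>0\<close> but never deletes them, whereas sums of nonzero
  grades may vanish. So a fresh zero \<open>Absent\<close> is adjoined. Weakening is the inequality
  \<open>Absent \<le> Present 0\<close>.\<close>

datatype 'r with_zero = Absent | Present 'r

instantiation with_zero :: (preordered_semiring) preordered_semiring
begin

definition "0 = Absent"
definition "1 = Present 1"

fun plus_with_zero :: "'a with_zero \<Rightarrow> 'a with_zero \<Rightarrow> 'a with_zero" where
  "Absent + w = w"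
| "w + Absent = w"
| "Present r + Present s = Present (r + s)"

fun times_with_zero :: "'a with_zero \<Rightarrow> 'a with_zero \<Rightarrow> 'a with_zero" where
  "Present r * Present s = Present (r * s)"
| "_ * _ = Absent"

fun less_eq_with_zero :: "'a with_zero \<Rightarrow> 'a with_zero \<Rightarrow> bool" where
  "Absent \<le> Absent \<longleftrightarrow> True"
| "Absent \<le> Present s \<longleftrightarrow> 0 \<le> s"
| "Present r \<le> Present s \<longleftrightarrow> r \<le> s"
| "Present r \<le> Absent \<longleftrightarrow> False"

definition "v < w \<longleftrightarrow> v \<le> w \<and> \<not> w \<le> (v :: 'a with_zero)"

text \<open>This and the next lemma settle the monotonicity cases where a lower argument is
  \<open>Absent\<close>: the lower product is then \<open>Absent\<close>, and the lower sum is the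
  other summand.\<close>

lemma zero_absorb: "0 \<le> s \<Longrightarrow> 0 \<le> r * s" "0 \<le> s \<Longrightarrow> 0 \<le> s * r" for r s :: 'a
  using times_mono[of r r 0 s] times_mono[of 0 s r r] by simp_all

lemma zero_least: "0 \<le> s \<Longrightarrow> r \<le> t \<Longrightarrow> r \<le> t + s" "0 \<le> s \<Longrightarrow> r \<le> t \<Longrightarrow> r \<le> s + t" for r s t :: 'a
  using plus_mono[of r t 0 s] plus_mono[of 0 s r t] by simp_all

instance
proof
  fix a b c d :: "'a with_zero"
  show "a + b + c = a + (b + c)" by (cases a; cases b; cases c) (simp_all add: add.assoc)
  show "a + b = b + a" by (cases a; cases b) (simp_all add: add.commute)
  show "0 + a = a" by (simp add: zero_with_zero_def)
  show "a * b * c = a * (b * c)" by (cases a; cases b; cases c) (simp_all add: mult.assoc)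
  show "(a + b) * c = a * c + b * c" by (cases a; cases b; cases c) (simp_all add: distrib_right)
  show "a * (b + c) = a * b + a * c" by (cases a; cases b; cases c) (simp_all add: distrib_left)
  show "0 * a = 0" "a * 0 = 0" by (simp_all add: zero_with_zero_def)
  show "1 * a = a" "a * 1 = a" by (cases a; simp add: one_with_zero_def)+
  show "a < b \<longleftrightarrow> a \<le> b \<and> \<not> b \<le> a" by (simp add: less_with_zero_def)
  show "a \<le> a" by (cases a) simp_all
  show "a \<le> b \<Longrightarrow> b \<le> c \<Longrightarrow> a \<le> c" by (cases a; cases b; cases c) (auto intro: order_trans)
  show "a \<le> b \<Longrightarrow> c \<le> d \<Longrightarrow> a + c \<le> b + d"
    by (cases a; cases b; cases c; cases d) (auto intro: plus_mono zero_least)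
  show "a \<le> b \<Longrightarrow> c \<le> d \<Longrightarrow> a * c \<le> b * d"
    by (cases a; cases b; cases c; cases d) (auto intro: times_mono zero_absorb)
qed

end

text \<open>Sums of nonzero elements of the semiring may vanish, but a sum with a
  \<open>Present\<close> summand is always \<open>Present\<close>. Hence the support of a sum of
  contexts is the union of the supports.\<close>

lemma with_zero_add_eq_0: "v + w = 0 \<longleftrightarrow> v = 0 \<and> w = 0" for v w :: "'r::preordered_semiring with_zero"
  by (cases v; cases w) (simp_all add: zero_with_zero_def)

declare split_paired_All [simp del] split_paired_Ex [simp del]

text \<open>The name in a variable keeps several occurrences of the same formula apart, since contraction
  cannot be undone.\<close>

type_synonym 'r var = "nat \<times> 'r gform"
type_synonym 'r ctx = "'r var \<Rightarrow>\<^sub>0 'r with_zero"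

definition ctx_scale :: "'r::preordered_semiring with_zero \<Rightarrow> 'r ctx \<Rightarrow> 'r ctx" where
  "ctx_scale w f = Poly_Mapping.map ((*) w) f"

lemma lookup_ctx_scale [simp]: "lookup (ctx_scale w f) v = w * lookup f v"
  by (cases "lookup f v = 0") (simp_all add: ctx_scale_def Poly_Mapping.map.rep_eq)

definition ctx_le :: "'r::preordered_semiring ctx \<Rightarrow> 'r ctx \<Rightarrow> bool" where
  "ctx_le f g \<longleftrightarrow> (\<forall>v. lookup f v \<le> lookup g v)"

definition ctx_subst :: "'r::preordered_semiring var \<Rightarrow> 'r ctx \<Rightarrow> 'r ctx \<Rightarrow> 'r ctx" where
  "ctx_subst v g f = Poly_Mapping.update v 0 f + ctx_scale (lookup f v) g"

text \<open>As \<open>ctx_subst v g\<close> is a linear map on contexts, it commutes with every inference rule that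
    does not
  introduce \<open>v\<close>, without any splitting of contexts into occurrences of \<open>v\<close> and the rest.\<close>

lemma lookup_ctx_subst:
  "lookup (ctx_subst v g f) u = (if u = v then 0 else lookup f u) + lookup f v * lookup g u"
  by (simp add: ctx_subst_def lookup_add lookup_update)

lemma ctx_scale_simps [simp]: "ctx_scale w 0 = 0" "ctx_scale 1 f = f" "ctx_scale w (single v r) =
    single v (w * r)" "ctx_scale 0 f = 0"
  by (auto intro!: poly_mapping_eqI simp: lookup_single when_def)

lemma ctx_scale_add: "ctx_scale w (f + g) = ctx_scale w f + ctx_scale w g"
  by (auto intro!: poly_mapping_eqI simp: lookup_add distrib_left)

lemma ctx_subst_0 [simp]: "ctx_subst v g 0 = 0"
  by (auto intro!: poly_mapping_eqI simp: lookup_ctx_subst)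

lemma ctx_subst_add: "ctx_subst v g (f + f') = ctx_subst v g f + ctx_subst v g f'"
  by (auto intro!: poly_mapping_eqI simp: lookup_ctx_subst lookup_add algebra_simps)

lemma ctx_subst_ctx_scale: "ctx_subst v g (ctx_scale w f) = ctx_scale w (ctx_subst v g f)"
  by (auto intro!: poly_mapping_eqI simp: lookup_ctx_subst distrib_left mult.assoc)

lemma ctx_subst_single: "ctx_subst v g (single u w) = (if u = v then ctx_scale w g else single u w)"
  by (auto intro!: poly_mapping_eqI simp: lookup_ctx_subst lookup_single when_def)

lemma ctx_subst_fresh: "lookup f v = 0 \<Longrightarrow> ctx_subst v g f = f"
  by (auto intro!: poly_mapping_eqI simp: lookup_ctx_subst)

lemma ctx_le_refl: "ctx_le f f" by (simp add: ctx_le_def)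

lemma ctx_le_add: "ctx_le f g \<Longrightarrow> ctx_le f' g' \<Longrightarrow> ctx_le (f + f') (g + g')"
  by (simp add: ctx_le_def lookup_add plus_mono)

lemma ctx_le_ctx_scale: "w \<le> w' \<Longrightarrow> ctx_le f g \<Longrightarrow> ctx_le (ctx_scale w f) (ctx_scale w' g)"
  by (simp add: ctx_le_def times_mono)

lemma ctx_le_ctx_subst: "ctx_le f f' \<Longrightarrow> ctx_le (ctx_subst v g f) (ctx_subst v g f')"
  by (simp add: ctx_le_def lookup_ctx_subst plus_mono times_mono)

lemma keys_add_eq: "keys (f + g) = keys f \<union> keys g" for f g :: "'r::preordered_semiring ctx"
  by (auto simp: in_keys_iff lookup_add with_zero_add_eq_0)

lemma keys_ctx_scale: "keys (ctx_scale w f) \<subseteq> keys f"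
  by (auto simp: in_keys_iff)

section \<open>Cut elimination for named contexts\<close>

datatype 'r goal = Gr "'r gform" | Ln "'r lform"

text \<open>All grades of a derivation are kept in a subsemiring \<open>R\<close>: a program can only produce grades
  in the subsemiring generated by its input.\<close>

locale grades =
  fixes R :: "'r::preordered_semiring set"
  assumes zero_in: "0 \<in> R" and one_in: "1 \<in> R"
    and plus_in: "r \<in> R \<Longrightarrow> s \<in> R \<Longrightarrow> r + s \<in> R"
    and times_in: "r \<in> R \<Longrightarrow> s \<in> R \<Longrightarrow> r * s \<in> R"
begin

definition grade_ok :: "'r with_zero \<Rightarrow> bool" where
  "grade_ok w \<longleftrightarrow> set_with_zero w \<subseteq> R"

lemma grade_ok_simps [simp]: "grade_ok Absent" "grade_ok (Present r) \<longleftrightarrow> r \<in> R" "grade_ok 0"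
    "grade_ok 1"
  by (simp_all add: grade_ok_def zero_with_zero_def one_with_zero_def one_in)

lemma grade_ok_plus: "grade_ok v \<Longrightarrow> grade_ok w \<Longrightarrow> grade_ok (v + w)"
  by (cases v; cases w) (simp_all add: plus_in)

lemma grade_ok_times: "grade_ok v \<Longrightarrow> grade_ok w \<Longrightarrow> grade_ok (v * w)"
  by (cases v; cases w) (simp_all add: times_in)

abbreviation gform_ok :: "'r gform \<Rightarrow> bool" where "gform_ok X \<equiv> set_gform X \<subseteq> R"
abbreviation lform_ok :: "'r lform \<Rightarrow> bool" where "lform_ok A \<equiv> set_lform A \<subseteq> R"

definition ctx_ok :: "'r ctx \<Rightarrow> bool" where
  "ctx_ok f \<longleftrightarrow> (\<forall>v. grade_ok (lookup f v)) \<and> (\<forall>v\<in>keys f. gform_ok (snd v))"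

lemma ctx_ok_0 [simp]: "ctx_ok 0" by (simp add: ctx_ok_def)

lemma ctx_ok_lookup: "ctx_ok f \<Longrightarrow> grade_ok (lookup f v)" by (simp add: ctx_ok_def)

lemma ctx_ok_add: "ctx_ok f \<Longrightarrow> ctx_ok g \<Longrightarrow> ctx_ok (f + g)"
  by (auto simp: ctx_ok_def lookup_add grade_ok_plus keys_add_eq)

lemma ctx_ok_ctx_scale: "grade_ok w \<Longrightarrow> ctx_ok f \<Longrightarrow> ctx_ok (ctx_scale w f)"
  using keys_ctx_scale[of w f] by (auto simp: ctx_ok_def grade_ok_times)

lemma ctx_ok_single: "grade_ok w \<Longrightarrow> w = 0 \<or> gform_ok (snd v) \<Longrightarrow> ctx_ok (single v w)"
  by (auto simp: ctx_ok_def lookup_single when_def in_keys_iff)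

lemma ctx_ok_ctx_subst: "ctx_ok f \<Longrightarrow> ctx_ok g \<Longrightarrow> ctx_ok (ctx_subst v g f)"
proof -
  assume "ctx_ok f" "ctx_ok g"
  then have "ctx_ok (Poly_Mapping.update v 0 f)"
    by (auto simp: ctx_ok_def lookup_update in_keys_iff split: if_splits)
  then show ?thesis
    unfolding ctx_subst_def using \<open>ctx_ok f\<close> \<open>ctx_ok g\<close> by (intro ctx_ok_add ctx_ok_ctx_scale
        ctx_ok_lookup)
qed

text \<open>Freshness matters: that a sum lies in \<open>R\<close> says nothing about its summands,
  whereas at a fresh variable the sum is \<open>w\<close> itself.\<close>

lemma ctx_ok_fresh:
  assumes "ctx_ok (f + single v w)" "v \<notin> keys f"
  shows "ctx_ok f" "w = 0 \<or> gform_ok (snd v)" "grade_ok w"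
proof -
  have *: "lookup (f + single v w) u = lookup f u + (if u = v then w else 0)" for u
    by (simp add: lookup_add lookup_single when_def)
  have z: "lookup f v = 0" using assms(2) by (simp add: in_keys_iff)
  show "grade_ok w" using ctx_ok_lookup[OF assms(1), of v] z * by simp
  show "ctx_ok f" unfolding ctx_ok_def
  proof (intro conjI allI ballI)
    fix u show "grade_ok (lookup f u)"
      using ctx_ok_lookup[OF assms(1), of u] z * by (cases "u = v") auto
  next
    fix u assume "u \<in> keys f" then show "gform_ok (snd u)"
      using assms(1) by (auto simp: ctx_ok_def keys_add_eq)
  qed
  show "w = 0 \<or> gform_ok (snd v)"
    using assms(1) by (auto simp: ctx_ok_def keys_add_eq)
qed

text \<open>The premises of \<open>tensorL\<close> and \<open>grdL\<close> are quantified over all but finitely many names, so that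
  the induction hypotheses avoid the variable being substituted. Weakening is contained in \<open>sub\<close>;
  contraction and exchange are implicit in the addition of contexts.\<close>

inductive der :: "'r ctx \<Rightarrow> 'r lform multiset \<Rightarrow> 'r goal \<Rightarrow> bool" where
  idG: "gform_ok X \<Longrightarrow> der (single (n, X) 1) {#} (Gr X)"
| sub: "der f \<Gamma> C \<Longrightarrow> ctx_le f f' \<Longrightarrow> ctx_ok f' \<Longrightarrow> der f' \<Gamma> C"
| unitL: "der f \<Gamma> C \<Longrightarrow> grade_ok w \<Longrightarrow> der (f + single (n, J) w) \<Gamma> C"
| tensorL: "finite L \<Longrightarrow>
    (\<And>a b. a \<notin> L \<Longrightarrow> b \<notin> L \<Longrightarrow> a \<noteq> b \<Longrightarrow> der (f + single (a, X) w + single (b, Y) w) \<Gamma> C) \<Longrightarrow>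
    grade_ok w \<Longrightarrow> der (f + single (c, GTensor X Y) w) \<Gamma> C"
| unitR: "der 0 {#} (Gr J)"
| tensorR: "der f {#} (Gr X) \<Longrightarrow> der g {#} (Gr Y) \<Longrightarrow> der (f + g) {#} (Gr (GTensor X Y))"
| linR: "der f {#} (Ln A) \<Longrightarrow> der f {#} (Gr (Lin A))"
| idL: "lform_ok A \<Longrightarrow> der 0 {#A#} (Ln A)"
| lunitR: "der 0 {#} (Ln I)"
| lunitL: "der f \<Gamma> (Ln A) \<Longrightarrow> der f (add_mset I \<Gamma>) (Ln A)"
| ltensorR: "der f \<Gamma> (Ln A) \<Longrightarrow> der g \<Delta> (Ln B) \<Longrightarrow> der (f + g) (\<Gamma> + \<Delta>) (Ln (Tensor A B))"
| ltensorL: "der f (add_mset A (add_mset B \<Gamma>)) (Ln C) \<Longrightarrow> der f (add_mset (Tensor A B) \<Gamma>) (Ln C)"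
| lolliR: "der f (add_mset A \<Gamma>) (Ln B) \<Longrightarrow> der f \<Gamma> (Ln (Lolli A B))"
| lolliL: "der f \<Gamma> (Ln A) \<Longrightarrow> der g (add_mset B \<Delta>) (Ln C) \<Longrightarrow>
    der (f + g) (add_mset (Lolli A B) (\<Gamma> + \<Delta>)) (Ln C)"
| linL: "der f (add_mset A \<Gamma>) (Ln B) \<Longrightarrow> der (f + single (n, Lin A) 1) \<Gamma> (Ln B)"
| grdR: "der f {#} (Gr X) \<Longrightarrow> r \<in> R \<Longrightarrow> der (ctx_scale (Present r) f) {#} (Ln (Grd r X))"
| grdL: "finite L \<Longrightarrow> (\<And>a. a \<notin> L \<Longrightarrow> der (f + single (a, X) (Present r)) \<Gamma> (Ln A)) \<Longrightarrow>
    r \<in> R \<Longrightarrow> gform_ok X \<Longrightarrow> der f (add_mset (Grd r X) \<Gamma>) (Ln A)"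

lemma fresh_nat: "finite L \<Longrightarrow> \<exists>a::nat. a \<notin> L"
  by (rule ex_new_if_finite) simp_all

lemma fresh_var: "finite L \<Longrightarrow> \<exists>a. a \<notin> L \<and> (\<forall>X. (a, X) \<notin> keys (f :: 'r ctx))"
proof -
  assume "finite L"
  then obtain a where "a \<notin> L \<union> fst ` keys f" using fresh_nat[of "L \<union> fst ` keys f"] by auto
  then show ?thesis by (intro exI[of _ a]) force
qed

primrec goal_ok :: "'r goal \<Rightarrow> bool" where "goal_ok (Gr X) = gform_ok X" | "goal_ok (Ln A) =
    lform_ok A"

text \<open>In the cases \<open>tensorL\<close> and \<open>grdL\<close> the premises are taken at
  names fresh for \<open>f\<close>, so that \<open>ctx_ok_fresh\<close> can strip off the new
  entries one by one.\<close>

lemma der_ok: "der f \<Gamma> C \<Longrightarrow> ctx_ok f \<and> (\<forall>A\<in>#\<Gamma>. lform_ok A) \<and> goal_ok C"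
proof (induction rule: der.induct)
  case (tensorL L f X w Y \<Gamma> C c)
  obtain a where a: "a \<notin> L" "\<And>X. (a, X) \<notin> keys f" using fresh_var[OF tensorL(1), of f] by blast
  obtain b where b: "b \<notin> insert a L" "\<And>X. (b, X) \<notin> keys f"
    using fresh_var[of "insert a L" f] tensorL(1) by blast
  have ih: "ctx_ok (f + single (a, X) w + single (b, Y) w)" "\<forall>A\<in>#\<Gamma>. lform_ok A" "goal_ok C"
    using tensorL.IH[of a b] a b by auto
  have "ctx_ok (f + single (a, X) w)" "w = 0 \<or> gform_ok Y"
    using ctx_ok_fresh[OF ih(1)] b by (auto simp: keys_add_eq split: if_splits)
  moreover have "ctx_ok f" "w = 0 \<or> gform_ok X" using ctx_ok_fresh[of f "(a, X)"
      w] calculation a by auto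
  ultimately show ?case using ih tensorL by (auto intro!: ctx_ok_add ctx_ok_single)
next
  case (grdL L f X r \<Gamma> A)
  obtain a where a: "a \<notin> L" "\<And>X. (a, X) \<notin> keys f" using fresh_var[OF grdL(1), of f] by blast
  then show ?case using grdL.IH[of a] ctx_ok_fresh[of f "(a, X)" "Present r"] grdL by auto
qed (auto intro!: ctx_ok_add ctx_ok_ctx_scale ctx_ok_single zero_in one_in)

text \<open>\<open>gprinc g X\<close> and \<open>lprinc g \<Gamma> A\<close> collect the premises of the right rule for the formula.\<close>

definition gprinc :: "'r ctx \<Rightarrow> 'r gform \<Rightarrow> bool" where
  "gprinc g X \<longleftrightarrow> (case X of J \<Rightarrow> g = 0
    | GTensor Y Z \<Rightarrow> \<exists>g\<^sub>1 g\<^sub>2. g = g\<^sub>1 + g\<^sub>2 \<and> der g\<^sub>1 {#} (Gr Y) \<and> der g\<^sub>2 {#} (Gr Z)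
    | Lin A \<Rightarrow> der g {#} (Ln A))"

text \<open>Induction on the left derivation, with \<open>h\<close> as the fixed rest of the
  right-hand context and \<open>w\<close> as the weight of the cut formula. A rule on the graded
  context of \<open>g\<close> is repeated below the cut with its entries scaled by \<open>w\<close>.
  An identity on the left hands over the right premise under whatever name it carries, which is why
  all names are assumed; a right rule yields the principal case \<open>gprinc\<close>.\<close>

lemma gcut_left:
  assumes "der g {#} (Gr X)" "ctx_ok h" "grade_ok w"
    and "\<And>n. der (h + single (n, X) w) \<Gamma> C"
    and "\<And>g. gprinc g X \<Longrightarrow> der (h + ctx_scale w g) \<Gamma> C"
  shows "der (h + ctx_scale w g) \<Gamma> C"
  using assms(1)
proof (induction g "{#} :: 'r lform multiset" "Gr X" rule: der.induct)
  case (idG n)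
  then show ?case using assms(4) by simp
next
  case (sub f f')
  then show ?case using assms(2,3)
    by (intro der.sub[of "h + ctx_scale w f" _ _ "h + ctx_scale w f'"] ctx_le_add ctx_le_refl
        ctx_le_ctx_scale ctx_ok_add ctx_ok_ctx_scale) auto
next
  case (unitL f w' n)
  then have "der ((h + ctx_scale w f) + single (n, J) (w * w')) \<Gamma> C"
    using assms(3) by (intro der.unitL grade_ok_times) auto
  then show ?case by (simp add: ctx_scale_add add.assoc)
next
  case (tensorL L f X' w' Y c)
  then have "der ((h + ctx_scale w f) + single (c, GTensor X' Y) (w * w')) \<Gamma> C"
    using assms(3) by (intro der.tensorL[of L] grade_ok_times) (auto simp: ctx_scale_add add.assoc)
  then show ?case by (simp add: ctx_scale_add add.assoc)
next
  case unitR
  then show ?case using assms(5)[of 0] by (simp add: gprinc_def)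
next
  case (tensorR f Y g Z)
  then have "gprinc (f + g) X" unfolding gprinc_def tensorR(5)[symmetric] gform.case by blast
  then show ?case by (rule assms(5))
next
  case (linR f A)
  then show ?case using assms(5)[of f] by (auto simp: gprinc_def)
qed

text \<open>By linearity the substitution passes through every rule unless the last one introduces
  the variable \<open>(m, X)\<close> itself. There the induction hypothesis has already replaced all
  other occurrences, and only the contribution of the introduced one, a multiple of
  \<open>g\<close>, is still to be added; this is what \<open>hJ\<close>, \<open>hT\<close> and
  \<open>hL\<close> provide. In the identity case the result is \<open>g\<close>.\<close>

lemma gcut_right:
  assumes "der f \<Gamma> C" and g: "der g {#} (Gr X)"
    and hJ: "\<And>h w \<Gamma> C. X = J \<Longrightarrow> grade_ok w \<Longrightarrow> der h \<Gamma> C \<Longrightarrow> der (h + ctx_scale w g) \<Gamma> C"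
    and hT: "\<And>L h w \<Gamma> C Y Z. X = GTensor Y Z \<Longrightarrow> finite L \<Longrightarrow> grade_ok w \<Longrightarrow>
      (\<And>a b. a \<notin> L \<Longrightarrow> b \<notin> L \<Longrightarrow> a \<noteq> b \<Longrightarrow> der (h + single (a, Y) w + single (b, Z) w) \<Gamma> C) \<Longrightarrow>
      der (h + ctx_scale w g) \<Gamma> C"
    and hL: "\<And>h A \<Gamma> B. X = Lin A \<Longrightarrow> der h (add_mset A \<Gamma>) (Ln B) \<Longrightarrow> der (h + g) \<Gamma> (Ln B)"
  shows "der (ctx_subst (m, X) g f) \<Gamma> C"
  using assms(1)
proof (induction rule: der.induct)
  case (idG Y n)
  then show ?case using g by (auto simp: ctx_subst_single intro: der.idG)
next
  case (sub f \<Gamma> C f')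
  then show ?case using der_ok[OF g] by (auto intro: der.sub ctx_le_ctx_subst ctx_ok_ctx_subst)
next
  case (unitL f \<Gamma> C w n)
  then show ?case using hJ[of w] by (auto simp: ctx_subst_add ctx_subst_single intro: der.unitL)
next
  case (tensorL L f Y w Z \<Gamma> C c)
  \<comment> \<open>Names equal to \<open>m\<close> are excluded because \<open>(a, Y)\<close> or
    \<open>(b, Z)\<close> could be the very variable being replaced.\<close>
  have *: "der (ctx_subst (m, X) g f + single (a, Y) w + single (b, Z) w) \<Gamma> C"
    if "a \<notin> insert m L" "b \<notin> insert m L" "a \<noteq> b" for a b
    using tensorL.IH[of a b] that by (auto simp: ctx_subst_add ctx_subst_single)
  show ?case
  proof (cases "(c, GTensor Y Z) = (m, X)")
    case True
    then have "der (ctx_subst (m, X) g f + ctx_scale w g) \<Gamma> C"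
      using tensorL.hyps(1,3) by (intro hT[of Y Z "insert m L"] *) auto
    then show ?thesis using True by (simp add: ctx_subst_add ctx_subst_single)
  next
    case False
    then have "ctx_subst (m, X) g (f + single (c, GTensor Y Z) w) =
        ctx_subst (m, X) g f + single (c, GTensor Y Z) w"
      by (simp only: ctx_subst_add ctx_subst_single if_False)
    then show ?thesis using der.tensorL[of "insert m L", OF _ *] tensorL.hyps(1,3) by simp
  qed
next
  case (linL f A \<Gamma> B n)
  then show ?case using hL[of A] by (auto simp: ctx_subst_add ctx_subst_single intro: der.linL)
next
  case (grdL L f Y r \<Gamma> A)
  have "der (ctx_subst (m, X) g f + single (a, Y) (Present r)) \<Gamma> (Ln A)" if "a \<notin> insert m L" for a
    using grdL.IH[of a] that by (auto simp: ctx_subst_add ctx_subst_single)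
  then show ?case using der.grdL[of "insert m L"] grdL.hyps(1,3,4) by simp
qed (auto simp: ctx_subst_add ctx_subst_ctx_scale intro: der.intros)

definition lprinc :: "'r ctx \<Rightarrow> 'r lform multiset \<Rightarrow> 'r lform \<Rightarrow> bool" where
  "lprinc g \<Gamma> A \<longleftrightarrow> (case A of I \<Rightarrow> g = 0 \<and> \<Gamma> = {#}
    | Tensor P Q \<Rightarrow> \<exists>g\<^sub>1 g\<^sub>2 \<Gamma>\<^sub>1 \<Gamma>\<^sub>2. g = g\<^sub>1 + g\<^sub>2 \<and> \<Gamma> = \<Gamma>\<^sub>1 + \<Gamma>\<^sub>2 \<and> der g\<^sub>1 \<Gamma>\<^sub>1 (Ln P) \<and>
        der g\<^sub>2 \<Gamma>\<^sub>2 (Ln Q)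
    | Lolli P Q \<Rightarrow> der g (add_mset P \<Gamma>) (Ln Q)
    | Grd r X \<Rightarrow> \<exists>f. g = ctx_scale (Present r) f \<and> \<Gamma> = {#} \<and> r \<in> R \<and> der f {#} (Gr X))"

text \<open>The linear counterpart of \<open>gcut_left\<close>, without weights: the last rule on
  the left acts on contexts and is repeated below the cut, or is the identity, or introduces
  \<open>A\<close> on the right. In the case \<open>lolliL\<close> only the second premise is cut,
  since it carries the conclusion of the rule.\<close>

lemma lcut_left:
  assumes "der g \<Gamma> (Ln A)" "ctx_ok h"
    and "der h (add_mset A \<Delta>) (Ln B)"
    and "\<And>g \<Gamma>. lprinc g \<Gamma> A \<Longrightarrow> der (g + h) (\<Gamma> + \<Delta>) (Ln B)"
  shows "der (g + h) (\<Gamma> + \<Delta>) (Ln B)"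
  using assms(1)
proof (induction g \<Gamma> "Ln A" rule: der.induct)
  case (sub f \<Gamma> f')
  then show ?case using assms(2) by (intro der.sub[of "f + h"
      _ _ "f' + h"] ctx_le_add ctx_le_refl ctx_ok_add) auto
next
  case (unitL f \<Gamma> w n)
  then have "der ((f + h) + single (n, J) w) (\<Gamma> + \<Delta>) (Ln B)" by (intro der.unitL) auto
  then show ?case by (simp add: ac_simps)
next
  case (tensorL L f X w Y \<Gamma> c)
  then have "der ((f + h) + single (c, GTensor X Y) w) (\<Gamma> + \<Delta>) (Ln B)"
    by (intro der.tensorL[of L]) (auto simp: ac_simps)
  then show ?case by (simp add: ac_simps)
next
  case idL
  then show ?case using assms(3) by simp
next
  case lunitR
  then show ?case using assms(4)[of 0 "{#}"] by (simp add: lprinc_def)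
next
  case (lunitL f \<Gamma>)
  then show ?case by (auto intro: der.lunitL)
next
  case (ltensorR f \<Gamma> P g \<Delta>' Q)
  then have "lprinc (f + g) (\<Gamma> + \<Delta>') A" unfolding lprinc_def ltensorR(5)[symmetric] lform.case by
      blast
  then show ?case by (rule assms(4))
next
  case (ltensorL f P Q \<Gamma>)
  then show ?case by (auto intro: der.ltensorL)
next
  case (lolliR f P \<Gamma> Q)
  then show ?case using assms(4)[of f \<Gamma>] by (auto simp: lprinc_def)
next
  case (lolliL f \<Gamma> P g Q \<Delta>')
  then have "der (f + (g + h)) (add_mset (Lolli P Q) (\<Gamma> + (\<Delta>' + \<Delta>))) (Ln B)"
    by (intro der.lolliL) auto
  then show ?case by (simp add: ac_simps)
next
  case (linL f P \<Gamma> n)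
  then have "der ((f + h) + single (n, Lin P) 1) (\<Gamma> + \<Delta>) (Ln B)" by (intro der.linL) auto
  then show ?case by (simp add: ac_simps)
next
  case (grdR f X r)
  then have "lprinc (ctx_scale (Present r) f) {#} A" unfolding lprinc_def grdR(3)[symmetric]
      lform.case by blast
  then show ?case by (rule assms(4))
next
  case (grdL L f X r \<Gamma>)
  then have "der (f + h) (add_mset (Grd r X) (\<Gamma> + \<Delta>)) (Ln B)"
    by (intro der.grdL[of L]) (auto simp: ac_simps)
  then show ?case by (simp add: ac_simps)
qed

text \<open>Equal formulas in a multiset are interchangeable. So if the last rule introduces a
  formula equal to \<open>A\<close>, that occurrence can be taken as the cut one; otherwise some
  occurrence of \<open>A\<close> comes from a premise and is cut there.\<close>

lemma lcut_right:
  assumes "der f \<Gamma> C" "A \<in># \<Gamma>" and g: "der g \<Gamma>' (Ln A)"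
    and hI: "\<And>h \<Delta> B. A = I \<Longrightarrow> der h \<Delta> (Ln B) \<Longrightarrow> der (g + h) (\<Gamma>' + \<Delta>) (Ln B)"
    and hT: "\<And>h \<Delta> P Q B. A = Tensor P Q \<Longrightarrow> der h (add_mset P (add_mset Q \<Delta>)) (Ln B) \<Longrightarrow>
      der (g + h) (\<Gamma>' + \<Delta>) (Ln B)"
    and hL: "\<And>h h' \<Delta> \<Delta>' P Q B. A = Lolli P Q \<Longrightarrow> der h \<Delta> (Ln P) \<Longrightarrow>
      der h' (add_mset Q \<Delta>') (Ln B) \<Longrightarrow> der (g + (h + h')) (\<Gamma>' + (\<Delta> + \<Delta>')) (Ln B)"
    and hG: "\<And>L h \<Delta> r X B. A = Grd r X \<Longrightarrow> finite L \<Longrightarrow> r \<in> R \<Longrightarrow> gform_ok X \<Longrightarrow>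
      (\<And>a. a \<notin> L \<Longrightarrow> der (h + single (a, X) (Present r)) \<Delta> (Ln B)) \<Longrightarrow>
      der (g + h) (\<Gamma>' + \<Delta>) (Ln B)"
  shows "der (g + f) (\<Gamma>' + (\<Gamma> - {#A#})) C"
  using assms(1,2)
proof (induction rule: der.induct)
  case (sub f \<Gamma> C f')
  then show ?case using der_ok[OF g] by (intro der.sub[of "g + f"
      _ _ "g + f'"] ctx_le_add ctx_le_refl ctx_ok_add) auto
next
  case (unitL f \<Gamma> C w n)
  then have "der ((g + f) + single (n, J) w) (\<Gamma>' + (\<Gamma> - {#A#})) C" by (intro der.unitL) auto
  then show ?case by (simp add: add.assoc)
next
  case (tensorL L f X w Y \<Gamma> C c)
  then have "der ((g + f) + single (c, GTensor X Y) w) (\<Gamma>' + (\<Gamma> - {#A#})) C"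
    by (intro der.tensorL[of L]) (auto simp: add.assoc)
  then show ?case by (simp add: add.assoc)
next
  case idL
  then show ?case using g by simp
next
  case (lunitL f \<Gamma> B)
  show ?case
  proof (cases "A = I")
    case True
    then show ?thesis using hI lunitL by simp
  next
    case False
    then obtain \<Delta> where "\<Gamma> = add_mset A \<Delta>" using lunitL(3) by (auto dest: multi_member_split)
    then show ?thesis using lunitL.IH False der.lunitL[of "g + f" "\<Gamma>' + \<Delta>"] by simp
  qed
next
  case (ltensorR f \<Gamma> P h \<Delta> Q)
  then consider "A \<in># \<Gamma>" | "A \<in># \<Delta>" by auto
  then show ?case
  proof cases
    case 1
    then obtain \<Gamma>\<^sub>0 where "\<Gamma> = add_mset A \<Gamma>\<^sub>0" by (auto dest: multi_member_split)
    then show ?thesis using ltensorR(3)[OF 1] der.ltensorR[of "g + f" "\<Gamma>' + \<Gamma>\<^sub>0"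
        P h \<Delta> Q] ltensorR(2)
      by (simp add: ac_simps)
  next
    case 2
    then obtain \<Gamma>\<^sub>0 where "\<Delta> = add_mset A \<Gamma>\<^sub>0" by (auto dest: multi_member_split)
    then show ?thesis using ltensorR(4)[OF 2] der.ltensorR[of f \<Gamma> P "g + h" "\<Gamma>' + \<Gamma>\<^sub>0"
        Q] ltensorR(1)
      by (simp add: ac_simps)
  qed
next
  case (ltensorL f P Q \<Gamma> B)
  show ?case
  proof (cases "A = Tensor P Q")
    case True
    then show ?thesis using hT ltensorL by simp
  next
    case False
    then obtain \<Delta> where "\<Gamma> = add_mset A \<Delta>" using ltensorL(3) by (auto dest: multi_member_split)
    then show ?thesis
      using ltensorL.IH False der.ltensorL[of "g + f" P Q "\<Gamma>' + \<Delta>"]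
      by (simp add: add_mset_commute[of _ A])
  qed
next
  case (lolliR f P \<Gamma> B)
  then obtain \<Delta> where "\<Gamma> = add_mset A \<Delta>" by (auto dest: multi_member_split)
  then show ?case using lolliR der.lolliR[of "g + f" P "\<Gamma>' + \<Delta>"] by (simp add: add_mset_commute[of
      _ A])
next
  case (lolliL f \<Gamma> P h Q \<Delta> B)
  show ?case
  proof (cases "A = Lolli P Q")
    case True
    then show ?thesis using hL lolliL by simp
  next
    case False
    then consider "A \<in># \<Gamma>" | "A \<in># \<Delta>" using lolliL.prems by auto
    then show ?thesis
    proof cases
      case 1
      then obtain \<Gamma>\<^sub>0 where "\<Gamma> = add_mset A \<Gamma>\<^sub>0" by (auto dest: multi_member_split)
      then show ?thesis
        using lolliL(3)[OF 1] der.lolliL[of "g + f" "\<Gamma>' + \<Gamma>\<^sub>0" P h Q \<Delta>] lolliL(2) False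
        by (simp add: ac_simps)
    next
      case 2
      then obtain \<Gamma>\<^sub>0 where "\<Delta> = add_mset A \<Gamma>\<^sub>0" by (auto dest: multi_member_split)
      then show ?thesis
        using lolliL(4) der.lolliL[of f \<Gamma> P "g + h" Q "\<Gamma>' + \<Gamma>\<^sub>0"] lolliL(1) False
        by (simp add: ac_simps add_mset_commute[of _ A])
    qed
  qed
next
  case (linL f P \<Gamma> B n)
  then obtain \<Delta> where "\<Gamma> = add_mset A \<Delta>" by (auto dest: multi_member_split)
  then show ?case using linL der.linL[of "g + f" P "\<Gamma>' + \<Delta>"]
    by (simp add: add_mset_commute[of _ A] add.assoc)
next
  case (grdL L f X r \<Gamma> B)
  show ?case
  proof (cases "A = Grd r X")
    case True
    then show ?thesis using hG[of r X L f \<Gamma> B] grdL by simp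
  next
    case False
    then obtain \<Delta> where "\<Gamma> = add_mset A \<Delta>" using grdL.prems by (auto dest: multi_member_split)
    then show ?thesis
      using grdL False der.grdL[of L "g + f" X r "\<Gamma>' + \<Delta>" B] by (simp add: add.assoc)
  qed
qed simp_all

section \<open>Admissibility of both cuts by induction on the cut formula\<close>

definition gcut_adm :: "'r gform \<Rightarrow> bool" where
  "gcut_adm X \<longleftrightarrow> (\<forall>n f g \<Gamma> C. der g {#} (Gr X) \<longrightarrow> der f \<Gamma> C \<longrightarrow> der (ctx_subst (n, X) g f) \<Gamma> C)"

definition lcut_adm :: "'r lform \<Rightarrow> bool" where
  "lcut_adm A \<longleftrightarrow> (\<forall>f g \<Gamma> \<Delta> B. der g \<Gamma> (Ln A) \<longrightarrow> der f (add_mset A \<Delta>) (Ln B) \<longrightarrow>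
     der (g + f) (\<Gamma> + \<Delta>) (Ln B))"

text \<open>With the variable fresh for \<open>f\<close>, the substitution leaves \<open>f\<close>
  unchanged and acts on the last summand alone.\<close>

lemma gcut_admD: "gcut_adm X \<Longrightarrow> der g {#} (Gr X) \<Longrightarrow> der (f + single (n, X) w) \<Gamma> C \<Longrightarrow>
    (n, X) \<notin> keys f \<Longrightarrow> der (f + ctx_scale w g) \<Gamma> C"
proof -
  assume "gcut_adm X" "der g {#} (Gr X)" "der (f + single (n, X) w) \<Gamma> C" "(n, X) \<notin> keys f"
  moreover from this have "der (ctx_subst (n, X) g (f + single (n, X) w)) \<Gamma> C"
    by (simp add: gcut_adm_def)
  ultimately show ?thesis by (simp add: ctx_subst_add ctx_subst_single ctx_subst_fresh in_keys_iff)
qed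

lemma lcut_admD: "lcut_adm A \<Longrightarrow> der g \<Gamma> (Ln A) \<Longrightarrow> der f (add_mset A \<Delta>) (Ln B) \<Longrightarrow>
    der (g + f) (\<Gamma> + \<Delta>) (Ln B)"
  unfolding lcut_adm_def by blast

text \<open>Each principal case on the right starts an induction on the left derivation by
  \<open>gcut_left\<close>. When both sides are principal, a tensor reduces to two cuts of the same
  weight on its components, and \<open>Lin A\<close> to a linear cut.\<close>

lemma gcut_admI:
  assumes T: "\<And>Y Z. X = GTensor Y Z \<Longrightarrow> gcut_adm Y \<and> gcut_adm Z"
    and L: "\<And>A. X = Lin A \<Longrightarrow> lcut_adm A"
  shows "gcut_adm X"
  unfolding gcut_adm_def
proof (intro allI impI)
  fix n f g \<Gamma> C assume g: "der g {#} (Gr X)" and f: "der f \<Gamma> C"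
  show "der (ctx_subst (n, X) g f) \<Gamma> C"
  proof (rule gcut_right[OF f g])
    fix h w \<Gamma> C assume *: "X = J" "grade_ok w" "der h \<Gamma> C"
    then show "der (h + ctx_scale w g) \<Gamma> C"
      using gcut_left[OF g, of h w \<Gamma> C] der_ok[OF *(3)] by (auto simp: gprinc_def intro: unitL)
  next
    fix M h w \<Gamma> C Y Z
    assume X: "X = GTensor Y Z" and M: "finite M" and w: "grade_ok w"
      and *: "\<And>a b. a \<notin> M \<Longrightarrow> b \<notin> M \<Longrightarrow> a \<noteq> b \<Longrightarrow> der (h + single (a, Y) w + single (b, Z) w) \<Gamma> C"
    \<comment> \<open>Reapplying the left rule restores the cut formula under any name, as the
      identity case on the left demands.\<close>
    have id: "der (h + single (n, X) w) \<Gamma> C" for n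
      unfolding X using M w * by (intro tensorL)
    have "ctx_ok h"
    proof -
      obtain a where "a \<notin> {}" "\<And>X. (a, X) \<notin> keys h" using fresh_var[of "{}" h] by blast
      then show ?thesis using ctx_ok_fresh(1)[of h "(a, X)" w] der_ok[OF id[of a]] by auto
    qed
    then show "der (h + ctx_scale w g) \<Gamma> C"
    proof (rule gcut_left[OF g _ w id])
      fix g assume "gprinc g X"
      then obtain g\<^sub>1 g\<^sub>2 where g: "g = g\<^sub>1 + g\<^sub>2" "der g\<^sub>1 {#} (Gr Y)" "der g\<^sub>2 {#} (Gr Z)"
        by (auto simp: gprinc_def X)
      \<comment> \<open>Each cut must hit a single entry: \<open>a\<close> is fresh for
        \<open>h\<close>, and \<open>b\<close> also for \<open>ctx_scale w g\<^sub>1\<close>, which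
        is part of the context when the second cut is made.\<close>
      obtain a where a: "a \<notin> M" "\<And>X. (a, X) \<notin> keys h" using fresh_var[OF M, of h] by blast
      obtain b where b: "b \<notin> insert a M" "\<And>X. (b, X) \<notin> keys (h + ctx_scale w g\<^sub>1)"
        using fresh_var[of "insert a M" "h + ctx_scale w g\<^sub>1"] M by blast
      have bh: "(b, X) \<notin> keys h" for X using b(2)[of X] by (auto simp: keys_add_eq)
      have "der ((h + single (b, Z) w) + single (a, Y) w) \<Gamma> C"
        using *[of a b] a b by (simp add: ac_simps)
      then have "der (h + single (b, Z) w + ctx_scale w g\<^sub>1) \<Gamma> C"
        using a b X T by (intro gcut_admD[OF _ g(2)]) (auto simp: keys_add_eq split: if_splits)
      then have "der (h + ctx_scale w g\<^sub>1 + single (b, Z) w) \<Gamma> C"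
        by (simp add: ac_simps)
      then have "der (h + ctx_scale w g\<^sub>1 + ctx_scale w g\<^sub>2) \<Gamma> C"
        using b X T by (intro gcut_admD[OF _ g(3)]) auto
      then show "der (h + ctx_scale w g) \<Gamma> C" by (simp add: g ctx_scale_add add.assoc)
    qed
  next
    fix h A \<Gamma> B assume X: "X = Lin A" and h: "der h (add_mset A \<Gamma>) (Ln B)"
    \<comment> \<open>The rule \<open>linL\<close> introduces its formula with grade 1, which fixes
      the weight.\<close>
    have "der (h + ctx_scale 1 g) \<Gamma> (Ln B)"
    proof (rule gcut_left[OF g])
      fix n show "der (h + single (n, X) 1) \<Gamma> (Ln B)" unfolding X using h by (rule linL)
    next
      fix g assume "gprinc g X"
      then have "der (g + h) ({#} + \<Gamma>) (Ln B)"
        using L[OF X] h by (intro lcut_admD) (auto simp: gprinc_def X)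
      then show "der (h + ctx_scale 1 g) \<Gamma> (Ln B)" by (simp add: add.commute)
    qed (use der_ok[OF h] in auto)
    then show "der (h + g) \<Gamma> (Ln B)" by simp
  qed
qed

text \<open>For \<open>Grd r X\<close> the right rule has scaled its context by \<open>r\<close>,
  and the premise of the left rule contains \<open>X\<close> with grade \<open>r\<close>; a graded
  cut of exactly this weight remains. For an implication the argument is first cut into the body,
  and the result is then cut into the remaining premise.\<close>

lemma lcut_admI:
  assumes T: "\<And>P Q. A = Tensor P Q \<or> A = Lolli P Q \<Longrightarrow> lcut_adm P \<and> lcut_adm Q"
    and G: "\<And>r X. A = Grd r X \<Longrightarrow> gcut_adm X"
  shows "lcut_adm A"
  unfolding lcut_adm_def
proof (intro allI impI)
  fix f g \<Gamma> \<Delta> B assume g: "der g \<Gamma> (Ln A)" and f: "der f (add_mset A \<Delta>) (Ln B)"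
  have "der (g + f) (\<Gamma> + (add_mset A \<Delta> - {#A#})) (Ln B)"
  proof (rule lcut_right[OF f _ g])
    fix h \<Delta> B assume *: "A = I" "der h \<Delta> (Ln B)"
    show "der (g + h) (\<Gamma> + \<Delta>) (Ln B)"
      using lcut_left[OF g, of h \<Delta> B] der_ok[OF *(2)] * by (auto simp: lprinc_def intro: lunitL)
  next
    fix h \<Delta> P Q B assume A: "A = Tensor P Q" and h: "der h (add_mset P (add_mset Q \<Delta>)) (Ln B)"
    show "der (g + h) (\<Gamma> + \<Delta>) (Ln B)"
    proof (rule lcut_left[OF g])
      fix g \<Gamma> assume "lprinc g \<Gamma> A"
      then obtain g\<^sub>1 g\<^sub>2 \<Gamma>\<^sub>1 \<Gamma>\<^sub>2 where *: "g = g\<^sub>1 + g\<^sub>2" "\<Gamma> = \<Gamma>\<^sub>1 + \<Gamma>\<^sub>2"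
          "der g\<^sub>1 \<Gamma>\<^sub>1 (Ln P)" "der g\<^sub>2 \<Gamma>\<^sub>2 (Ln Q)"
        by (auto simp: lprinc_def A)
      have "der (g\<^sub>1 + h) (\<Gamma>\<^sub>1 + add_mset Q \<Delta>) (Ln B)" using T A * h by (intro lcut_admD[of P]) auto
      then have "der (g\<^sub>2 + (g\<^sub>1 + h)) (\<Gamma>\<^sub>2 + (\<Gamma>\<^sub>1 + \<Delta>)) (Ln B)"
          using T A * by (intro lcut_admD[of Q]) auto
      then show "der (g + h) (\<Gamma> + \<Delta>) (Ln B)" using * by (simp add: ac_simps)
    qed (use der_ok[OF h] h A in \<open>auto intro: ltensorL\<close>)
  next
    fix h h' \<Delta> \<Delta>' P Q B
    assume A: "A = Lolli P Q" and h: "der h \<Delta> (Ln P)" and h': "der h' (add_mset Q \<Delta>') (Ln B)"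
    show "der (g + (h + h')) (\<Gamma> + (\<Delta> + \<Delta>')) (Ln B)"
    proof (rule lcut_left[OF g])
      fix g \<Gamma> assume "lprinc g \<Gamma> A"
      then have "der g (add_mset P \<Gamma>) (Ln Q)" by (simp add: lprinc_def A)
      then have "der (h + g) (\<Delta> + \<Gamma>) (Ln Q)" using T A h by (intro lcut_admD[of P]) auto
      then have "der ((h + g) + h') ((\<Delta> + \<Gamma>) + \<Delta>') (Ln B)"
          using T A h' by (blast intro: lcut_admD[of Q])
      then show "der (g + (h + h')) (\<Gamma> + (\<Delta> + \<Delta>')) (Ln B)" by (simp add: ac_simps)
    qed (use der_ok[OF h] der_ok[OF h'] h h' A in \<open>auto intro: lolliL ctx_ok_add\<close>)
  next
    fix L h \<Delta> r X B
    assume A: "A = Grd r X" and L: "finite L" and r: "r \<in> R" "gform_ok X"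
      and h: "\<And>a. a \<notin> L \<Longrightarrow> der (h + single (a, X) (Present r)) \<Delta> (Ln B)"
    have 1: "der h (add_mset A \<Delta>) (Ln B)" unfolding A using L h r by (intro grdL)
    show "der (g + h) (\<Gamma> + \<Delta>) (Ln B)"
    proof (rule lcut_left[OF g _ 1])
      fix g \<Gamma> assume "lprinc g \<Gamma> A"
      then obtain g' where *: "g = ctx_scale (Present r) g'" "\<Gamma> = {#}" "der g' {#} (Gr X)"
        by (auto simp: lprinc_def A)
      obtain a where a: "a \<notin> L" "\<And>X. (a, X) \<notin> keys h" using fresh_var[OF L, of h] by blast
      have "der (h + ctx_scale (Present r) g') \<Delta> (Ln B)"
          using gcut_admD[OF G[OF A] *(3) h] a by auto
      then show "der (g + h) (\<Gamma> + \<Delta>) (Ln B)" using * by (simp add: ac_simps)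
    qed (use der_ok[OF 1] in auto)
  qed simp
  then show "der (g + f) (\<Gamma> + \<Delta>) (Ln B)" by simp
qed

text \<open>\<open>Lin\<close> and \<open>Grd\<close> lead from one kind of cut to the other, so the
  induction on the cut formula is mutual.\<close>

theorem cut_adm: "gcut_adm X" "lcut_adm A"
  by (induction X and A rule: gform.induct lform.induct) (rule gcut_admI lcut_admI; simp; fail)+

section \<open>Confining list contexts and sequents to the subsemiring\<close>

definition gctx_ok :: "'r gctx \<Rightarrow> bool" where
  "gctx_ok \<Xi> \<longleftrightarrow> (\<forall>(r, X)\<in>set \<Xi>. r \<in> R \<and> gform_ok X)"

lemma gctx_ok_simps [simp]: "gctx_ok []" "gctx_ok (p # \<Xi>) \<longleftrightarrow> fst p \<in> R \<and> gform_ok (snd p) \<and>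
    gctx_ok \<Xi>"
  "gctx_ok (\<Xi> @ \<Xi>') \<longleftrightarrow> gctx_ok \<Xi> \<and> gctx_ok \<Xi>'"
  by (fastforce simp: gctx_ok_def)+

lemma gctx_ok_iff: "(\<forall>p\<in>set \<Xi>. Basic_BNFs.fsts p \<subseteq> R \<and> (\<forall>X\<in>Basic_BNFs.snds p. gform_ok X)) \<longleftrightarrow>
    gctx_ok \<Xi>"
  by (induction \<Xi>) (auto simp: fsts.simps snds.simps)

definition sequent_ok :: "'r sequent \<Rightarrow> bool" where "sequent_ok S \<longleftrightarrow> set_sequent S \<subseteq> R"

lemma sequent_ok_simps [simp]:
  "sequent_ok (GS \<Xi> X) \<longleftrightarrow> gctx_ok \<Xi> \<and> gform_ok X"
  "sequent_ok (MS \<Xi> \<Gamma> A) \<longleftrightarrow> gctx_ok \<Xi> \<and> (\<forall>B\<in>set \<Gamma>. lform_ok B) \<and> lform_ok A"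
  by (auto simp: sequent_ok_def UN_subset_iff ball_conj_distrib simp flip: gctx_ok_iff)

section \<open>From list contexts to named contexts\<close>

definition strip :: "('r \<times> 'r var) list \<Rightarrow> 'r gctx" where
  "strip = map (\<lambda>(r, v). (r, snd v))"

definition ctx_sum :: "('r \<times> 'r var) list \<Rightarrow> 'r ctx" where
  "ctx_sum L = (\<Sum>(r, v)\<leftarrow>L. single v (Present r))"

lemma ctx_sum_simps [simp]: "ctx_sum [] = 0" "ctx_sum (p # L) =
    single (snd p) (Present (fst p)) + ctx_sum L"
  "ctx_sum (L @ L') = ctx_sum L + ctx_sum L'"
  by (simp_all add: ctx_sum_def case_prod_unfold)

lemma strip_simps [simp]: "strip [] = []" "strip (p # L) = (fst p, snd (snd p)) # strip L"
  "strip (L @ L') = strip L @ strip L'"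
  by (simp_all add: strip_def case_prod_unfold)

lemma strip_eq_simps:
  "strip L = [] \<longleftrightarrow> L = []"
  "strip L = (r, X) # \<Xi> \<longleftrightarrow> (\<exists>n L'. L = (r, n, X) # L' \<and> strip L' = \<Xi>)"
  "strip L = \<Xi> @ \<Xi>' \<longleftrightarrow> (\<exists>L\<^sub>1 L\<^sub>2. L = L\<^sub>1 @ L\<^sub>2 \<and> strip L\<^sub>1 = \<Xi> \<and> strip L\<^sub>2 = \<Xi>')"
  by (auto simp: strip_def map_eq_Cons_conv map_eq_append_conv)

lemma ctx_ok_ctx_sum: "gctx_ok (strip L) \<Longrightarrow> ctx_ok (ctx_sum L)"
  by (induction L) (auto intro!: ctx_ok_add ctx_ok_single)

text \<open>The names in \<open>L\<close> need not be distinct; this is what makes contraction admissible, while a cut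
  can still choose a fresh common name for the copies of the cut formula.\<close>

definition labelled :: "'r gctx \<Rightarrow> (('r \<times> 'r var) list \<Rightarrow> bool) \<Rightarrow> bool" where
  "labelled \<Xi> P \<longleftrightarrow> (\<forall>L. strip L = \<Xi> \<longrightarrow> P L)"

lemma labelled_simps [simp]:
  "labelled [] P \<longleftrightarrow> P []"
  "labelled (p # \<Xi>) P \<longleftrightarrow> (\<forall>n. labelled \<Xi> (\<lambda>L. P ((fst p, n, snd p) # L)))"
  "labelled (\<Xi> @ \<Xi>') P \<longleftrightarrow> labelled \<Xi> (\<lambda>L. labelled \<Xi>' (\<lambda>L'. P (L @ L')))"
  by (cases p; auto simp: labelled_def strip_eq_simps)+

primrec entails :: "'r sequent \<Rightarrow> bool" where
  "entails (GS \<Xi> X) \<longleftrightarrow> labelled \<Xi> (\<lambda>L. der (ctx_sum L) {#} (Gr X))"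
| "entails (MS \<Xi> \<Gamma> A) \<longleftrightarrow> labelled \<Xi> (\<lambda>L. der (ctx_sum L) (mset \<Gamma>) (Ln A))"

text \<open>The names of \<open>L\<close> are transferred to the entries of \<open>\<Xi>\<close>
  position by position, so that the two sums can be compared at every variable.\<close>

lemma der_gctx_le:
  assumes "gctx_le \<Xi> (strip L)" "gctx_ok (strip L)" "\<And>L. strip L = \<Xi> \<Longrightarrow> der (ctx_sum L) \<Gamma> C"
  shows "der (ctx_sum L) \<Gamma> C"
proof -
  have "\<exists>L'. strip L' = \<Xi> \<and> ctx_le (ctx_sum L') (ctx_sum L)"
    using assms(1)
  proof (induction L arbitrary: \<Xi>)
    case Nil
    then show ?case by (auto simp: gctx_le_def ctx_le_refl intro!: exI[of _ "[]"])
  next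
    case (Cons p L)
    obtain s n X where p: "p = (s, n, X)" by (cases p) auto
    obtain r \<Xi>' where *: "\<Xi> = (r, X) # \<Xi>'" "r \<le> s" "gctx_le \<Xi>' (strip L)"
      using Cons.prems by (cases \<Xi>) (auto simp: gctx_le_def p)
    then obtain L' where L': "strip L' = \<Xi>'" "ctx_le (ctx_sum L') (ctx_sum L)" using Cons.IH by auto
    have "ctx_le (single (n, X) (Present r)) (single (n, X) (Present s))"
      using * by (auto simp: ctx_le_def lookup_single when_def)
    then show ?case using * L' p by (intro exI[of _ "(r, n, X) # L'"]) (auto intro: ctx_le_add)
  qed
  then obtain L' where "strip L' = \<Xi>" "ctx_le (ctx_sum L') (ctx_sum L)" by blast
  then show ?thesis using sub[OF assms(3) _ ctx_ok_ctx_sum[OF assms(2)]] by blast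
qed

lemma der_weak: "der (f + g) \<Gamma> C \<Longrightarrow> gform_ok X \<Longrightarrow> der (f + (single (n, X) (Present 0) + g)) \<Gamma> C"
proof -
  assume d: "der (f + g) \<Gamma> C" and X: "gform_ok X"
  have "ctx_le (0 + (f + g)) (single (n, X) (Present 0) + (f + g))"
    by (intro ctx_le_add ctx_le_refl) (simp add: ctx_le_def lookup_single when_def
        zero_with_zero_def)
  moreover have "ctx_ok (single (n, X) (Present 0) + (f + g))"
    using der_ok[OF d] X by (auto intro!: ctx_ok_add ctx_ok_single zero_in)
  ultimately show ?thesis using sub[OF d] by (simp add: ac_simps)
qed

lemma der_exch: "der (f + (g + (g' + h))) \<Gamma> C \<Longrightarrow> der (f + (g' + (g + h))) \<Gamma> C"
  by (simp add: add.left_commute)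

lemma der_unitL: "der (f + g) \<Gamma> C \<Longrightarrow> r \<in> R \<Longrightarrow> der (f + (single (n, J) (Present r) + g)) \<Gamma> C"
  using unitL[of "f + g" \<Gamma> C "Present r" n] by (simp add: ac_simps)

lemma der_tensorL:
  assumes "\<And>a b. der (f + (single (a, X) (Present r) + (single (b, Y) (Present r) + g))) \<Gamma> C"
      "r \<in> R"
  shows "der (f + (single (c, GTensor X Y) (Present r) + g)) \<Gamma> C"
proof -
  have "der (f + g + single (c, GTensor X Y) (Present r)) \<Gamma> C"
    using assms by (intro tensorL[of "{}"]) (auto simp: ac_simps)
  then show ?thesis by (simp add: ac_simps)
qed

lemma single_Present_add:
  "single v (Present (r + s)) = single v (Present r) + single v (Present s)"
  by (simp flip: single_add)

text \<open>Only the names come from \<open>L\<close>; the grades must be those of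
  \<open>\<Xi>\<close>, since multiplication by \<open>r\<close> need not be cancellable.\<close>

lemma strip_scale: "strip L = scale r \<Xi> \<Longrightarrow> \<exists>L'. strip L' = \<Xi> \<and> ctx_sum L =
    ctx_scale (Present r) (ctx_sum L')"
proof (induction \<Xi> arbitrary: L)
  case Nil
  then show ?case by (auto simp: scale_def strip_eq_simps intro!: exI[of _ "[]"])
next
  case (Cons p \<Xi>)
  obtain s X where p: "p = (s, X)" by (cases p)
  obtain n L\<^sub>1 where L: "L = (r * s, n, X) # L\<^sub>1" "strip L\<^sub>1 = scale r \<Xi>"
    using Cons.prems by (auto simp: scale_def p strip_eq_simps)
  obtain L' where "strip L' = \<Xi>" "ctx_sum L\<^sub>1 = ctx_scale (Present r) (ctx_sum L')"
      using Cons.IH[OF L(2)] by blast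
  then show ?case using L p by (intro exI[of _ "(s, n, X) # L'"]) (simp add: ctx_scale_add)
qed

text \<open>A contraction is absorbed by giving both occurrences the name of the contracted one, an
  exchange by commutativity of addition.\<close>

lemma rule_entails:
  "rule_inst Ss S \<Longrightarrow> \<forall>S'\<in>set Ss. entails S' \<Longrightarrow> \<forall>S'\<in>set Ss. sequent_ok S' \<Longrightarrow> sequent_ok S \<Longrightarrow> entails S"
proof (induction rule: rule_inst.induct)
  case (g_id X)
  then show ?case using idG[of X] by (simp add: one_with_zero_def)
next
  case (g_sub \<Xi> \<Xi>' X)
  then show ?case by (auto simp: labelled_def intro: der_gctx_le[where \<Xi> = \<Xi>])
next
  case (g_weak \<Xi>\<^sub>1 \<Xi>\<^sub>2 Y X)
  then show ?case by simp (simp add: labelled_def der_weak)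
next
  case (g_contr \<Xi>\<^sub>1 r X s \<Xi>\<^sub>2 Y)
  then show ?case by simp (simp add: labelled_def single_Present_add add.assoc)
next
  case (g_exch \<Xi>\<^sub>1 r X s Y \<Xi>\<^sub>2 Z)
  then show ?case by simp (auto simp: labelled_def intro: der_exch)
next
  case (g_unitL \<Xi>\<^sub>1 \<Xi>\<^sub>2 X r)
  then show ?case by simp (simp add: labelled_def der_unitL)
next
  case (g_tensorL \<Xi>\<^sub>1 r X Y \<Xi>\<^sub>2 Z)
  then show ?case by simp (simp add: labelled_def der_tensorL)
next
  case (m_sub \<Xi> \<Xi>' \<Gamma> A)
  then show ?case by (auto simp: labelled_def intro: der_gctx_le[where \<Xi> = \<Xi>])
next
  case (m_weak \<Xi>\<^sub>1 \<Xi>\<^sub>2 \<Gamma> A X)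
  then show ?case by simp (simp add: labelled_def der_weak)
next
  case (m_contr \<Xi>\<^sub>1 r X s \<Xi>\<^sub>2 \<Gamma> A)
  then show ?case by simp (simp add: labelled_def single_Present_add add.assoc)
next
  case (m_gexch \<Xi>\<^sub>1 r X s Y \<Xi>\<^sub>2 \<Gamma> A)
  then show ?case by simp (auto simp: labelled_def intro: der_exch)
next
  case (m_gunitL \<Xi>\<^sub>1 \<Xi>\<^sub>2 \<Gamma> A r)
  then show ?case by simp (simp add: labelled_def der_unitL)
next
  case (m_gtensorL \<Xi>\<^sub>1 r X Y \<Xi>\<^sub>2 \<Gamma> A)
  then show ?case by simp (simp add: labelled_def der_tensorL)
next
  case (m_linL \<Xi> A \<Gamma> B)
  then show ?case by simp (simp add: labelled_def linL flip: one_with_zero_def)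
next
  case (m_grdR \<Xi> X r)
  then show ?case by (auto simp: labelled_def dest!: strip_scale intro!: grdR)
next
  case (m_grdL \<Xi> r X \<Gamma> A)
  then show ?case by simp (auto simp: labelled_def intro!: grdL[of "{}"])
next
  case (m_lolliL \<Xi>\<^sub>2 \<Gamma>\<^sub>2 A \<Xi>\<^sub>1 \<Gamma>\<^sub>1 B \<Gamma>\<^sub>3 C)
  have "der (f + g) (add_mset (Lolli A B) (mset \<Gamma>\<^sub>1 + (mset \<Gamma>\<^sub>2 + mset \<Gamma>\<^sub>3))) (Ln C)"
    if "der g (mset \<Gamma>\<^sub>2) (Ln A)" "der f (add_mset B (mset \<Gamma>\<^sub>1 + mset \<Gamma>\<^sub>3)) (Ln C)" for f g
    using lolliL[OF that] by (simp add: ac_simps)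
  then show ?case using m_lolliL by simp (simp add: labelled_def)
next
  case (m_lexch \<Xi> \<Gamma>\<^sub>1 A B \<Gamma>\<^sub>2 C)
  then show ?case by (simp add: add_mset_commute)
next
  case (m_tensorR \<Xi>\<^sub>1 \<Gamma>\<^sub>1 A \<Xi>\<^sub>2 \<Gamma>\<^sub>2 B)
  then show ?case by simp (simp add: labelled_def ltensorR)
next
  case (g_tensorR \<Xi>\<^sub>1 X \<Xi>\<^sub>2 Y)
  then show ?case by simp (simp add: labelled_def tensorR)
qed (simp_all, simp_all add: unitR idL lunitR, simp_all add: labelled_def unitR linR idL lunitR
    lunitL ltensorL lolliR)

text \<open>For \<open>\<delta> = []\<close> the left-hand side is \<open>Absent\<close> but the multicut leaves grades \<open>0\<close>, hence only an
  inequality.\<close>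

lemma Present_multiscale: "(\<Sum>r\<leftarrow>\<delta>. Present r) * Present s \<le> Present (\<Sum>r\<leftarrow>\<delta>. r * s)"
  by (induction \<delta>) (simp_all add: zero_with_zero_def distrib_right plus_mono flip:
      plus_with_zero.simps(3))

lemma multiscale_ctx_sum:
  "strip L = multiscale \<delta> \<Xi> \<Longrightarrow>
   \<exists>L'. strip L' = \<Xi> \<and> ctx_le (ctx_scale (\<Sum>r\<leftarrow>\<delta>. Present r) (ctx_sum L')) (ctx_sum L)"
proof (induction \<Xi> arbitrary: L)
  case Nil
  then show ?case by (auto simp: multiscale_def strip_eq_simps ctx_le_refl intro!: exI[of _ "[]"])
next
  case (Cons p \<Xi>)
  obtain s X where p: "p = (s, X)" by (cases p)
  obtain n L\<^sub>1 where L: "L = (\<Sum>r\<leftarrow>\<delta>. r * s, n, X) # L\<^sub>1" "strip L\<^sub>1 = multiscale \<delta> \<Xi>"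
    using Cons.prems by (auto simp: multiscale_def p strip_eq_simps)
  obtain L' where L': "strip L' = \<Xi>" "ctx_le (ctx_scale (\<Sum>r\<leftarrow>\<delta>. Present r) (ctx_sum L')) (ctx_sum
      L\<^sub>1)"
    using Cons.IH[OF L(2)] by blast
  have "ctx_le (single (n, X) ((\<Sum>r\<leftarrow>\<delta>. Present r) * Present s)) (single (n, X) (Present (\<Sum>r\<leftarrow>\<delta>. r *
      s)))"
    using Present_multiscale[of \<delta> s] by (auto simp: ctx_le_def lookup_single when_def)
  then show ?case using L L' p
    by (intro exI[of _ "(s, n, X) # L'"]) (auto simp: ctx_scale_add intro: ctx_le_add)
qed

text \<open>All copies of \<open>X\<close> receive one common name, which merges them into a single
  entry whose grade is the sum of \<open>\<delta>\<close>; one cut then does the work of the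
  multicut. If \<open>\<delta>\<close> is empty this entry is absent, and the final approximation
  adds the entries of grade 0.\<close>

lemma der_multicut:
  assumes r: "\<And>L. strip L = \<Xi>\<^sub>1 @ copies \<delta> X @ \<Xi>\<^sub>3 \<Longrightarrow> der (ctx_sum L) \<Gamma> C"
    and l: "\<And>L. strip L = \<Xi>\<^sub>2 \<Longrightarrow> der (ctx_sum L) {#} (Gr X)"
    and L: "strip L = \<Xi>\<^sub>1 @ multiscale \<delta> \<Xi>\<^sub>2 @ \<Xi>\<^sub>3" "gctx_ok (strip L)"
  shows "der (ctx_sum L) \<Gamma> C"
proof -
  obtain L\<^sub>1 L\<^sub>2 L\<^sub>3 where L': "L = L\<^sub>1 @ L\<^sub>2 @ L\<^sub>3" "strip L\<^sub>1 = \<Xi>\<^sub>1" "strip L\<^sub>2 =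
      multiscale \<delta> \<Xi>\<^sub>2" "strip L\<^sub>3 = \<Xi>\<^sub>3"
    using L(1) by (auto simp: strip_eq_simps)
  obtain K where K: "strip K = \<Xi>\<^sub>2" "ctx_le (ctx_scale (\<Sum>r\<leftarrow>\<delta>. Present r) (ctx_sum K)) (ctx_sum L\<^sub>2)"
    using multiscale_ctx_sum[OF L'(3)] by blast
  \<comment> \<open>Other occurrences of \<open>X\<close> in the side contexts must survive the cut,
    so the common name avoids both.\<close>
  obtain m where m: "\<And>X. (m, X) \<notin> keys (ctx_sum L\<^sub>1 + ctx_sum L\<^sub>3)"
    using fresh_var[of "{}" "ctx_sum L\<^sub>1 + ctx_sum L\<^sub>3"] by auto
  have c: "strip (map (\<lambda>r. (r, m, X)) \<delta>) = copies \<delta> X"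
    "ctx_sum (map (\<lambda>r. (r, m, X)) \<delta>) = single (m, X) (\<Sum>r\<leftarrow>\<delta>. Present r)"
    by (induction \<delta>) (simp_all add: copies_def single_add)
  have "der (ctx_sum (L\<^sub>1 @ map (\<lambda>r. (r, m, X)) \<delta> @ L\<^sub>3)) \<Gamma> C"
    using c L' by (intro r) simp
  then have d: "der (ctx_sum L\<^sub>1 + ctx_sum L\<^sub>3 + single (m, X) (\<Sum>r\<leftarrow>\<delta>. Present r)) \<Gamma> C"
    using c by (simp add: ac_simps)
  then have "der (ctx_sum L\<^sub>1 + ctx_sum L\<^sub>3 + ctx_scale (\<Sum>r\<leftarrow>\<delta>. Present r) (ctx_sum K)) \<Gamma> C"
    by (rule gcut_admD[OF cut_adm(1) l[OF K(1)] _ m])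
  moreover have "ctx_ok (ctx_sum L\<^sub>1 + ctx_sum L\<^sub>3 + ctx_sum L\<^sub>2)"
      using ctx_ok_ctx_sum[OF L(2)] L' by (simp add: ac_simps)
  ultimately have "der (ctx_sum L\<^sub>1 + ctx_sum L\<^sub>3 + ctx_sum L\<^sub>2) \<Gamma> C"
    using sub ctx_le_add[OF ctx_le_refl K(2)] by blast
  then show ?thesis by (simp add: L' ac_simps)
qed

lemma gcut_entails:
  "gcut_inst X S\<^sub>1 S\<^sub>2 S \<Longrightarrow> entails S\<^sub>1 \<Longrightarrow> entails S\<^sub>2 \<Longrightarrow> sequent_ok S \<Longrightarrow> entails S"
proof (induction rule: gcut_inst.induct)
  case (g_cut \<Xi>\<^sub>2 \<Xi>\<^sub>1 \<delta> \<Xi>\<^sub>3 Y)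
  then show ?case
    using der_multicut[of \<Xi>\<^sub>1 \<delta> X \<Xi>\<^sub>3 "{#}" "Gr Y" \<Xi>\<^sub>2] by (simp add: labelled_def del:
        labelled_simps)
next
  case (m_gcut \<Xi>\<^sub>2 \<Xi>\<^sub>1 \<delta> \<Xi>\<^sub>3 \<Gamma> A)
  then show ?case
    using der_multicut[of \<Xi>\<^sub>1 \<delta> X \<Xi>\<^sub>3 "mset \<Gamma>" "Ln A" \<Xi>\<^sub>2] by (simp add: labelled_def del:
        labelled_simps)
qed

lemma lcut_entails:
  "lcut_inst A S\<^sub>1 S\<^sub>2 S \<Longrightarrow> entails S\<^sub>1 \<Longrightarrow> entails S\<^sub>2 \<Longrightarrow> entails S"
proof (induction rule: lcut_inst.induct)
  case (m_lcut \<Xi>\<^sub>2 \<Gamma>\<^sub>2 \<Xi>\<^sub>1 \<Gamma>\<^sub>1 \<Gamma>\<^sub>3 B)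
  have "der (f + g) (mset \<Gamma>\<^sub>1 + (mset \<Gamma>\<^sub>2 + mset \<Gamma>\<^sub>3)) (Ln B)"
    if "der g (mset \<Gamma>\<^sub>2) (Ln A)" "der f (add_mset A (mset \<Gamma>\<^sub>1 + mset \<Gamma>\<^sub>3)) (Ln B)" for f g
    using lcut_admD[OF cut_adm(2) that] by (simp add: ac_simps)
  then show ?case using m_lcut by simp (simp add: labelled_def)
qed

text \<open>Every node stores its end sequent, so \<open>set_derivation \<Pi> \<subseteq> R\<close>
  bounds the grades of all sequents, including those that a cut removes.\<close>

lemma proof_entails: "proof_of \<Pi> S \<Longrightarrow> set_derivation \<Pi> \<subseteq> R \<Longrightarrow> sequent_ok S \<and> entails S"
proof (induction rule: proof_of.induct)
  case (1 Ss S \<Pi>s)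
  then have "sequent_ok S" by (simp add: sequent_ok_def)
  moreover have "\<forall>S'\<in>set Ss. sequent_ok S' \<and> entails S'"
  proof
    fix S' assume "S' \<in> set Ss"
    then obtain i where "i < length Ss" "S' = Ss ! i" by (auto simp: in_set_conv_nth)
    moreover have "set_derivation (\<Pi>s ! i) \<subseteq> R"
      using 1(3) calculation list_all2_lengthD[OF 1(2)] by (fastforce simp: UN_subset_iff)
    ultimately show "sequent_ok S' \<and> entails S'"
      using 1(2) by (auto simp: list_all2_conv_all_nth)
  qed
  ultimately show ?case using rule_entails[OF 1(1)] by blast
next
  case (2 X S\<^sub>1 S\<^sub>2 S \<Pi>\<^sub>1 \<Pi>\<^sub>2)
  then show ?case using gcut_entails by (auto simp: sequent_ok_def)
next
  case (3 A S\<^sub>1 S\<^sub>2 S \<Pi>\<^sub>1 \<Pi>\<^sub>2)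
  then show ?case using lcut_entails by (auto simp: sequent_ok_def)
qed

section \<open>From named contexts back to list contexts\<close>

text \<open>Every sequent of the derivation is confined to \<open>R\<close>, because a certificate
  has to spell out each rule instance.\<close>

inductive cut_free_derivable :: "'r sequent \<Rightarrow> bool" where
  "rule_inst Ss S \<Longrightarrow> \<forall>S'\<in>set Ss. cut_free_derivable S' \<Longrightarrow> sequent_ok S \<Longrightarrow> cut_free_derivable S"

lemma cut_free_derivable_ok: "cut_free_derivable S \<Longrightarrow> sequent_ok S"
  by (erule cut_free_derivable.cases) simp

primrec sequent_of :: "'r gctx \<Rightarrow> 'r lform list \<Rightarrow> 'r goal \<Rightarrow> 'r sequent" where
  "sequent_of \<Xi> \<Gamma> (Gr X) = GS \<Xi> X"
| "sequent_of \<Xi> \<Gamma> (Ln A) = MS \<Xi> \<Gamma> A"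

text \<open>Adjacent swaps generate all permutations: \<open>move\<close> brings the required head
  to the front, and induction on \<open>ys\<close> does the rest.\<close>

lemma mset_swap_closed:
  assumes swap: "\<And>xs a b ys. P (xs @ [a, b] @ ys) \<Longrightarrow> P (xs @ [b, a] @ ys)"
    and "P xs" "mset xs = mset ys"
  shows "P ys"
proof -
  have move: "P (zs @ xs @ y # ys) \<Longrightarrow> P (zs @ y # xs @ ys)" for zs xs y ys
  proof (induction xs arbitrary: ys rule: rev_induct)
    case (snoc x xs)
    then show ?case using swap[of "zs @ xs" x y ys] by simp
  qed simp
  have "P (zs @ xs) \<Longrightarrow> mset xs = mset ys \<Longrightarrow> P (zs @ ys)" for zs
  proof (induction ys arbitrary: xs zs)
    case (Cons y ys)
    then have "y \<in> set xs" by (metis list.set_intros(1) set_mset_mset)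
    then obtain xs\<^sub>1 xs\<^sub>2 where xs: "xs = xs\<^sub>1 @ y # xs\<^sub>2" by (auto dest: split_list)
    then have "P ((zs @ [y]) @ (xs\<^sub>1 @ xs\<^sub>2))" using move[of zs xs\<^sub>1 y xs\<^sub>2] Cons.prems(1) by simp
    then show ?case
      using xs Cons.prems(2) Cons.IH[where zs = "zs @ [y]" and xs = "xs\<^sub>1 @ xs\<^sub>2"] by simp
  qed simp
  from this[of "[]"] show ?thesis using assms by simp
qed

text \<open>Quantifying over all orderings lets every later rule find its principal formulas where
  the list rule wants them.\<close>

definition cut_free_from :: "('r \<times> 'r gform) multiset \<Rightarrow> 'r lform multiset \<Rightarrow> 'r goal \<Rightarrow> bool" where
  "cut_free_from M \<Gamma> C \<longleftrightarrow> (\<forall>\<Xi> \<Delta>. mset \<Xi> = M \<longrightarrow> mset \<Delta> = \<Gamma> \<longrightarrow> cut_free_derivable (sequent_of \<Xi> \<Delta> C))"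

lemma cut_free_derivable_rule1: "rule_inst [S'] S \<Longrightarrow> cut_free_derivable S' \<Longrightarrow> sequent_ok S \<Longrightarrow>
    cut_free_derivable S"
  by (rule cut_free_derivable.intros) auto

text \<open>One ordering suffices thanks to exchange; the graded and the linear context are permuted
  one after the other. For a graded goal \<open>sequent_of\<close> ignores the linear list, so the
  second permutation is trivial.\<close>

lemma cfmI: assumes "cut_free_derivable (sequent_of \<Xi> \<Delta> C)" "mset \<Xi> = M" "mset \<Delta> = \<Gamma>"
    shows "cut_free_from M \<Gamma> C"
  unfolding cut_free_from_def
proof (intro allI impI)
  fix \<Xi>' \<Delta>' assume *: "mset \<Xi>' = M" "mset \<Delta>' = \<Gamma>"
  have "cut_free_derivable (sequent_of \<Xi>' \<Delta> C)"
  proof (rule mset_swap_closed[where P = "\<lambda>\<Xi>. cut_free_derivable (sequent_of \<Xi> \<Delta> C)"])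
    fix xs ys and a b :: "'r \<times> 'r gform" assume d: "cut_free_derivable (sequent_of (xs @ [a, b] @
        ys) \<Delta> C)"
    have "rule_inst [sequent_of (xs @ [a, b] @ ys) \<Delta> C] (sequent_of (xs @ [b, a] @ ys) \<Delta> C)"
      by (cases C; cases a; cases b) (simp_all only: sequent_of.simps g_exch m_gexch)
    then show "cut_free_derivable (sequent_of (xs @ [b, a] @ ys) \<Delta> C)"
      using d by (rule cut_free_derivable_rule1) (use cut_free_derivable_ok[OF d] in \<open>cases C;
          auto\<close>)
  qed (use assms * in auto)
  then show "cut_free_derivable (sequent_of \<Xi>' \<Delta>' C)"
  proof (rule mset_swap_closed[where P = "\<lambda>\<Delta>. cut_free_derivable (sequent_of \<Xi>' \<Delta> C)", rotated])
    fix xs ys and a b :: "'r lform" assume d: "cut_free_derivable (sequent_of \<Xi>' (xs @ [a, b] @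
        ys) C)"
    show "cut_free_derivable (sequent_of \<Xi>' (xs @ [b, a] @ ys) C)"
    proof (cases C)
      case (Ln A)
      then have "rule_inst [sequent_of \<Xi>' (xs @ [a, b] @ ys) C] (sequent_of \<Xi>' (xs @ [b, a] @ ys)
          C)"
        by (simp only: sequent_of.simps m_lexch)
      then show ?thesis
        using d by (rule cut_free_derivable_rule1) (use Ln cut_free_derivable_ok[OF d] in auto)
    qed (use d in simp)
  qed (use assms * in auto)
qed

lemma cut_free_from_D: "cut_free_from (mset \<Xi>) (mset \<Delta>) C \<Longrightarrow> cut_free_derivable (sequent_of \<Xi> \<Delta> C)"
  by (simp add: cut_free_from_def)

lemma cut_free_from_rule1:
  "cut_free_from (mset \<Xi>) (mset \<Delta>) C \<Longrightarrow> rule_inst [sequent_of \<Xi> \<Delta> C] (sequent_of \<Xi>' \<Delta>' C') \<Longrightarrow>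
   (sequent_ok (sequent_of \<Xi> \<Delta> C) \<Longrightarrow> sequent_ok (sequent_of \<Xi>' \<Delta>' C')) \<Longrightarrow> mset \<Xi>' = M \<Longrightarrow> mset \<Delta>' =
       \<Gamma> \<Longrightarrow> cut_free_from M \<Gamma> C'"
  by (rule cfmI[of \<Xi>' \<Delta>']) (auto intro: cut_free_derivable_rule1 dest!: cut_free_from_D dest:
      cut_free_derivable_ok)

lemma cut_free_from_ctx_rule:
  assumes "cut_free_from (mset \<Xi>) \<Gamma> C" "\<And>Y. rule_inst [GS \<Xi> Y] (GS \<Xi>' Y)"
    "\<And>\<Delta> A. rule_inst [MS \<Xi> \<Delta> A] (MS \<Xi>' \<Delta> A)" "gctx_ok \<Xi> \<Longrightarrow> gctx_ok \<Xi>'" "mset \<Xi>' = M"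
  shows "cut_free_from M \<Gamma> C"
proof -
  obtain \<Delta> where \<Delta>: "mset \<Delta> = \<Gamma>" by (metis ex_mset)
  have "rule_inst [sequent_of \<Xi> \<Delta> C] (sequent_of \<Xi>' \<Delta> C)" using assms(2,3) by (cases C) simp_all
  moreover have "sequent_ok (sequent_of \<Xi> \<Delta> C) \<Longrightarrow> sequent_ok (sequent_of \<Xi>' \<Delta> C)"
      using assms(4) by (cases C) simp_all
  ultimately show ?thesis using assms(1,5) \<Delta> by - (rule cut_free_from_rule1[of \<Xi> \<Delta> C \<Xi>' \<Delta> C]; auto)
qed

lemma cut_free_from_sub: "cut_free_from (mset \<Xi>) \<Gamma> C \<Longrightarrow> gctx_le \<Xi> \<Xi>' \<Longrightarrow> gctx_ok \<Xi>' \<Longrightarrow>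
    cut_free_from (mset \<Xi>') \<Gamma> C"
  by (erule cut_free_from_ctx_rule) (auto intro: g_sub m_sub)

lemma cut_free_from_weak:
  assumes "cut_free_from M \<Gamma> C" "gform_ok X" shows "cut_free_from (add_mset (0, X) M) \<Gamma> C"
proof -
  obtain \<Xi> where "M = mset \<Xi>" by (metis ex_mset)
  then show ?thesis using assms zero_in g_weak[of "[]" \<Xi> _ X] m_weak[of "[]" \<Xi> _ _ X]
    by - (rule cut_free_from_ctx_rule[of \<Xi> \<Gamma> C "(0, X) # \<Xi>"]; auto)
qed

lemma cut_free_from_contr:
  assumes "cut_free_from (add_mset (r, X) (add_mset (s, X) M)) \<Gamma> C"
      shows "cut_free_from (add_mset (r + s, X) M) \<Gamma> C"
proof -
  obtain \<Xi> where "M = mset \<Xi>" by (metis ex_mset)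
  then show ?thesis using assms plus_in g_contr[of "[]" r X s \<Xi>] m_contr[of "[]" r X s \<Xi>]
    by - (rule cut_free_from_ctx_rule[of "(r, X) # (s, X) # \<Xi>" \<Gamma> C "(r + s, X) # \<Xi>"]; auto)
qed

lemma cut_free_from_unitL:
  assumes "cut_free_from M \<Gamma> C" "r \<in> R" shows "cut_free_from (add_mset (r, J) M) \<Gamma> C"
proof -
  obtain \<Xi> where "M = mset \<Xi>" by (metis ex_mset)
  then show ?thesis using assms g_unitL[of "[]" \<Xi> _ r] m_gunitL[of "[]" \<Xi> _ _ r]
    by - (rule cut_free_from_ctx_rule[of \<Xi> \<Gamma> C "(r, J) # \<Xi>"]; auto)
qed

lemma cut_free_from_tensorL:
  assumes "cut_free_from (add_mset (r, X) (add_mset (r, Y) M)) \<Gamma> C"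
  shows "cut_free_from (add_mset (r, GTensor X Y) M) \<Gamma> C"
proof -
  obtain \<Xi> where "M = mset \<Xi>" by (metis ex_mset)
  then show ?thesis using assms g_tensorL[of "[]" r X Y \<Xi>] m_gtensorL[of "[]" r X Y \<Xi>]
    by - (rule cut_free_from_ctx_rule[of "(r, X) # (r, Y) # \<Xi>" \<Gamma> C "(r, GTensor X Y) # \<Xi>"]; auto)
qed

text \<open>The default 0 keeps this map monotone, as \<open>Absent \<le> Present s\<close> means
  \<open>0 \<le> s\<close>.\<close>

definition the_grade :: "'r with_zero \<Rightarrow> 'r" where
  "the_grade w = (case w of Absent \<Rightarrow> 0 | Present r \<Rightarrow> r)"

definition entries :: "'r ctx \<Rightarrow> ('r \<times> 'r gform) multiset" where
  "entries f = image_mset (\<lambda>v. (the_grade (lookup f v), snd v)) (mset_set (keys f))"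

lemma entries_0 [simp]: "entries 0 = {#}" by (simp add: entries_def)

lemma entries_add_fresh:
  assumes "v \<notin> keys f" shows "entries (f + single v (Present r)) = add_mset (r, snd v) (entries f)"
proof -
  have k: "keys (f + single v (Present r)) = insert v (keys f)"
    by (simp add: keys_add_eq zero_with_zero_def)
  have "lookup (f + single v (Present r)) u = lookup f u" if "u \<in> keys f" for u
    using that assms by (auto simp: lookup_add lookup_single when_def)
  then have "image_mset (\<lambda>u. (the_grade (lookup (f + single v (Present r)) u), snd u)) (mset_set
      (keys f)) = entries f"
    unfolding entries_def by (intro image_mset_cong) auto
  moreover have "the_grade (lookup (f + single v (Present r)) v) = r"
    using assms by (simp add: lookup_add in_keys_iff the_grade_def)
  ultimately show ?thesis unfolding entries_def k using assms by (simp add: entries_def)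
qed

lemma ctx_split:
  assumes "v \<in> keys f"
  obtains f' r where "f = f' + single v (Present r)" "v \<notin> keys f'" "card (keys f') < card (keys f)"
proof -
  let ?f = "Poly_Mapping.update v 0 f"
  have "f = ?f + single v (lookup f v)"
    by (intro poly_mapping_eqI) (simp add: lookup_add lookup_update lookup_single when_def)
  moreover obtain r where "lookup f v = Present r"
    using assms by (cases "lookup f v") (auto simp: in_keys_iff zero_with_zero_def)
  moreover have "keys ?f = keys f - {v}"
    by (auto simp: in_keys_iff lookup_update split: if_splits)
  ultimately show thesis using that assms by (metis DiffE card_Diff1_less finite_keys insertI1)
qed

lemma cut_free_from_absorb:
  "cut_free_from (add_mset (r, snd v) (entries f + N)) \<Gamma> C \<Longrightarrow>
      cut_free_from (entries (f + single v (Present r)) + N) \<Gamma> C"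
proof (cases "v \<in> keys f")
  case True
  then obtain f' s where f: "f = f' + single v (Present s)" "v \<notin> keys f'" by (rule ctx_split)
  assume "cut_free_from (add_mset (r, snd v) (entries f + N)) \<Gamma> C"
  then have "cut_free_from (add_mset (r + s, snd v) (entries f' + N)) \<Gamma> C"
    by (intro cut_free_from_contr) (simp add: f entries_add_fresh)
  moreover have "f + single v (Present r) = f' + single v (Present (r + s))"
    by (simp add: f single_Present_add ac_simps)
  ultimately show ?thesis by (simp add: f entries_add_fresh)
qed (simp add: entries_add_fresh)

lemma ctx_ctx_sum: "\<exists>L. f = ctx_sum L \<and> entries f = mset (strip L)"
proof (induction "card (keys f)" arbitrary: f rule: less_induct)
  case less
  show ?case
  proof (cases "keys f = {}")
    case True
    then have "f = 0" by (auto intro!: poly_mapping_eqI simp: in_keys_iff)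
    then show ?thesis by (intro exI[of _ "[]"]) simp
  next
    case False
    then obtain v where "v \<in> keys f" by (meson ex_in_conv)
    then obtain f' r where f: "f = f' + single v (Present r)" "v \<notin> keys f'"
        "card (keys f') < card (keys f)"
      by (rule ctx_split)
    then obtain L where "f' = ctx_sum L" "entries f' = mset (strip L)" using less by blast
    then show ?thesis using f by (intro exI[of _ "(r, v) # L"]) (simp add: entries_add_fresh
        ac_simps)
  qed
qed

text \<open>A rule with two premises concatenates contexts, while \<open>f + g\<close> merges
  entries at common variables. The entries of \<open>g\<close> are therefore absorbed one at a
  time.\<close>

lemma cut_free_from_add: "cut_free_from (entries f + entries g) \<Gamma> C \<Longrightarrow>
    cut_free_from (entries (f + g)) \<Gamma> C"
proof -
  assume *: "cut_free_from (entries f + entries g) \<Gamma> C"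
  obtain L where L: "g = ctx_sum L" "entries g = mset (strip L)" using ctx_ctx_sum by blast
  have "cut_free_from (entries f + mset (strip L)) \<Gamma> C \<Longrightarrow>
      cut_free_from (entries (f + ctx_sum L)) \<Gamma> C" for f
  proof (induction L arbitrary: f)
    case (Cons p L)
    then have "cut_free_from (entries (f + single (snd p) (Present (fst p))) + mset (strip L)) \<Gamma> C"
      by (intro cut_free_from_absorb) simp
    from Cons.IH[OF this] show ?case by (simp add: add.assoc)
  qed simp
  then show ?thesis using * L by simp
qed

lemma cut_free_from_single: "cut_free_from (add_mset (r, snd v) (entries f)) \<Gamma> C \<Longrightarrow>
    cut_free_from (entries (f + single v (Present r))) \<Gamma> C"
  using cut_free_from_absorb[of r v f "{#}"] by simp

text \<open>Multiplying a present grade by \<open>Present r\<close> never yields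
  \<open>Absent\<close>, even where the product of the grades is 0, so no entry is lost.\<close>

lemma entries_ctx_scale: "entries (ctx_scale (Present r) f) =
    image_mset (\<lambda>(s, X). (r * s, X)) (entries f)"
proof -
  have nz: "Present r * w = 0 \<longleftrightarrow> w = 0" "w \<noteq> 0 \<Longrightarrow> the_grade (Present r * w) = r * the_grade w" for w
    by (cases w; simp add: zero_with_zero_def the_grade_def)+
  have "keys (ctx_scale (Present r) f) = keys f" by (auto simp: in_keys_iff nz)
  then show ?thesis
    by (auto simp: entries_def image_mset.compositionality o_def in_keys_iff nz intro!:
        image_mset_cong)
qed

lemma ctx_ok_entries: "ctx_ok f \<Longrightarrow> mset \<Xi> = entries f \<Longrightarrow> gctx_ok \<Xi>"
proof -
  assume f: "ctx_ok f" and "mset \<Xi> = entries f"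
  then have "set \<Xi> = set_mset (entries f)" by (metis set_mset_mset)
  moreover have "the_grade (lookup f v) \<in> R" if "v \<in> keys f" for v
    using ctx_ok_lookup[OF f, of v] zero_in by (cases "lookup f v") (auto simp: the_grade_def)
  ultimately show ?thesis using f by (auto simp: gctx_ok_def entries_def ctx_ok_def)
qed

text \<open>The inequality splits into weakenings, which add the variables of \<open>f'\<close>
  missing in \<open>f\<close> with grade 0, and one approximation step between contexts of the same
  shape.\<close>

lemma cut_free_from_ctx_le:
  assumes "cut_free_from (entries f) \<Gamma> C" "ctx_le f f'" "ctx_ok f'"
      shows "cut_free_from (entries f') \<Gamma> C"
proof -
  obtain vs where vs: "set vs = keys f" "distinct vs" using finite_distinct_list[of "keys f"] by
      auto
  obtain ws where ws: "set ws = keys f' - keys f" "distinct ws"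
    using finite_distinct_list[of "keys f' - keys f"] by auto
  have le: "lookup f v \<le> lookup f' v" for v using assms(2) by (simp add: ctx_le_def)
  \<comment> \<open>\<open>Present r \<le> Absent\<close> is false, so increasing a context never
    drops a variable.\<close>
  have sub: "keys f \<subseteq> keys f'"
  proof
    fix v assume "v \<in> keys f"
    then show "v \<in> keys f'" using le[of v]
      by (cases "lookup f v"; cases "lookup f' v") (auto simp: in_keys_iff zero_with_zero_def)
  qed
  let ?l = "\<lambda>f. map (\<lambda>v. (the_grade (lookup f v), snd v))"
  have "cut_free_from (mset (?l f vs @ map (\<lambda>v. (0, snd v)) us)) \<Gamma> C" if "set us \<subseteq> keys f'" for us
    using that
  proof (induction us)
    case Nil
    have "entries f = mset (?l f vs)" using vs by (simp add: entries_def flip: mset_set_set)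
    then show ?case using assms(1) by simp
  next
    case (Cons u us)
    then show ?case using assms(3) cut_free_from_weak[of _ \<Gamma> C "snd u"] by (auto simp: ctx_ok_def)
  qed
  then have 1: "cut_free_from (mset (?l f vs @ map (\<lambda>v. (0, snd v)) ws)) \<Gamma> C" using ws by auto
  have r: "entries f' = mset (?l f' (vs @ ws))"
  proof -
    have "keys f' = set (vs @ ws)" "distinct (vs @ ws)" using vs ws sub by auto
    then show ?thesis by (metis (no_types, lifting) mset_map mset_set_set entries_def)
  qed
  have "gctx_le (?l f vs @ map (\<lambda>v. (0, snd v)) ws) (?l f' (vs @ ws))"
  proof -
    have "the_grade (lookup f v) \<le> the_grade (lookup f' v)" for v
      using le[of v] by (cases "lookup f v"; cases "lookup f' v") (auto simp: the_grade_def)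
    moreover have "0 \<le> the_grade (lookup f' v)" if "v \<in> set ws" for v
      using le[of v] that ws by (cases "lookup f' v") (auto simp: the_grade_def in_keys_iff
          zero_with_zero_def)
    ultimately show ?thesis
      by (auto simp: gctx_le_def list_all2_append list_all2_map1 list_all2_map2 list.rel_refl_strong
          intro!: list_all2_appendI list.rel_refl_strong)
  qed
  then show ?thesis unfolding r
    by (rule cut_free_from_sub[OF 1]) (use ctx_ok_entries[OF assms(3)] r in metis)
qed

lemma der_cut_free_from: "der f \<Gamma> C \<Longrightarrow> cut_free_from (entries f) \<Gamma> C"
proof (induction rule: der.induct)
  case (idG X n)
  have "entries (single (n, X) 1) = {#(1, X)#}"
    using entries_add_fresh[of "(n, X)" 0 1] by (simp add: one_with_zero_def)
  then show ?case using idG one_in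
    by (auto intro!: cfmI[of "[(1, X)]" "[]"] cut_free_derivable.intros[OF g_id])
next
  case (sub f \<Gamma> C f')
  then show ?case by (blast intro: cut_free_from_ctx_le)
next
  case (unitL f \<Gamma> C w n)
  then show ?case
    by (cases w) (auto intro!: cut_free_from_single cut_free_from_unitL simp:
        zero_with_zero_def[symmetric])
next
  case (tensorL L f X w Y \<Gamma> C c)
  \<comment> \<open>With fresh names the two components remain entries of their own instead of being
    merged into \<open>f\<close>.\<close>
  obtain a where a: "a \<notin> L" "\<And>X. (a, X) \<notin> keys f" using fresh_var[OF tensorL.hyps(1), of f] by blast
  obtain b where b: "b \<notin> insert a L" "\<And>X. (b, X) \<notin> keys f"
    using fresh_var[of "insert a L" f] tensorL.hyps(1) by blast
  have *: "cut_free_from (entries (f + single (a, X) w + single (b, Y) w)) \<Gamma> C"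
    using tensorL.IH[of a b] a b by auto
  show ?case
  proof (cases w)
    \<comment> \<open>An absent grade contributes nothing: premise and conclusion both have the
      context \<open>f\<close>.\<close>
    case Absent
    then show ?thesis using * by (simp flip: zero_with_zero_def)
  next
    case (Present r)
    have "(b, Y) \<notin> keys (f + single (a, X) (Present r))"
        using a b by (auto simp: keys_add_eq split: if_splits)
    then have "cut_free_from (add_mset (r, X) (add_mset (r, Y) (entries f))) \<Gamma> C"
      using * a b by (simp add: Present entries_add_fresh add_mset_commute)
    then show ?thesis unfolding Present by (intro cut_free_from_single) (auto intro:
        cut_free_from_tensorL)
  qed
next
  case (tensorR f X g Y)
  obtain \<Xi> \<Xi>' where \<Xi>: "mset \<Xi> = entries f" "mset \<Xi>' = entries g" by (metis ex_mset)
  have "cut_free_derivable (GS \<Xi> X)" "cut_free_derivable (GS \<Xi>' Y)"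
    using tensorR.IH cut_free_from_D[of \<Xi> "[]" "Gr X"] cut_free_from_D[of \<Xi>' "[]"
        "Gr Y"] by (simp_all add: \<Xi>)
  moreover from this have "sequent_ok (GS \<Xi> X)" "sequent_ok (GS \<Xi>' Y)"
      by (blast intro: cut_free_derivable_ok)+
  ultimately have "cut_free_derivable (GS (\<Xi> @ \<Xi>') (GTensor X Y))"
    by (intro cut_free_derivable.intros[OF g_tensorR]) auto
  then have "cut_free_from (entries f + entries g) {#} (Gr (GTensor X Y))"
    by (intro cfmI[of "\<Xi> @ \<Xi>'" "[]"]) (auto simp: \<Xi>)
  then show ?case by (rule cut_free_from_add)
next
  case (ltensorR f \<Gamma> A g \<Delta> B)
  obtain \<Xi> \<Xi>' \<Gamma>' \<Delta>' where \<Xi>: "mset \<Xi> = entries f" "mset \<Xi>' = entries g" "mset \<Gamma>' = \<Gamma>" "mset \<Delta>' = \<Delta>"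
    by (metis ex_mset)
  have "cut_free_derivable (MS \<Xi> \<Gamma>' A)" "cut_free_derivable (MS \<Xi>' \<Delta>' B)"
    using ltensorR.IH cut_free_from_D[of \<Xi> \<Gamma>' "Ln A"] cut_free_from_D[of \<Xi>' \<Delta>' "Ln B"] by
        (simp_all add: \<Xi>)
  moreover from this have "sequent_ok (MS \<Xi> \<Gamma>' A)" "sequent_ok (MS \<Xi>' \<Delta>' B)"
      by (blast intro: cut_free_derivable_ok)+
  ultimately have "cut_free_derivable (MS (\<Xi> @ \<Xi>') (\<Gamma>' @ \<Delta>') (Tensor A B))"
    by (intro cut_free_derivable.intros[OF m_tensorR]) auto
  then have "cut_free_from (entries f + entries g) (\<Gamma> + \<Delta>) (Ln (Tensor A B))"
    by (intro cfmI[of "\<Xi> @ \<Xi>'" "\<Gamma>' @ \<Delta>'"]) (auto simp: \<Xi>)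
  then show ?case by (rule cut_free_from_add)
next
  case (lolliL f \<Gamma> A g B \<Delta> C)
  obtain \<Xi> \<Xi>' \<Gamma>' \<Delta>' where \<Xi>: "mset \<Xi> = entries f" "mset \<Xi>' = entries g" "mset \<Gamma>' = \<Gamma>" "mset \<Delta>' = \<Delta>"
    by (metis ex_mset)
  have "cut_free_derivable (MS \<Xi> \<Gamma>' A)" "cut_free_derivable (MS \<Xi>' ([] @ [B] @ \<Delta>') C)"
    using lolliL.IH cut_free_from_D[of \<Xi> \<Gamma>' "Ln A"] cut_free_from_D[of \<Xi>' "B # \<Delta>'"
        "Ln C"] by (simp_all add: \<Xi>)
  moreover from this have "sequent_ok (MS \<Xi> \<Gamma>' A)" "sequent_ok (MS \<Xi>' ([] @ [B] @ \<Delta>') C)"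
      by (blast intro: cut_free_derivable_ok)+
  ultimately have "cut_free_derivable (MS (\<Xi>' @ \<Xi>) ([] @ [Lolli A B] @ \<Gamma>' @ \<Delta>') C)"
    by (intro cut_free_derivable.intros[OF m_lolliL]) auto
  then have "cut_free_from (entries f + entries g) (add_mset (Lolli A B) (\<Gamma> + \<Delta>)) (Ln C)"
    by (intro cfmI[of "\<Xi>' @ \<Xi>" "[Lolli A B] @ \<Gamma>' @ \<Delta>'"]) (auto simp: \<Xi>)
  then show ?case by (rule cut_free_from_add)
next
  case unitR
  then show ?case by (auto intro!: cfmI[of "[]" "[]"] cut_free_derivable.intros[OF g_unitR])
next
  case (linR f A)
  obtain \<Xi> where \<Xi>: "mset \<Xi> = entries f" by (metis ex_mset)
  show ?case using linR.IH
    by - (rule cut_free_from_rule1[of \<Xi> "[]" "Ln A" \<Xi> "[]"]; auto simp: \<Xi> g_linR)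
next
  case (idL A)
  then show ?case by (auto intro!: cfmI[of "[]" "[A]"] cut_free_derivable.intros[OF m_id])
next
  case lunitR
  then show ?case by (auto intro!: cfmI[of "[]" "[]"] cut_free_derivable.intros[OF m_unitR])
next
  case (lunitL f \<Gamma> A)
  obtain \<Xi> \<Delta> where \<Xi>: "mset \<Xi> = entries f" "mset \<Delta> = \<Gamma>" by (metis ex_mset)
  show ?case using lunitL.IH m_unitL[of \<Xi> "[]" \<Delta> A]
    by - (rule cut_free_from_rule1[of \<Xi> \<Delta> "Ln A" \<Xi> "I # \<Delta>"]; auto simp: \<Xi>)
next
  case (ltensorL f A B \<Gamma> C)
  obtain \<Xi> \<Delta> where \<Xi>: "mset \<Xi> = entries f" "mset \<Delta> = \<Gamma>" by (metis ex_mset)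
  show ?case using ltensorL.IH m_tensorL[of \<Xi> "[]" A B \<Delta> C]
    by - (rule cut_free_from_rule1[of \<Xi> "A # B # \<Delta>" "Ln C" \<Xi> "Tensor A B # \<Delta>"]; auto simp: \<Xi>)
next
  case (lolliR f A \<Gamma> B)
  obtain \<Xi> \<Delta> where \<Xi>: "mset \<Xi> = entries f" "mset \<Delta> = \<Gamma>" by (metis ex_mset)
  show ?case using lolliR.IH m_lolliR[of \<Xi> \<Delta> A B]
    by - (rule cut_free_from_rule1[of \<Xi> "\<Delta> @ [A]" "Ln B" \<Xi> \<Delta>]; auto simp: \<Xi>)
next
  case (linL f A \<Gamma> B n)
  obtain \<Xi> \<Delta> where \<Xi>: "mset \<Xi> = entries f" "mset \<Delta> = \<Gamma>" by (metis ex_mset)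
  have "cut_free_from (add_mset (1, Lin A) (entries f)) \<Gamma> (Ln B)"
    using linL.IH m_linL[of \<Xi> A \<Delta> B] one_in
    by - (rule cut_free_from_rule1[of \<Xi> "A # \<Delta>" "Ln B" "\<Xi> @ [(1, Lin A)]" \<Delta>]; auto simp: \<Xi>)
  then show ?case using cut_free_from_single[of 1 "(n, Lin A)"] by (simp add: one_with_zero_def)
next
  case (grdR f X r)
  obtain \<Xi> where \<Xi>: "mset \<Xi> = entries f" by (metis ex_mset)
  have "gctx_ok (scale r \<Xi>)" if "gctx_ok \<Xi>" for \<Xi>
    using that grdR.hyps(2) by (induction \<Xi>) (auto simp: scale_def times_in)
  then show ?case using grdR m_grdR[of \<Xi> X r]
    by - (rule cut_free_from_rule1[of \<Xi> "[]" "Gr X" "scale r \<Xi>"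
        "[]"]; auto simp: \<Xi> entries_ctx_scale scale_def)
next
  case (grdL L f X r \<Gamma> A)
  obtain \<Xi> \<Delta> where \<Xi>: "mset \<Xi> = entries f" "mset \<Delta> = \<Gamma>" by (metis ex_mset)
  obtain a where a: "a \<notin> L" "\<And>X. (a, X) \<notin> keys f" using fresh_var[OF grdL.hyps(1), of f] by blast
  show ?case using grdL.IH[of a] a m_grdL[of \<Xi> r X \<Delta> A] grdL.hyps
    by - (rule cut_free_from_rule1[of "\<Xi> @ [(r, X)]" \<Delta> "Ln A"
        \<Xi> "Grd r X # \<Delta>"]; auto simp: \<Xi> entries_add_fresh)
qed

theorem proof_cut_free_derivable:
  assumes "proof_of \<Pi> S" "set_derivation \<Pi> \<subseteq> R" shows "cut_free_derivable S"
proof -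
  have ok: "sequent_ok S" "entails S" using proof_entails[OF assms] by auto
  have "cut_free_derivable (sequent_of \<Xi> \<Delta> C)"
    if "\<And>L. strip L = \<Xi> \<Longrightarrow> der (ctx_sum L) (mset \<Delta>) C" for \<Xi> \<Delta> C
  proof -
    \<comment> \<open>Positions serve as names; they are distinct, so no two entries merge and the
      list is recovered from its sum up to order.\<close>
    define L where "L = map (\<lambda>(i, r, X). (r, i :: nat, X)) (enumerate 0 \<Xi>)"
    have "strip L = \<Xi>"
      by (auto simp: L_def strip_def intro!: nth_equalityI simp: nth_enumerate_eq split:
          prod.splits)
    have d: "distinct (map snd L)"
    proof -
      have "distinct (map (fst \<circ> snd) L)"
        by (auto simp: L_def o_def case_prod_unfold)
      then show ?thesis by (metis distinct_map list.map_comp)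
    qed
    have "entries (ctx_sum L) = mset (strip L)"
      using d
    proof (induction L)
      case (Cons p L)
      have "keys (ctx_sum L) = snd ` set L"
        by (induction L) (auto simp: keys_add_eq zero_with_zero_def)
      then have "entries (ctx_sum L + single (snd p) (Present (fst p))) =
          add_mset (fst p, snd (snd p)) (entries (ctx_sum L))"
        using Cons.prems by (intro entries_add_fresh) auto
      then show ?case using Cons by (simp add: add.commute)
    qed simp
    then show ?thesis using der_cut_free_from[OF that] \<open>strip L = \<Xi>\<close> by (metis cut_free_from_D)
  qed
  from this[of _ "[]" "Gr _"] this[of _ _ "Ln _"] show ?thesis using ok(2) by (cases S) (auto
      simp: labelled_def)
qed

end

section \<open>Evaluation as a function\<close>

text \<open>A partial function instead of a relation, so that programs can be run by rewriting.
  \<open>None\<close> stands for being stuck as well as for divergence.\<close>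

definition ev :: "program \<Rightarrow> 'r::preordered_semiring tree list \<Rightarrow> expr \<Rightarrow> 'r tree option" where
  "ev P vs e = (if \<exists>v. evaluates P vs e v then Some (THE v. evaluates P vs e v) else None)"

lemma ev_eq_Some: "ev P vs e = Some v \<longleftrightarrow> evaluates P vs e v"
proof -
  have "(THE v. evaluates P vs e v) = w" if "evaluates P vs e w" for w
    using that evaluates_deterministic by blast
  then show ?thesis unfolding ev_def by auto
qed

lemma option_eqI: "(\<And>x. a = Some x \<longleftrightarrow> b = Some x) \<Longrightarrow> a = b"
  by (cases a; cases b) auto

lemma those_eq_Some: "those xs = Some ys \<longleftrightarrow> list_all2 (\<lambda>x y. x = Some y) xs ys"
  by (induction xs arbitrary: ys) (auto split: option.splits simp: list_all2_Cons1)

lemma case_pair_eq_Some: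
  "(case v of Pair a b \<Rightarrow> F a b | _ \<Rightarrow> None) = Some w \<longleftrightarrow> (\<exists>a b. v = Pair a b \<and> F a b = Some w)"
  by (cases v) auto

lemma case_grade_eq_Some:
  "(case v of Grade r \<Rightarrow> F r | _ \<Rightarrow> None) = Some w \<longleftrightarrow> (\<exists>r. v = Grade r \<and> F r = Some w)"
  by (cases v) auto

lemmas ev_conv = ev_eq_Some bind_eq_Some_conv those_eq_Some list_all2_map1
  case_pair_eq_Some case_grade_eq_Some

text \<open>The equations hold for divergent expressions too, both sides then being
  \<open>None\<close>; a recursive call can thus be unfolded before anything is known about
  termination.\<close>

lemma ev_basic [simp]:
  "ev P vs (Arg i) = (if i < length vs then Some (vs ! i) else None)"
  "ev P vs ELeaf = Some Leaf"
  "ev P vs EZero = Some (Grade 0)"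
  "ev P vs EOne = Some (Grade 1)"
  "ev P vs (EPair e\<^sub>1 e\<^sub>2) = Option.bind (ev P vs e\<^sub>1) (\<lambda>v\<^sub>1. Option.bind (ev P vs e\<^sub>2) (\<lambda>v\<^sub>2.
      Some (Pair v\<^sub>1 v\<^sub>2)))"
  "ev P vs (Fst e) = Option.bind (ev P vs e) (\<lambda>v. case v of Pair a b \<Rightarrow> Some a | _ \<Rightarrow> None)"
  "ev P vs (Snd e) = Option.bind (ev P vs e) (\<lambda>v. case v of Pair a b \<Rightarrow> Some b | _ \<Rightarrow> None)"
  "ev P vs (EPlus e\<^sub>1 e\<^sub>2) = Option.bind (ev P vs e\<^sub>1) (\<lambda>v. Option.bind (ev P vs e\<^sub>2) (\<lambda>w.
     case v of Grade r \<Rightarrow> (case w of Grade s \<Rightarrow> Some (Grade (r + s)) | _ \<Rightarrow> None) | _ \<Rightarrow> None))"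
  "ev P vs (ETimes e\<^sub>1 e\<^sub>2) = Option.bind (ev P vs e\<^sub>1) (\<lambda>v. Option.bind (ev P vs e\<^sub>2) (\<lambda>w.
     case v of Grade r \<Rightarrow> (case w of Grade s \<Rightarrow> Some (Grade (r * s)) | _ \<Rightarrow> None) | _ \<Rightarrow> None))"
  "ev P vs (Call f es) = (if f < length P
     then Option.bind (those (map (ev P vs) es)) (\<lambda>ws. ev P ws (P ! f)) else None)"
  by (rule option_eqI; fastforce simp: ev_conv elim!: evaluates_elims intro: evaluates.intros
      split: if_splits)+

lemma ev_IfPair [simp]:
  "ev P vs (IfPair e e\<^sub>1 e\<^sub>2) = Option.bind (ev P vs e) (\<lambda>v.
     case v of Pair a b \<Rightarrow> ev P vs e\<^sub>1 | _ \<Rightarrow> ev P vs e\<^sub>2)"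
proof (rule option_eqI)
  have *: "(case v of Pair a b \<Rightarrow> ev P vs e\<^sub>1 | _ \<Rightarrow> ev P vs e\<^sub>2) = Some w \<longleftrightarrow>
    evaluates P vs (if \<exists>v\<^sub>1 v\<^sub>2. v = Pair v\<^sub>1 v\<^sub>2 then e\<^sub>1 else e\<^sub>2) w" for v w
    by (cases v) (auto simp: ev_eq_Some)
  show "ev P vs (IfPair e e\<^sub>1 e\<^sub>2) = Some w \<longleftrightarrow> Option.bind (ev P vs e) (\<lambda>v.
     case v of Pair a b \<Rightarrow> ev P vs e\<^sub>1 | _ \<Rightarrow> ev P vs e\<^sub>2) = Some w" for w
    unfolding bind_eq_Some_conv * unfolding ev_eq_Some by (blast elim: evaluates_elims intro:
        evaluates.intros)
qed

lemma ev_IfEq [simp]: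
  "ev P vs (IfEq e e' e\<^sub>1 e\<^sub>2) = Option.bind (ev P vs e) (\<lambda>v. Option.bind (ev P vs e') (\<lambda>w.
     if v = w then ev P vs e\<^sub>1 else ev P vs e\<^sub>2))"
proof (rule option_eqI)
  have *: "(if v = w then ev P vs e\<^sub>1 else ev P vs e\<^sub>2) = Some u \<longleftrightarrow>
    evaluates P vs (if v = w then e\<^sub>1 else e\<^sub>2) u" for u v w
    by (simp add: ev_eq_Some)
  show "ev P vs (IfEq e e' e\<^sub>1 e\<^sub>2) = Some u \<longleftrightarrow> Option.bind (ev P vs e) (\<lambda>v.
     Option.bind (ev P vs e') (\<lambda>w. if v = w then ev P vs e\<^sub>1 else ev P vs e\<^sub>2)) = Some u" for u
    unfolding bind_eq_Some_conv * unfolding ev_eq_Some by (blast elim: evaluates_elims intro: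
        evaluates.intros)
qed

lemma ev_IfLe [simp]:
  "ev P vs (IfLe e e' e\<^sub>1 e\<^sub>2) = Option.bind (ev P vs e) (\<lambda>v. Option.bind (ev P vs e') (\<lambda>w.
     case v of Grade r \<Rightarrow> (case w of Grade s \<Rightarrow> if r \<le> s then ev P vs e\<^sub>1 else ev P vs e\<^sub>2
       | _ \<Rightarrow> None) | _ \<Rightarrow> None))"
proof (rule option_eqI)
  have *: "(if r \<le> s then ev P vs e\<^sub>1 else ev P vs e\<^sub>2) = Some u \<longleftrightarrow>
    evaluates P vs (if r \<le> s then e\<^sub>1 else e\<^sub>2) u" for u r s
    by (simp add: ev_eq_Some)
  show "ev P vs (IfLe e e' e\<^sub>1 e\<^sub>2) = Some u \<longleftrightarrow> Option.bind (ev P vs e) (\<lambda>v. Option.bind (ev P vs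
      e') (\<lambda>w.
     case v of Grade r \<Rightarrow> (case w of Grade s \<Rightarrow> if r \<le> s then ev P vs e\<^sub>1 else ev P vs e\<^sub>2
       | _ \<Rightarrow> None) | _ \<Rightarrow> None)) = Some u" for u
    unfolding bind_eq_Some_conv case_grade_eq_Some * unfolding ev_eq_Some
    by (blast elim: evaluates_elims intro: evaluates.intros)
qed

section \<open>Building cut-free proofs from arbitrary trees\<close>

text \<open>Every tree is read as a certificate for some cut-free proof: malformed parts are replaced by
  defaults, so that decoding and building are total and never have to report failure.\<close>

primrec tfst :: "'r tree \<Rightarrow> 'r tree" where
  "tfst Leaf = Leaf" | "tfst (Grade r) = Leaf" | "tfst (Pair a b) = a"

primrec tsnd :: "'r tree \<Rightarrow> 'r tree" where
  "tsnd Leaf = Leaf" | "tsnd (Grade r) = Leaf" | "tsnd (Pair a b) = b"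

primrec tgrade :: "'r::zero tree \<Rightarrow> 'r" where
  "tgrade Leaf = 0" | "tgrade (Grade r) = r" | "tgrade (Pair a b) = 0"

definition num :: "nat \<Rightarrow> 'r tree" where "num k = tree_of_list (replicate k Leaf)"

lemma size_tfst: "size (tfst t) \<le> size t" and size_tsnd: "size (tsnd t) \<le> size t"
  by (cases t; simp)+

function (sequential) dec_g :: "'r::zero tree \<Rightarrow> 'r gform" and dec_l :: "'r tree \<Rightarrow> 'r lform" where
  "dec_g (Pair k t) = (if k = num 1 then GTensor (dec_g (tfst t)) (dec_g (tsnd t))
     else if k = num 2 then Lin (dec_l t) else J)"
| "dec_g _ = J"
| "dec_l (Pair k t) = (if k = num 1 then Tensor (dec_l (tfst t)) (dec_l (tsnd t))
     else if k = num 2 then Lolli (dec_l (tfst t)) (dec_l (tsnd t))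
     else if k = num 3 then Grd (tgrade (tfst t)) (dec_g (tsnd t)) else I)"
| "dec_l _ = I"
  by pat_completeness auto
termination
  by (relation "measure (case_sum size size)") (auto simp: less_Suc_eq_le size_tfst size_tsnd
      le_SucI trans_le_add2)

fun dec_gctx :: "'r::zero tree \<Rightarrow> 'r gctx" where
  "dec_gctx (Pair p t) = (tgrade (tfst p), dec_g (tsnd p)) # dec_gctx t"
| "dec_gctx _ = []"

fun dec_lctx :: "'r::zero tree \<Rightarrow> 'r lform list" where
  "dec_lctx (Pair p t) = dec_l p # dec_lctx t"
| "dec_lctx _ = []"

text \<open>A total form of approximation: a grade is replaced only where the order permits. So any
  two contexts yield a correct instance, and by \<open>raise_eq\<close> no instance is lost.\<close>

fun raise :: "'r::ord gctx \<Rightarrow> 'r gctx \<Rightarrow> 'r gctx" where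
  "raise ((r, X) # \<Xi>) ((s, Y) # \<Xi>') = (if r \<le> s then s else r, X) # raise \<Xi> \<Xi>'"
| "raise [] \<Xi>' = []"
| "raise \<Xi> [] = \<Xi>"

lemma gctx_le_raise: "gctx_le \<Xi> (raise \<Xi> \<Xi>')" for \<Xi> :: "'r::preorder gctx"
  by (induction \<Xi> \<Xi>' rule: raise.induct) (auto simp: gctx_le_def intro!: list.rel_refl_strong)

lemma raise_eq: "gctx_le \<Xi> \<Xi>' \<Longrightarrow> raise \<Xi> \<Xi>' = \<Xi>'"
  by (induction \<Xi> \<Xi>' rule: raise.induct) (auto simp: gctx_le_def list_all2_Cons1)

primrec withctx :: "'r sequent \<Rightarrow> 'r gctx \<Rightarrow> 'r sequent" where
  "withctx (GS _ X) \<Xi> = GS \<Xi> X"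
| "withctx (MS _ \<Gamma> A) \<Xi> = MS \<Xi> \<Gamma> A"

primrec endseq :: "'r derivation \<Rightarrow> 'r sequent" where
  "endseq (Infer S _) = S"
| "endseq (GCut _ S _ _) = S"
| "endseq (LCut _ S _ _) = S"

text \<open>Any tree serves as a unary index, read off as the number of pairs on its right
  spine.\<close>

primrec select :: "'r tree \<Rightarrow> 'a list \<Rightarrow> 'a \<Rightarrow> 'a" where
  "select k [] d = d"
| "select k (x # xs) d = (case k of Pair a k' \<Rightarrow> select k' xs d | _ \<Rightarrow> x)"

lemma select_in: "select k xs d \<in> insert d (set xs)"
  by (induction xs arbitrary: k) (auto split: tree.split)

lemma select_num: "i < length xs \<Longrightarrow> select (num i) xs d = xs ! i"
  by (induction xs arbitrary: i) (auto simp: num_def tree_of_list_def nth_Cons split: nat.split)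

text \<open>The rules acting on the graded context are shared by both judgments; their sequents arise from
  the sequent \<open>q\<close> of the first premise by changing its graded context.\<close>

definition rules :: "'r::preordered_semiring sequent \<Rightarrow> 'r gctx \<Rightarrow> 'r gctx \<Rightarrow> 'r \<Rightarrow> 'r \<Rightarrow> 'r gform \<Rightarrow> 'r
    gform \<Rightarrow>
    'r lform list \<Rightarrow> 'r lform list \<Rightarrow> 'r lform list \<Rightarrow> 'r lform \<Rightarrow> 'r lform \<Rightarrow> 'r lform \<Rightarrow>
    ('r sequent list \<times> 'r sequent) list" where
  "rules q \<Xi>\<^sub>1 \<Xi>\<^sub>2 r s X Y \<Gamma>\<^sub>1 \<Gamma>\<^sub>2 \<Gamma>\<^sub>3 A B C = [
    ([], GS [(1, X)] X),
    ([withctx q \<Xi>\<^sub>1], withctx q (raise \<Xi>\<^sub>1 \<Xi>\<^sub>2)),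
    ([withctx q (\<Xi>\<^sub>1 @ \<Xi>\<^sub>2)], withctx q (\<Xi>\<^sub>1 @ [(0, X)] @ \<Xi>\<^sub>2)),
    ([withctx q (\<Xi>\<^sub>1 @ [(r, X), (s, X)] @ \<Xi>\<^sub>2)], withctx q (\<Xi>\<^sub>1 @ [(r + s, X)] @ \<Xi>\<^sub>2)),
    ([withctx q (\<Xi>\<^sub>1 @ [(r, X), (s, Y)] @ \<Xi>\<^sub>2)], withctx q (\<Xi>\<^sub>1 @ [(s, Y), (r, X)] @ \<Xi>\<^sub>2)),
    ([withctx q (\<Xi>\<^sub>1 @ \<Xi>\<^sub>2)], withctx q (\<Xi>\<^sub>1 @ [(r, J)] @ \<Xi>\<^sub>2)),
    ([withctx q (\<Xi>\<^sub>1 @ [(r, X), (r, Y)] @ \<Xi>\<^sub>2)], withctx q (\<Xi>\<^sub>1 @ [(r, GTensor X Y)] @ \<Xi>\<^sub>2)),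
    ([], GS [] J),
    ([GS \<Xi>\<^sub>1 X, GS \<Xi>\<^sub>2 Y], GS (\<Xi>\<^sub>1 @ \<Xi>\<^sub>2) (GTensor X Y)),
    ([MS \<Xi>\<^sub>1 [] A], GS \<Xi>\<^sub>1 (Lin A)),
    ([], MS [] [A] A),
    ([MS \<Xi>\<^sub>1 (\<Gamma>\<^sub>1 @ [A, B] @ \<Gamma>\<^sub>2) C], MS \<Xi>\<^sub>1 (\<Gamma>\<^sub>1 @ [B, A] @ \<Gamma>\<^sub>2) C),
    ([], MS [] [] I),
    ([MS \<Xi>\<^sub>1 (\<Gamma>\<^sub>1 @ \<Gamma>\<^sub>2) A], MS \<Xi>\<^sub>1 (\<Gamma>\<^sub>1 @ [I] @ \<Gamma>\<^sub>2) A),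
    ([MS \<Xi>\<^sub>1 \<Gamma>\<^sub>1 A, MS \<Xi>\<^sub>2 \<Gamma>\<^sub>2 B], MS (\<Xi>\<^sub>1 @ \<Xi>\<^sub>2) (\<Gamma>\<^sub>1 @ \<Gamma>\<^sub>2) (Tensor A B)),
    ([MS \<Xi>\<^sub>1 (\<Gamma>\<^sub>1 @ [A, B] @ \<Gamma>\<^sub>2) C], MS \<Xi>\<^sub>1 (\<Gamma>\<^sub>1 @ [Tensor A B] @ \<Gamma>\<^sub>2) C),
    ([MS \<Xi>\<^sub>1 (\<Gamma>\<^sub>1 @ [A]) B], MS \<Xi>\<^sub>1 \<Gamma>\<^sub>1 (Lolli A B)),
    ([MS \<Xi>\<^sub>2 \<Gamma>\<^sub>2 A, MS \<Xi>\<^sub>1 (\<Gamma>\<^sub>1 @ [B] @ \<Gamma>\<^sub>3) C],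
      MS (\<Xi>\<^sub>1 @ \<Xi>\<^sub>2) (\<Gamma>\<^sub>1 @ [Lolli A B] @ \<Gamma>\<^sub>2 @ \<Gamma>\<^sub>3) C),
    ([MS \<Xi>\<^sub>1 (A # \<Gamma>\<^sub>1) B], MS (\<Xi>\<^sub>1 @ [(1, Lin A)]) \<Gamma>\<^sub>1 B),
    ([GS \<Xi>\<^sub>1 X], MS (scale r \<Xi>\<^sub>1) [] (Grd r X)),
    ([MS (\<Xi>\<^sub>1 @ [(r, X)]) \<Gamma>\<^sub>1 A], MS \<Xi>\<^sub>1 (Grd r X # \<Gamma>\<^sub>1) A)]"

lemma rules_sound: "x \<in> set (rules q \<Xi>\<^sub>1 \<Xi>\<^sub>2 r s X Y \<Gamma>\<^sub>1 \<Gamma>\<^sub>2 \<Gamma>\<^sub>3 A B C) \<Longrightarrow> rule_inst (fst x) (snd x)"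
proof -
  have "\<forall>x\<in>set (rules q \<Xi>\<^sub>1 \<Xi>\<^sub>2 r s X Y \<Gamma>\<^sub>1 \<Gamma>\<^sub>2 \<Gamma>\<^sub>3 A B C). rule_inst (fst x) (snd x)"
    unfolding rules_def
    by (cases q; simp only: list.set ball_simps fst_conv snd_conv withctx.simps;
        intro conjI TrueI; rule rule_inst.intros gctx_le_raise)
      (rule gctx_le_raise)+
  then show "x \<in> set (rules q \<Xi>\<^sub>1 \<Xi>\<^sub>2 r s X Y \<Gamma>\<^sub>1 \<Gamma>\<^sub>2 \<Gamma>\<^sub>3 A B C) \<Longrightarrow> rule_inst (fst x) (snd x)"
      by blast
qed

definition tnth :: "nat \<Rightarrow> 'r tree \<Rightarrow> 'r tree" where
  "tnth i p = tfst ((tsnd ^^ i) p)"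

definition schema :: "'r::preordered_semiring tree \<Rightarrow> 'r tree \<Rightarrow> 'r sequent \<Rightarrow> 'r sequent list \<times> 'r
    sequent" where
  "schema k p q = select k (rules q (dec_gctx (tnth 0 p)) (dec_gctx (tnth 1 p))
     (tgrade (tnth 2 p)) (tgrade (tnth 3 p)) (dec_g (tnth 4 p)) (dec_g (tnth 5 p))
     (dec_lctx (tnth 6 p)) (dec_lctx (tnth 7 p)) (dec_lctx (tnth 8 p))
     (dec_l (tnth 9 p)) (dec_l (tnth 10 p)) (dec_l (tnth 11 p))) ([], GS [] J)"

text \<open>The comparison of end sequents is the only check; the fallback, the axiom for
  \<open>J\<close>, is itself a cut-free proof.\<close>

definition finish :: "'r::preordered_semiring tree \<Rightarrow> 'r tree \<Rightarrow> 'r derivation list \<Rightarrow> 'r derivation"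
    where
  "finish k p \<Pi>s = (case schema k p (case \<Pi>s of [] \<Rightarrow> GS [] J | \<Pi> # _ \<Rightarrow> endseq \<Pi>) of
     (Ss, S) \<Rightarrow> if map endseq \<Pi>s = Ss then Infer S \<Pi>s else Infer (GS [] J) [])"

fun build :: "'r::preordered_semiring tree \<Rightarrow> 'r derivation"
  and build_list :: "'r tree \<Rightarrow> 'r derivation list" where
  "build (Pair h t) = finish (tfst h) (tsnd h) (build_list t)"
| "build _ = Infer (GS [] J) []"
| "build_list (Pair c t) = build c # build_list t"
| "build_list _ = []"

lemma schema_sound: "schema k p q = (Ss, S) \<Longrightarrow> rule_inst Ss S"
proof -
  assume *: "schema k p q = (Ss, S)"
  have "schema k p q \<in> insert ([], GS [] J) (set (rules q (dec_gctx (tnth 0 p)) (dec_gctx (tnth 1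
      p))
     (tgrade (tnth 2 p)) (tgrade (tnth 3 p)) (dec_g (tnth 4 p)) (dec_g (tnth 5 p))
     (dec_lctx (tnth 6 p)) (dec_lctx (tnth 7 p)) (dec_lctx (tnth 8 p))
     (dec_l (tnth 9 p)) (dec_l (tnth 10 p)) (dec_l (tnth 11 p))))"
    unfolding schema_def by (rule select_in)
  then show ?thesis using rules_sound[of "(Ss, S)"] g_unitR unfolding * by (metis fst_conv insertE
      prod.inject snd_conv)
qed

definition cut_free_proof :: "'r::preordered_semiring derivation \<Rightarrow> bool" where
  "cut_free_proof \<Pi> \<longleftrightarrow> proof_of \<Pi> (endseq \<Pi>) \<and> cut_free \<Pi>"

lemma cut_free_proof_default: "cut_free_proof (Infer (GS [] J) [])"
  by (auto simp: cut_free_proof_def intro: proof_of.intros g_unitR)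

text \<open>As every tree yields a cut-free proof, the search can recognise success by the end
  sequent alone.\<close>

lemma build_cut_free_proof:
  fixes t :: "'r::preordered_semiring tree"
  shows "cut_free_proof (build t)" "\<Pi> \<in> set (build_list t) \<Longrightarrow> cut_free_proof \<Pi>"
proof (induction t and t arbitrary: and \<Pi> rule: build_build_list.induct)
  case (1 h t)
  obtain Ss S where *: "schema (tfst h) (tsnd h) (case build_list t of [] \<Rightarrow> GS [] J | \<Pi> # _ \<Rightarrow>
      endseq \<Pi>) = (Ss, S)"
    by fastforce
  have "cut_free_proof (Infer S (build_list t))" if "Ss = map endseq (build_list t)"
    using 1 schema_sound[OF *] unfolding that
    by (auto simp: cut_free_proof_def list_all_iff list_all2_map2 list.rel_refl_strong intro!:
        proof_of.intros(1) list.rel_refl_strong)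
  then show ?case using cut_free_proof_default by (auto simp: finish_def *)
qed (auto simp: cut_free_proof_default)

section \<open>Certificates over \<open>R\<close> for all cut-free derivations over
  \<open>R\<close>\<close>

context grades
begin

definition applicable :: "'r sequent \<Rightarrow> 'r sequent list \<Rightarrow> 'r sequent \<Rightarrow> bool" where
  "applicable q Ss S \<longleftrightarrow> (\<exists>k p. set_tree k \<union> set_tree p \<subseteq> R \<and> schema k p q = (Ss, S))"

primrec enc_g :: "'r gform \<Rightarrow> 'r tree" and enc_l :: "'r lform \<Rightarrow> 'r tree" where
  "enc_g J = Leaf"
| "enc_g (GTensor X Y) = Pair (num 1) (Pair (enc_g X) (enc_g Y))"
| "enc_g (Lin A) = Pair (num 2) (enc_l A)"
| "enc_l I = Leaf"
| "enc_l (Tensor A B) = Pair (num 1) (Pair (enc_l A) (enc_l B))"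
| "enc_l (Lolli A B) = Pair (num 2) (Pair (enc_l A) (enc_l B))"
| "enc_l (Grd r X) = Pair (num 3) (Pair (Grade r) (enc_g X))"

lemma num_inject [simp]: "num i = (num j :: 'a tree) \<longleftrightarrow> i = j"
  by (simp add: num_def tree_of_list_inject replicate_eq_replicate)

lemma set_num [simp]: "set_tree (num k) = {}"
  by (induction k) (auto simp: num_def tree_of_list_def)

lemma dec_enc_form: "dec_g (enc_g X) = X" "dec_l (enc_l A) = A"
  by (induction X and A rule: gform.induct lform.induct) simp_all

lemma set_enc_form: "set_tree (enc_g X) = set_gform X" "set_tree (enc_l A) = set_lform A"
  by (induction X and A rule: gform.induct lform.induct) auto

definition enc_gctx :: "'r gctx \<Rightarrow> 'r tree" where
  "enc_gctx \<Xi> = tree_of_list (map (\<lambda>(r, X). Pair (Grade r) (enc_g X)) \<Xi>)"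

lemma dec_enc_gctx: "dec_gctx (enc_gctx \<Xi>) = \<Xi>"
  by (induction \<Xi>) (auto simp: enc_gctx_def tree_of_list_def dec_enc_form)

lemma set_enc_gctx: "gctx_ok \<Xi> \<Longrightarrow> set_tree (enc_gctx \<Xi>) \<subseteq> R"
  by (induction \<Xi>) (auto simp: enc_gctx_def tree_of_list_def set_enc_form)

definition enc_lctx :: "'r lform list \<Rightarrow> 'r tree" where
  "enc_lctx \<Gamma> = tree_of_list (map enc_l \<Gamma>)"

lemma dec_enc_lctx: "dec_lctx (enc_lctx \<Gamma>) = \<Gamma>"
  by (induction \<Gamma>) (auto simp: enc_lctx_def tree_of_list_def dec_enc_form)

lemma set_enc_lctx: "\<forall>A\<in>set \<Gamma>. lform_ok A \<Longrightarrow> set_tree (enc_lctx \<Gamma>) \<subseteq> R"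
  by (induction \<Gamma>) (auto simp: enc_lctx_def tree_of_list_def set_enc_form)

lemma applicableI:
  assumes "rules q \<Xi>\<^sub>1 \<Xi>\<^sub>2 r s X Y \<Gamma>\<^sub>1 \<Gamma>\<^sub>2 \<Gamma>\<^sub>3 A B C ! i = (Ss, S)" "i < 21"
    "gctx_ok \<Xi>\<^sub>1 \<and> gctx_ok \<Xi>\<^sub>2 \<and> r \<in> R \<and> s \<in> R \<and> gform_ok X \<and> gform_ok Y \<and>
        (\<forall>A\<in>set \<Gamma>\<^sub>1. lform_ok A) \<and>
     (\<forall>A\<in>set \<Gamma>\<^sub>2. lform_ok A) \<and> (\<forall>A\<in>set \<Gamma>\<^sub>3. lform_ok A) \<and> lform_ok A \<and> lform_ok B \<and> lform_ok C"
  shows "applicable q Ss S"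
proof -
  \<comment> \<open>Listed in the order in which \<open>schema\<close> fetches its parameters by
    \<open>tnth\<close>.\<close>
  define ps where "ps = [enc_gctx \<Xi>\<^sub>1, enc_gctx \<Xi>\<^sub>2, Grade r, Grade s, enc_g X, enc_g Y,
    enc_lctx \<Gamma>\<^sub>1, enc_lctx \<Gamma>\<^sub>2, enc_lctx \<Gamma>\<^sub>3, enc_l A, enc_l B, enc_l C]"
  have set_list: "set_tree (tree_of_list ts) = (\<Union>t\<in>set ts. set_tree t)" for ts :: "'r tree list"
    by (induction ts) (auto simp: tree_of_list_def)
  have set_ps: "set_tree (tree_of_list ps) \<subseteq> R"
    using assms(3) unfolding set_list ps_def by (simp add: set_enc_gctx set_enc_lctx set_enc_form)
  have nth: "tnth j (tree_of_list ts) = ts ! j" if "j < length ts" for j and ts :: "'r tree list"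
    using that
  proof (induction j arbitrary: ts)
    case 0
    then show ?case by (cases ts) (auto simp: tnth_def tree_of_list_def)
  next
    case (Suc j)
    then show ?case by (cases ts) (auto simp: tnth_def tree_of_list_def funpow_Suc_right simp del:
        funpow.simps)
  qed
  have "schema (num i) (tree_of_list ps) q =
      select (num i :: 'r tree) (rules q \<Xi>\<^sub>1 \<Xi>\<^sub>2 r s X Y \<Gamma>\<^sub>1 \<Gamma>\<^sub>2 \<Gamma>\<^sub>3 A B C) ([], GS [] J)"
    unfolding schema_def by (simp add: nth ps_def dec_enc_gctx dec_enc_lctx dec_enc_form)
  also have "\<dots> = (Ss, S)"
    using assms(1,2) by (subst select_num) (simp_all add: rules_def)
  finally have "schema (num i) (tree_of_list ps) q = (Ss, S)" .
  with set_ps show ?thesis unfolding applicable_def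
    by (intro exI[of _ "num i"] exI[of _ "tree_of_list ps"]) simp
qed

text \<open>The final number in each case is the position in \<open>rules\<close>; parameters that
  do not occur in the rule are filled with \<open>0\<close>, \<open>J\<close>, \<open>I\<close> or
  \<open>[]\<close>. The graded and the mixed version of a context rule share a position, since the
  first premise supplies the rest of the sequent.\<close>

lemma rule_applicable:
  assumes "rule_inst Ss S" "\<forall>S'\<in>set Ss. sequent_ok S'" "sequent_ok S"
  shows "applicable (case Ss of [] \<Rightarrow> GS [] J | S' # _ \<Rightarrow> S') Ss S"
  using assms
proof (induction rule: rule_inst.induct)
  case (g_id X)
  then show ?case using zero_in
    by - (rule applicableI[of _ "[]" "[]" 0 0 X J "[]" "[]" "[]" I I I 0]; simp add: rules_def)
next
  case (g_sub \<Xi> \<Xi>' X)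
  then show ?case using zero_in
    by - (rule applicableI[of _ \<Xi> "\<Xi>'" 0 0 J J "[]" "[]" "[]"
        I I I 1]; simp add: rules_def raise_eq)
next
  case (g_weak \<Xi>\<^sub>1 \<Xi>\<^sub>2 Y X)
  then show ?case using zero_in
    by - (rule applicableI[of _ \<Xi>\<^sub>1 \<Xi>\<^sub>2 0 0 X J "[]" "[]" "[]" I I I 2]; simp add: rules_def)
next
  case (g_contr \<Xi>\<^sub>1 r X s \<Xi>\<^sub>2 Y)
  then show ?case using zero_in
    by - (rule applicableI[of _ \<Xi>\<^sub>1 \<Xi>\<^sub>2 r s X J "[]" "[]" "[]" I I I 3]; simp add: rules_def)
next
  case (g_exch \<Xi>\<^sub>1 r X s Y \<Xi>\<^sub>2 Z)
  then show ?case using zero_in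
    by - (rule applicableI[of _ \<Xi>\<^sub>1 \<Xi>\<^sub>2 r s X Y "[]" "[]" "[]" I I I 4]; simp add: rules_def)
next
  case g_unitR
  then show ?case using zero_in
    by - (rule applicableI[of _ "[]" "[]" 0 0 J J "[]" "[]" "[]" I I I 7]; simp add: rules_def)
next
  case (g_unitL \<Xi>\<^sub>1 \<Xi>\<^sub>2 X r)
  then show ?case using zero_in
    by - (rule applicableI[of _ \<Xi>\<^sub>1 \<Xi>\<^sub>2 r 0 J J "[]" "[]" "[]" I I I 5]; simp add: rules_def)
next
  case (g_tensorR \<Xi>\<^sub>1 X \<Xi>\<^sub>2 Y)
  then show ?case using zero_in
    by - (rule applicableI[of _ \<Xi>\<^sub>1 \<Xi>\<^sub>2 0 0 X Y "[]" "[]" "[]" I I I 8]; simp add: rules_def)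
next
  case (g_tensorL \<Xi>\<^sub>1 r X Y \<Xi>\<^sub>2 Z)
  then show ?case using zero_in
    by - (rule applicableI[of _ \<Xi>\<^sub>1 \<Xi>\<^sub>2 r 0 X Y "[]" "[]" "[]" I I I 6]; simp add: rules_def)
next
  case (g_linR \<Xi> A)
  then show ?case using zero_in
    by - (rule applicableI[of _ \<Xi> "[]" 0 0 J J "[]" "[]" "[]" A I I 9]; simp add: rules_def)
next
  case (m_sub \<Xi> \<Xi>' \<Gamma> A)
  then show ?case using zero_in
    by - (rule applicableI[of _ \<Xi> "\<Xi>'" 0 0 J J "[]" "[]" "[]"
        I I I 1]; simp add: rules_def raise_eq)
next
  case (m_weak \<Xi>\<^sub>1 \<Xi>\<^sub>2 \<Gamma> A X)
  then show ?case using zero_in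
    by - (rule applicableI[of _ \<Xi>\<^sub>1 \<Xi>\<^sub>2 0 0 X J "[]" "[]" "[]" I I I 2]; simp add: rules_def)
next
  case (m_contr \<Xi>\<^sub>1 r X s \<Xi>\<^sub>2 \<Gamma> A)
  then show ?case using zero_in
    by - (rule applicableI[of _ \<Xi>\<^sub>1 \<Xi>\<^sub>2 r s X J "[]" "[]" "[]" I I I 3]; simp add: rules_def)
next
  case (m_gexch \<Xi>\<^sub>1 r X s Y \<Xi>\<^sub>2 \<Gamma> A)
  then show ?case using zero_in
    by - (rule applicableI[of _ \<Xi>\<^sub>1 \<Xi>\<^sub>2 r s X Y "[]" "[]" "[]" I I I 4]; simp add: rules_def)
next
  case (m_gunitL \<Xi>\<^sub>1 \<Xi>\<^sub>2 \<Gamma> A r)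
  then show ?case using zero_in
    by - (rule applicableI[of _ \<Xi>\<^sub>1 \<Xi>\<^sub>2 r 0 J J "[]" "[]" "[]" I I I 5]; simp add: rules_def)
next
  case (m_gtensorL \<Xi>\<^sub>1 r X Y \<Xi>\<^sub>2 \<Gamma> A)
  then show ?case using zero_in
    by - (rule applicableI[of _ \<Xi>\<^sub>1 \<Xi>\<^sub>2 r 0 X Y "[]" "[]" "[]" I I I 6]; simp add: rules_def)
next
  case (m_id A)
  then show ?case using zero_in
    by - (rule applicableI[of _ "[]" "[]" 0 0 J J "[]" "[]" "[]" A I I 10]; simp add: rules_def)
next
  case (m_lexch \<Xi> \<Gamma>\<^sub>1 A B \<Gamma>\<^sub>2 C)
  then show ?case using zero_in
    by - (rule applicableI[of _ \<Xi> "[]" 0 0 J J \<Gamma>\<^sub>1 \<Gamma>\<^sub>2 "[]" A B C 11]; simp add: rules_def)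
next
  case m_unitR
  then show ?case using zero_in
    by - (rule applicableI[of _ "[]" "[]" 0 0 J J "[]" "[]" "[]" I I I 12]; simp add: rules_def)
next
  case (m_unitL \<Xi> \<Gamma>\<^sub>1 \<Gamma>\<^sub>2 A)
  then show ?case using zero_in
    by - (rule applicableI[of _ \<Xi> "[]" 0 0 J J \<Gamma>\<^sub>1 \<Gamma>\<^sub>2 "[]" A I I 13]; simp add: rules_def)
next
  case (m_tensorR \<Xi>\<^sub>1 \<Gamma>\<^sub>1 A \<Xi>\<^sub>2 \<Gamma>\<^sub>2 B)
  then show ?case using zero_in
    by - (rule applicableI[of _ \<Xi>\<^sub>1 \<Xi>\<^sub>2 0 0 J J \<Gamma>\<^sub>1 \<Gamma>\<^sub>2 "[]" A B I 14]; simp add: rules_def)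
next
  case (m_tensorL \<Xi> \<Gamma>\<^sub>1 A B \<Gamma>\<^sub>2 C)
  then show ?case using zero_in
    by - (rule applicableI[of _ \<Xi> "[]" 0 0 J J \<Gamma>\<^sub>1 \<Gamma>\<^sub>2 "[]" A B C 15]; simp add: rules_def)
next
  case (m_lolliR \<Xi> \<Gamma> A B)
  then show ?case using zero_in
    by - (rule applicableI[of _ \<Xi> "[]" 0 0 J J \<Gamma> "[]" "[]" A B I 16]; simp add: rules_def)
next
  case (m_lolliL \<Xi>\<^sub>2 \<Gamma>\<^sub>2 A \<Xi>\<^sub>1 \<Gamma>\<^sub>1 B \<Gamma>\<^sub>3 C)
  then show ?case using zero_in
    by - (rule applicableI[of _ \<Xi>\<^sub>1 \<Xi>\<^sub>2 0 0 J J \<Gamma>\<^sub>1 \<Gamma>\<^sub>2 \<Gamma>\<^sub>3 A B C 17]; simp add: rules_def)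
next
  case (m_linL \<Xi> A \<Gamma> B)
  then show ?case using zero_in
    by - (rule applicableI[of _ \<Xi> "[]" 0 0 J J \<Gamma> "[]" "[]" A B I 18]; simp add: rules_def)
next
  case (m_grdR \<Xi> X r)
  then show ?case using zero_in
    by - (rule applicableI[of _ \<Xi> "[]" r 0 X J "[]" "[]" "[]" I I I 19]; simp add: rules_def)
next
  case (m_grdL \<Xi> r X \<Gamma> A)
  then show ?case using zero_in
    by - (rule applicableI[of _ \<Xi> "[]" r 0 X J \<Gamma> "[]" "[]" A I I 20]; simp add: rules_def)
qed

text \<open>Only the end sequent has to be reached, so certificates for the premises can be combined
  without regard to which proofs they denote.\<close>

lemma cut_free_derivable_build: "cut_free_derivable S \<Longrightarrow> \<exists>c. set_tree c \<subseteq> R \<and> endseq (build c) = S"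
proof (induction rule: cut_free_derivable.induct)
  case (1 Ss S)
  have "\<exists>t. set_tree t \<subseteq> R \<and> map endseq (build_list t) = Ss"
    using "1.IH"
  proof (induction Ss)
    case Nil
    then show ?case by (intro exI[of _ Leaf]) simp
  next
    case (Cons S' Ss)
    obtain t where t: "set_tree t \<subseteq> R" "map endseq (build_list t) = Ss" using Cons by auto
    obtain c where c: "set_tree c \<subseteq> R" "endseq (build c) = S'" using Cons.prems by auto
    show ?case using t c by (intro exI[of _ "Pair c t"]) simp
  qed
  then obtain t where t: "set_tree t \<subseteq> R" "map endseq (build_list t) = Ss" by blast
  have "applicable (case Ss of [] \<Rightarrow> GS [] J | S' # _ \<Rightarrow> S') Ss S"
    using 1 by (intro rule_applicable) (auto intro: cut_free_derivable_ok)
  then obtain k p where kp: "set_tree k \<union> set_tree p \<subseteq> R"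
    "schema k p (case Ss of [] \<Rightarrow> GS [] J | S' # _ \<Rightarrow> S') = (Ss, S)" by (auto simp: applicable_def)
  have "(case build_list t of [] \<Rightarrow> GS [] J | \<Pi> # _ \<Rightarrow> endseq \<Pi>) =
      (case Ss of [] \<Rightarrow> GS [] J | S' # _ \<Rightarrow> S')"
    unfolding t(2)[symmetric] by (cases "build_list t") auto
  then have "endseq (build (Pair (Pair k p) t)) = S" using kp t by (simp add: finish_def)
  then show ?case using kp t by (intro exI[of _ "Pair (Pair k p) t"]) simp
qed

end

section \<open>The search program\<close>

primrec elist :: "expr list \<Rightarrow> expr" where
  "elist [] = ELeaf"
| "elist (e # es) = EPair e (elist es)"

definition enum :: "nat \<Rightarrow> expr" where "enum k = elist (replicate k ELeaf)"

definition enode :: "nat \<Rightarrow> expr list \<Rightarrow> expr" where "enode k es = EPair (enum k) (elist es)"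

lemma tree_of_list_Nil [simp]: "tree_of_list [] = Leaf"
  by (simp add: tree_of_list_def)

lemma tree_of_list_Cons: "tree_of_list (v # vs) = Pair v (tree_of_list vs)"
  by (simp add: tree_of_list_def)

lemma ev_elist [simp]: "ev P vs (elist es) = map_option tree_of_list (those (map (ev P vs) es))"
proof (induction es)
  case (Cons e es)
  then show ?case by (cases "ev P vs e"; cases "those (map (ev P vs) es)") (auto simp:
      tree_of_list_Cons)
qed simp

lemma ev_enum [simp]: "ev P vs (enum k) = Some (num k)"
proof -
  have "those (replicate k (Some Leaf)) = Some (replicate k Leaf)" by (induction k) auto
  then show ?thesis by (auto simp: enum_def num_def)
qed

lemma ev_enode [simp]: "ev P vs (enode k es) = map_option (node k) (those (map (ev P vs) es))"
  by (cases "those (map (ev P vs) es)") (simp_all add: enode_def node_def num_def)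

primrec eselect :: "expr \<Rightarrow> expr list \<Rightarrow> expr \<Rightarrow> expr" where
  "eselect t [] d = d"
| "eselect t (e # es) d = IfPair t (eselect (Snd t) es d) e"

lemma ev_eselect:
  assumes "ev P vs t = Some k" "list_all2 (\<lambda>e x. ev P vs e = Some (f x)) es xs" "ev P vs d =
      Some (f y)"
  shows "ev P vs (eselect t es d) = Some (f (select k xs y))"
  using assms(2,1)
proof (induction arbitrary: k t rule: list_all2_induct)
  case (Cons e es x xs)
  then show ?case by (cases k) auto
qed (use assms(3) in simp)

declare elist.simps [simp del]

abbreviation (input) "eFst e \<equiv> Call 1 [e]"
abbreviation (input) "eSnd e \<equiv> Call 2 [e]"
abbreviation (input) "eGrade e \<equiv> Call 3 [e]"
abbreviation (input) "eGform e \<equiv> Call 4 [e]"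
abbreviation (input) "eLform e \<equiv> Call 5 [e]"
abbreviation (input) "eGctx e \<equiv> Call 6 [e]"
abbreviation (input) "eLctx e \<equiv> Call 7 [e]"
abbreviation (input) "eAppend e e' \<equiv> Call 8 [e, e']"
abbreviation (input) "eScale e e' \<equiv> Call 9 [e, e']"
abbreviation (input) "eRaise e e' \<equiv> Call 10 [e, e']"
abbreviation (input) "eWithctx e e' \<equiv> Call 11 [e, e']"
abbreviation (input) "eGS \<Xi> X \<equiv> enode 0 [\<Xi>, X]"
abbreviation (input) "eMS \<Xi> \<Gamma> A \<equiv> enode 1 [\<Xi>, \<Gamma>, A]"
abbreviation (input) "eJ \<equiv> enode 0 []"
abbreviation (input) "eI \<equiv> enode 0 []"
abbreviation (input) "eDefault \<equiv> enode 0 [eGS ELeaf eJ, ELeaf]"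

text \<open>Entry by entry the compiled form of \<open>rules\<close>, so that the two lists can be
  compared pointwise. \<open>Arg 0\<close> is reserved for the selecting tree.\<close>

definition rule_exprs :: "expr list" where
  "rule_exprs = (let q = Arg 1; \<Xi>\<^sub>1 = Arg 2; \<Xi>\<^sub>2 = Arg 3; r = Arg 4; s = Arg 5; X = Arg 6; Y =
      Arg 7;
      \<Gamma>\<^sub>1 = Arg 8; \<Gamma>\<^sub>2 = Arg 9; \<Gamma>\<^sub>3 = Arg 10; A = Arg 11; B = Arg 12; C = Arg 13;
      R = (\<lambda>Ss S. EPair (elist Ss) S) in [
    R [] (eGS (elist [EPair EOne X]) X),
    R [eWithctx q \<Xi>\<^sub>1] (eWithctx q (eRaise \<Xi>\<^sub>1 \<Xi>\<^sub>2)),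
    R [eWithctx q (eAppend \<Xi>\<^sub>1 \<Xi>\<^sub>2)]
      (eWithctx q (eAppend \<Xi>\<^sub>1 (eAppend (elist [EPair EZero X]) \<Xi>\<^sub>2))),
    R [eWithctx q (eAppend \<Xi>\<^sub>1 (eAppend (elist [EPair r X, EPair s X]) \<Xi>\<^sub>2))]
      (eWithctx q (eAppend \<Xi>\<^sub>1 (eAppend (elist [EPair (EPlus r s) X]) \<Xi>\<^sub>2))),
    R [eWithctx q (eAppend \<Xi>\<^sub>1 (eAppend (elist [EPair r X, EPair s Y]) \<Xi>\<^sub>2))]
      (eWithctx q (eAppend \<Xi>\<^sub>1 (eAppend (elist [EPair s Y, EPair r X]) \<Xi>\<^sub>2))),
    R [eWithctx q (eAppend \<Xi>\<^sub>1 \<Xi>\<^sub>2)]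
      (eWithctx q (eAppend \<Xi>\<^sub>1 (eAppend (elist [EPair r eJ]) \<Xi>\<^sub>2))),
    R [eWithctx q (eAppend \<Xi>\<^sub>1 (eAppend (elist [EPair r X, EPair r Y]) \<Xi>\<^sub>2))]
      (eWithctx q (eAppend \<Xi>\<^sub>1 (eAppend (elist [EPair r (enode 1 [X, Y])]) \<Xi>\<^sub>2))),
    R [] (eGS ELeaf eJ),
    R [eGS \<Xi>\<^sub>1 X, eGS \<Xi>\<^sub>2 Y] (eGS (eAppend \<Xi>\<^sub>1 \<Xi>\<^sub>2) (enode 1 [X, Y])),
    R [eMS \<Xi>\<^sub>1 ELeaf A] (eGS \<Xi>\<^sub>1 (enode 2 [A])),
    R [] (eMS ELeaf (elist [A]) A),
    R [eMS \<Xi>\<^sub>1 (eAppend \<Gamma>\<^sub>1 (eAppend (elist [A, B]) \<Gamma>\<^sub>2)) C]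
      (eMS \<Xi>\<^sub>1 (eAppend \<Gamma>\<^sub>1 (eAppend (elist [B, A]) \<Gamma>\<^sub>2)) C),
    R [] (eMS ELeaf ELeaf eI),
    R [eMS \<Xi>\<^sub>1 (eAppend \<Gamma>\<^sub>1 \<Gamma>\<^sub>2) A] (eMS \<Xi>\<^sub>1 (eAppend \<Gamma>\<^sub>1 (eAppend (elist [eI]) \<Gamma>\<^sub>2)) A),
    R [eMS \<Xi>\<^sub>1 \<Gamma>\<^sub>1 A, eMS \<Xi>\<^sub>2 \<Gamma>\<^sub>2 B] (eMS (eAppend \<Xi>\<^sub>1 \<Xi>\<^sub>2) (eAppend \<Gamma>\<^sub>1 \<Gamma>\<^sub>2) (enode 1 [A, B])),
    R [eMS \<Xi>\<^sub>1 (eAppend \<Gamma>\<^sub>1 (eAppend (elist [A, B]) \<Gamma>\<^sub>2)) C]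
      (eMS \<Xi>\<^sub>1 (eAppend \<Gamma>\<^sub>1 (eAppend (elist [enode 1 [A, B]]) \<Gamma>\<^sub>2)) C),
    R [eMS \<Xi>\<^sub>1 (eAppend \<Gamma>\<^sub>1 (elist [A])) B] (eMS \<Xi>\<^sub>1 \<Gamma>\<^sub>1 (enode 2 [A, B])),
    R [eMS \<Xi>\<^sub>2 \<Gamma>\<^sub>2 A, eMS \<Xi>\<^sub>1 (eAppend \<Gamma>\<^sub>1 (eAppend (elist [B]) \<Gamma>\<^sub>3)) C]
      (eMS (eAppend \<Xi>\<^sub>1 \<Xi>\<^sub>2) (eAppend \<Gamma>\<^sub>1 (eAppend (elist [enode 2 [A, B]]) (eAppend \<Gamma>\<^sub>2 \<Gamma>\<^sub>3))) C),
    R [eMS \<Xi>\<^sub>1 (eAppend (elist [A]) \<Gamma>\<^sub>1) B]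
      (eMS (eAppend \<Xi>\<^sub>1 (elist [EPair EOne (enode 2 [A])])) \<Gamma>\<^sub>1 B),
    R [eGS \<Xi>\<^sub>1 X] (eMS (eScale r \<Xi>\<^sub>1) ELeaf (enode 3 [r, X])),
    R [eMS (eAppend \<Xi>\<^sub>1 (elist [EPair r X])) \<Gamma>\<^sub>1 A]
      (eMS \<Xi>\<^sub>1 (eAppend (elist [enode 3 [r, X]]) \<Gamma>\<^sub>1) A)])"

primrec enth :: "nat \<Rightarrow> expr \<Rightarrow> expr" where
  "enth 0 e = eFst e"
| "enth (Suc i) e = enth i (eSnd e)"

text \<open>Position 0 is the entry point and positions 1 to 11 are those of the abbreviations above. The
  others are: 12 \<open>select k (rules \<dots>)\<close>; 13 \<open>schema\<close>; 14 \<open>build\<close>; 15 \<open>build_list\<close>; 16 and 17 \<open>finish\<close>;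
  18 and 19 \<open>endseq\<close> of a list of derivations and of a derivation; 20 the search through a pool of
  certificates, which restarts at 23 with a larger pool; 21 and 22 \<open>grow1\<close> and \<open>grow2\<close>.\<close>

definition search_program :: program where
  "search_program = [
    Call 20 [elist [Arg 0, ELeaf, EZero, EOne], elist [Arg 0, ELeaf, EZero, EOne], Call 19 [Arg 0]],
    IfPair (Arg 0) (Fst (Arg 0)) ELeaf,
    IfPair (Arg 0) (Snd (Arg 0)) ELeaf,
    IfPair (Arg 0) EZero (IfEq (Arg 0) ELeaf EZero (Arg 0)),
    IfPair (Arg 0)
      (IfEq (Fst (Arg 0)) (enum 1) (enode 1 [eGform (eFst (Snd (Arg 0))), eGform (eSnd (Snd (Arg
          0)))])
      (IfEq (Fst (Arg 0)) (enum 2) (enode 2 [eLform (Snd (Arg 0))]) eJ)) eJ,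
    IfPair (Arg 0)
      (IfEq (Fst (Arg 0)) (enum 1) (enode 1 [eLform (eFst (Snd (Arg 0))), eLform (eSnd (Snd (Arg
          0)))])
      (IfEq (Fst (Arg 0)) (enum 2) (enode 2 [eLform (eFst (Snd (Arg 0))), eLform (eSnd (Snd (Arg
          0)))])
      (IfEq (Fst (Arg 0)) (enum 3) (enode 3 [eGrade (eFst (Snd (Arg 0))), eGform (eSnd (Snd (Arg
          0)))])
      eI))) eI,
    IfPair (Arg 0) (EPair (EPair (eGrade (eFst (Fst (Arg 0)))) (eGform (eSnd (Fst (Arg 0)))))
      (eGctx (Snd (Arg 0)))) ELeaf,
    IfPair (Arg 0) (EPair (eLform (Fst (Arg 0))) (eLctx (Snd (Arg 0)))) ELeaf,
    IfPair (Arg 0) (EPair (Fst (Arg 0)) (eAppend (Snd (Arg 0)) (Arg 1))) (Arg 1),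
    IfPair (Arg 1) (EPair (EPair (ETimes (Arg 0) (Fst (Fst (Arg 1)))) (Snd (Fst (Arg 1))))
      (eScale (Arg 0) (Snd (Arg 1)))) ELeaf,
    IfPair (Arg 0) (IfPair (Arg 1)
      (EPair (EPair (IfLe (Fst (Fst (Arg 0))) (Fst (Fst (Arg 1))) (Fst (Fst (Arg 1))) (Fst (Fst
          (Arg 0))))
        (Snd (Fst (Arg 0)))) (eRaise (Snd (Arg 0)) (Snd (Arg 1)))) (Arg 0)) ELeaf,
    EPair (Fst (Arg 0)) (EPair (Arg 1) (Snd (Snd (Arg 0)))),
    eselect (Arg 0) rule_exprs (EPair ELeaf (eGS ELeaf eJ)),
    Call 12 [Arg 0, Arg 2, eGctx (enth 0 (Arg 1)), eGctx (enth 1 (Arg 1)),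
      eGrade (enth 2 (Arg 1)), eGrade (enth 3 (Arg 1)), eGform (enth 4 (Arg 1)), eGform (enth 5
          (Arg 1)),
      eLctx (enth 6 (Arg 1)), eLctx (enth 7 (Arg 1)), eLctx (enth 8 (Arg 1)),
      eLform (enth 9 (Arg 1)), eLform (enth 10 (Arg 1)), eLform (enth 11 (Arg 1))],
    IfPair (Arg 0) (Call 16 [eFst (Fst (Arg 0)), eSnd (Fst (Arg 0)), Call 15 [Snd (Arg 0)]])
        eDefault,
    IfPair (Arg 0) (EPair (Call 14 [Fst (Arg 0)]) (Call 15 [Snd (Arg 0)])) ELeaf,
    Call 17 [Call 13 [Arg 0, Arg 1, IfPair (Arg 2) (Call 19 [Fst (Arg 2)]) (eGS ELeaf eJ)], Arg 2],
    IfEq (Call 18 [Arg 1]) (Fst (Arg 0)) (enode 0 [Snd (Arg 0), Arg 1]) eDefault,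
    IfPair (Arg 0) (EPair (Call 19 [Fst (Arg 0)]) (Call 18 [Snd (Arg 0)])) ELeaf,
    IfEq (Fst (Arg 0)) ELeaf (Fst (Snd (Arg 0))) (Fst (Snd (Snd (Arg 0)))),
    IfPair (Arg 0)
      (IfEq (Call 19 [Call 14 [Fst (Arg 0)]]) (Arg 2) (Call 14 [Fst (Arg 0)])
        (Call 20 [Snd (Arg 0), Arg 1, Arg 2]))
      (Call 23 [Call 21 [Arg 1, Arg 1, Arg 1], Arg 2]),
    IfPair (Arg 0) (Call 21 [Snd (Arg 0), Arg 1,
      Call 22 [Fst (Arg 0), Arg 1, EPair (eFst (Fst (Arg 0))) (EPair (eSnd (Fst (Arg 0))) (Arg
          2))]]) (Arg 2),
    IfPair (Arg 1) (Call 22 [Arg 0, Snd (Arg 1),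
      EPair (EPair (Arg 0) (Fst (Arg 1))) (EPair (EPlus (eGrade (Arg 0)) (eGrade (Fst (Arg 1))))
        (EPair (ETimes (eGrade (Arg 0)) (eGrade (Fst (Arg 1)))) (Arg 2)))]) (Arg 2),
    Call 20 [Arg 0, Arg 0, Arg 1]]"

section \<open>What the functions of the program compute\<close>

lemma length_search_program [simp]: "length search_program = 24"
  by (simp add: search_program_def)

lemma ev_fst [simp]: "ev search_program [t] (search_program ! 1) = Some (tfst t)"
  "ev search_program [t] (search_program ! Suc 0) = Some (tfst t)"
  \<comment> \<open>Only the body is unfolded; the program against which calls are resolved stays
    folded, so that equations for other functions still apply.\<close>
  by (subst (2) search_program_def; cases t; simp)+

lemma ev_snd [simp]: "ev search_program [t] (search_program ! 2) = Some (tsnd t)"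
  by (subst (2) search_program_def) (cases t; simp)

lemma ev_grade [simp]: "ev search_program [t] (search_program ! 3) = Some (Grade (tgrade t))"
  by (subst (2) search_program_def) (cases t; simp)

lemma ev_form:
  "ev search_program [t] (search_program ! 4) = Some (tree_of_gform (dec_g t))"
  "ev search_program [t] (search_program ! 5) = Some (tree_of_lform (dec_l t))"
proof (induction t and t rule: dec_g_dec_l.induct)
  case (1 k t)
  then show ?case by (subst (2) search_program_def) simp
next
  case (3 k t)
  then show ?case by (subst (2) search_program_def) simp
qed (subst (2) search_program_def; simp)+

lemmas [simp] = ev_form

lemma tree_of_gctx_simps [simp]:
  "tree_of_gctx [] = Leaf"
  "tree_of_gctx ((r, X) # \<Xi>) = Pair (Pair (Grade r) (tree_of_gform X)) (tree_of_gctx \<Xi>)"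
  by (simp_all add: tree_of_gctx_def tree_of_list_def)

lemma ev_gctx [simp]: "ev search_program [t] (search_program ! 6) =
    Some (tree_of_gctx (dec_gctx t))"
  by (induction t rule: dec_gctx.induct) (subst (2) search_program_def; simp)+

lemma ev_lctx [simp]: "ev search_program [t] (search_program ! 7) =
    Some (tree_of_list (map tree_of_lform (dec_lctx t)))"
  by (induction t rule: dec_lctx.induct) (subst (2) search_program_def; simp add:
      tree_of_list_Cons)+

lemma ev_append [simp]: "ev search_program [tree_of_list ts, tree_of_list us] (search_program ! 8)
    = Some (tree_of_list (ts @ us))"
  by (induction ts) (subst (2) search_program_def; simp add: tree_of_list_Cons split: tree.split)+

lemma ev_scale: "ev search_program [Grade r, tree_of_gctx \<Xi>] (search_program ! 9) =
    Some (tree_of_gctx (scale r \<Xi>))"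
  by (induction \<Xi>) (subst (2) search_program_def; auto simp: scale_def)+

lemma ev_raise: "ev search_program [tree_of_gctx \<Xi>, tree_of_gctx \<Xi>'] (search_program ! 10) =
    Some (tree_of_gctx (raise \<Xi> \<Xi>'))"
proof (induction \<Xi> \<Xi>' rule: raise.induct)
  case (3 p \<Xi>)
  then show ?case by (cases p; subst (2) search_program_def; simp)
qed (subst (2) search_program_def; simp)+

lemma ev_withctx:
  "ev search_program [tree_of_sequent q, tree_of_gctx \<Xi>] (search_program ! 11) =
      Some (tree_of_sequent (withctx q \<Xi>))"
  by (subst (2) search_program_def) (cases q; simp add: node_def tree_of_list_Cons)

definition tree_of_rule :: "'r sequent list \<times> 'r sequent \<Rightarrow> 'r tree" where
  "tree_of_rule x = Pair (tree_of_list (map tree_of_sequent (fst x))) (tree_of_sequent (snd x))"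

lemma ev_rules:
  "ev search_program [k, tree_of_sequent q, tree_of_gctx \<Xi>\<^sub>1, tree_of_gctx \<Xi>\<^sub>2, Grade r, Grade s,
     tree_of_gform X, tree_of_gform Y, tree_of_list (map tree_of_lform \<Gamma>\<^sub>1),
     tree_of_list (map tree_of_lform \<Gamma>\<^sub>2), tree_of_list (map tree_of_lform \<Gamma>\<^sub>3),
     tree_of_lform A, tree_of_lform B, tree_of_lform C] (search_program ! 12) =
   Some (tree_of_rule (select k (rules q \<Xi>\<^sub>1 \<Xi>\<^sub>2 r s X Y \<Gamma>\<^sub>1 \<Gamma>\<^sub>2 \<Gamma>\<^sub>3 A B C) ([], GS [] J)))"
proof -
  have append: "ev search_program [tree_of_gctx \<Xi>, tree_of_gctx \<Xi>'] (search_program ! 8) =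
      Some (tree_of_gctx (\<Xi> @ \<Xi>'))"
    for \<Xi> \<Xi>' :: "'a gctx" by (simp add: tree_of_gctx_def)
  \<comment> \<open>An \<open>elist\<close> of entries evaluates to a plain list tree; it is
    refolded into a context so that the equations for context operations match.\<close>
  have fold: "tree_of_list [Pair (Grade r) (tree_of_gform X)] = tree_of_gctx [(r, X)]"
    "tree_of_list [Pair (Grade r) (tree_of_gform X), Pair (Grade s) (tree_of_gform Y)] =
        tree_of_gctx [(r, X), (s, Y)]"
    "tree_of_list [Pair (Grade r) (node 0 [])] = tree_of_gctx [(r, J)]"
    "tree_of_list [Pair (Grade r) (node (Suc 0) [tree_of_gform X, tree_of_gform Y])] =
        tree_of_gctx [(r, GTensor X Y)]"
    "tree_of_list [Pair (Grade r) (node 2 [tree_of_lform A])] = tree_of_gctx [(r, Lin A)]"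
    for r s :: 'a and X Y A by (simp_all add: tree_of_gctx_def)
  have 12: "search_program ! 12 = eselect (Arg 0) rule_exprs (EPair ELeaf (eGS ELeaf eJ))"
    by (simp add: search_program_def)
  show ?thesis
    unfolding 12
  proof (rule ev_eselect[where f = tree_of_rule], goal_cases)
    case 2
    show ?case
      unfolding rule_exprs_def rules_def Let_def list_all2_Cons list.rel_inject(1)
        tree_of_rule_def fst_conv snd_conv
      by (intro conjI TrueI; simp add: append fold ev_scale ev_raise ev_withctx del:
          tree_of_gctx_simps(2))
  qed (simp_all add: tree_of_rule_def)
qed

lemma ev_schema:
  "ev search_program [k, p, tree_of_sequent q] (search_program ! 13) =
      Some (tree_of_rule (schema k p q))"
proof -
  have enth: "ev search_program vs (enth i e) = Some (tnth i t)" if "ev search_program vs e =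
      Some t" for vs i e and t :: "'a tree"
    using that by (induction i arbitrary: e t) (simp_all add: tnth_def funpow_swap1)
  have 13: "search_program ! 13 = Call 12 [Arg 0, Arg 2, eGctx (enth 0 (Arg 1)), eGctx (enth 1
      (Arg 1)),
      eGrade (enth 2 (Arg 1)), eGrade (enth 3 (Arg 1)), eGform (enth 4 (Arg 1)), eGform (enth 5
          (Arg 1)),
      eLctx (enth 6 (Arg 1)), eLctx (enth 7 (Arg 1)), eLctx (enth 8 (Arg 1)),
      eLform (enth 9 (Arg 1)), eLform (enth 10 (Arg 1)), eLform (enth 11 (Arg 1))]"
    by (simp add: search_program_def)
  have arg: "ev search_program [k, p, tree_of_sequent q] (enth i (Arg 1)) = Some (tnth i p)" for i
    by (rule enth) simp
  show ?thesis unfolding 13 schema_def by (simp only: ev_basic arg list.map) (simp add: ev_rules)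
qed

lemma ev_endseq [simp]: "ev search_program [tree_of_derivation \<Pi>] (search_program ! 19) =
    Some (tree_of_sequent (endseq \<Pi>))"
  by (subst (2) search_program_def) (cases \<Pi>; simp add: node_def tree_of_list_def numeral_2_eq_2)

lemma ev_endseqs [simp]:
  "ev search_program [tree_of_list (map tree_of_derivation \<Pi>s)] (search_program ! 18) =
   Some (tree_of_list (map tree_of_sequent (map endseq \<Pi>s)))"
  by (induction \<Pi>s) (subst (2) search_program_def; simp add: tree_of_list_Cons)+

text \<open>Injectivity of the encoding turns \<open>IfEq\<close> on trees into a test for equality
  of lists of sequents.\<close>

lemma tree_of_sequents_inject:
  "tree_of_list (map tree_of_sequent Ss) = tree_of_list (map tree_of_sequent Ss') \<longleftrightarrow> Ss = Ss'"
  by (simp add: tree_of_list_inject inj_map_eq_map inj_def tree_of_sequent_inject)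

lemma ev_finish:
  "ev search_program [k, p, tree_of_list (map tree_of_derivation \<Pi>s)] (search_program ! 16) =
   Some (tree_of_derivation (finish k p \<Pi>s))"
proof -
  define q where "q = (case \<Pi>s of [] \<Rightarrow> GS [] J | \<Pi> # _ \<Rightarrow> endseq \<Pi>)"
  have 16: "search_program ! 16 = Call 17 [Call 13 [Arg 0, Arg 1, IfPair (Arg 2) (Call 19 [Fst
      (Arg 2)]) (eGS ELeaf eJ)], Arg 2]"
    by (simp add: search_program_def)
  have 17: "search_program ! 17 = IfEq (Call 18 [Arg 1]) (Fst (Arg 0)) (enode 0 [Snd (Arg 0), Arg
      1]) eDefault"
    by (simp add: search_program_def)
  have "ev search_program [k, p, tree_of_list (map tree_of_derivation \<Pi>s)]
      (IfPair (Arg 2) (Call 19 [Fst (Arg 2)]) (eGS ELeaf eJ)) = Some (tree_of_sequent q)"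
    by (cases \<Pi>s) (simp_all add: q_def tree_of_list_Cons)
  then have "ev search_program [k, p, tree_of_list (map tree_of_derivation \<Pi>s)] (search_program !
      16) =
      ev search_program [tree_of_rule (schema k p q), tree_of_list (map tree_of_derivation \<Pi>s)]
          (search_program ! 17)"
    unfolding 16 by (simp only: ev_basic list.map) (simp add: ev_schema)
  also have "\<dots> = Some (tree_of_derivation (finish k p \<Pi>s))"
    unfolding 17 finish_def q_def[symmetric] tree_of_rule_def
    by (cases "schema k p q") (auto simp: tree_of_sequents_inject simp del: map_map)
  finally show ?thesis .
qed

lemma ev_build:
  "ev search_program [t] (search_program ! 14) = Some (tree_of_derivation (build t))"
  "ev search_program [t] (search_program ! 15) = Some (tree_of_list (map tree_of_derivation
      (build_list t)))"
proof (induction t and t rule: build_build_list.induct)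
  case (1 h t)
  then show ?case by (subst (2) search_program_def) (simp add: ev_finish)
qed (subst (2) search_program_def; simp add: tree_of_list_Cons)+

lemmas [simp] = ev_build

text \<open>Sums and products are formed from all trees, non-grades counting as 0, which spares the
  enumeration a case distinction.\<close>

definition grow_pair :: "'r::preordered_semiring tree \<Rightarrow> 'r tree \<Rightarrow> 'r tree list" where
  "grow_pair a b = [Pair a b, Grade (tgrade a + tgrade b), Grade (tgrade a * tgrade b)]"

primrec grow2 :: "'r::preordered_semiring tree \<Rightarrow> 'r tree list \<Rightarrow> 'r tree list \<Rightarrow> 'r tree list" where
  "grow2 a [] acc = acc"
| "grow2 a (b # bs) acc = grow2 a bs (grow_pair a b @ acc)"

text \<open>The projections take the input apart, which is how the grades of the given derivation
  enter the pool.\<close>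

primrec grow1 :: "'r::preordered_semiring tree list \<Rightarrow> 'r tree list \<Rightarrow> 'r tree list \<Rightarrow> 'r tree list"
    where
  "grow1 [] bs acc = acc"
| "grow1 (a # as) bs acc = grow1 as bs (grow2 a bs (tfst a # tsnd a # acc))"

definition grow :: "'r::preordered_semiring tree list \<Rightarrow> 'r tree list" where
  "grow ts = grow1 ts ts ts"

lemma set_grow2: "set (grow2 a bs acc) = set acc \<union> (\<Union>b\<in>set bs. set (grow_pair a b))"
  by (induction bs arbitrary: acc) auto

lemma set_grow1:
  "set (grow1 as bs acc) = set acc \<union> (\<Union>a\<in>set as. {tfst a, tsnd a} \<union> (\<Union>b\<in>set bs. set (grow_pair a
      b)))"
  by (induction as arbitrary: acc) (auto simp: set_grow2)

lemma ev_grow2: "ev search_program [a, tree_of_list bs, tree_of_list acc] (search_program ! 22) =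
    Some (tree_of_list (grow2 a bs acc))"
proof (induction bs arbitrary: acc)
  case (Cons b bs)
  from Cons[of "grow_pair a b @ acc"] show ?case
    by (subst (2) search_program_def) (simp add: tree_of_list_Cons grow_pair_def)
qed (subst (2) search_program_def; simp)

lemma ev_grow1:
  "ev search_program [tree_of_list as, tree_of_list bs, tree_of_list acc] (search_program ! 21) =
      Some (tree_of_list (grow1 as bs acc))"
proof (induction as arbitrary: acc)
  case (Cons a as)
  from Cons[of "grow2 a bs (tfst a # tsnd a # acc)"] ev_grow2[of a bs "tfst a # tsnd a # acc"]
  show ?case by (subst (2) search_program_def) (simp add: tree_of_list_Cons)
qed (subst (2) search_program_def; simp)

text \<open>An exhausted pool restarts the scan with the next one. The equation leaves open whether
  the two sides have a value.\<close>

lemma ev_scan_Nil: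
  "ev search_program [Leaf, tree_of_list pool, S] (search_program ! 20) =
   ev search_program [tree_of_list (grow pool), tree_of_list (grow pool), S] (search_program ! 20)"
proof -
  have 23: "search_program ! 23 = Call 20 [Arg 0, Arg 0, Arg 1]" by (simp add: search_program_def)
  show ?thesis by (subst (2) search_program_def) (simp add: ev_grow1 23 grow_def)
qed

lemma ev_scan_Cons:
  "ev search_program [tree_of_list (c # cs), pool, tree_of_sequent S] (search_program ! 20) =
   (if endseq (build c) = S then Some (tree_of_derivation (build c))
    else ev search_program [tree_of_list cs, pool, tree_of_sequent S] (search_program ! 20))"
  by (subst (2) search_program_def) (simp add: tree_of_list_Cons tree_of_sequent_inject)

lemma ev_scan:
  "(\<exists>c. ev search_program [tree_of_list cs, tree_of_list pool, tree_of_sequent S] (search_program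
      ! 20) =
      Some (tree_of_derivation (build c)) \<and> endseq (build c) = S) \<or>
   (\<forall>c\<in>set cs. endseq (build c) \<noteq> S) \<and>
   ev search_program [tree_of_list cs, tree_of_list pool, tree_of_sequent S] (search_program ! 20) =
   ev search_program [tree_of_list (grow pool), tree_of_list (grow pool), tree_of_sequent S]
       (search_program ! 20)"
  by (induction cs) (auto simp: ev_scan_Nil ev_scan_Cons)

text \<open>The given \<open>c\<close> only bounds the number of rounds; the scan may stop earlier,
  at another certificate for \<open>S\<close>.\<close>

lemma ev_search:
  "c \<in> set ((grow ^^ n) pool) \<Longrightarrow> endseq (build c) = S \<Longrightarrow>
   \<exists>c. ev search_program [tree_of_list pool, tree_of_list pool, tree_of_sequent S] (search_program
       ! 20) =
      Some (tree_of_derivation (build c)) \<and> endseq (build c) = S"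
proof (induction n arbitrary: pool)
  case 0
  then show ?case using ev_scan[of pool pool S] by auto
next
  case (Suc n)
  then have "\<exists>c. ev search_program [tree_of_list (grow pool), tree_of_list (grow pool),
      tree_of_sequent S] (search_program ! 20) =
      Some (tree_of_derivation (build c)) \<and> endseq (build c) = S"
    by (intro Suc.IH) (simp_all add: funpow_swap1)
  then show ?case using ev_scan[of pool pool S] by auto
qed

section \<open>Completeness of the search\<close>

inductive_set generated :: "'r::preordered_semiring set \<Rightarrow> 'r set" for G where
  "g \<in> G \<Longrightarrow> g \<in> generated G"
| "0 \<in> generated G"
| "1 \<in> generated G"
| "r \<in> generated G \<Longrightarrow> s \<in> generated G \<Longrightarrow> r + s \<in> generated G"
| "r \<in> generated G \<Longrightarrow> s \<in> generated G \<Longrightarrow> r * s \<in> generated G"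

lemma grades_generated: "grades (generated G)"
  by unfold_locales (auto intro: generated.intros)

text \<open>The pools increase, so any two trees lie in a common one, and their union
  \<open>U\<close> is closed under projections, pairing, and sums and products of grades.
  Projections bring the grades of \<open>v\<close> into \<open>U\<close>; closure then yields every
  tree over the generated subsemiring.\<close>

lemma pool_complete:
  assumes "set_tree c \<subseteq> generated (set_tree v)"
  shows "\<exists>n. c \<in> set ((grow ^^ n) [v, Leaf, Grade 0, Grade 1])"
proof -
  define pool where "pool n = set ((grow ^^ n) [v, Leaf, Grade 0, Grade 1])" for n
  define U where "U = (\<Union>n. pool n)"
  have grow: "pool (Suc n) = pool n \<union> (\<Union>a\<in>pool n. {tfst a, tsnd a} \<union> (\<Union>b\<in>pool n. set (grow_pair a
      b)))" for n
    by (simp add: pool_def grow_def set_grow1)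
  have mono: "pool m \<subseteq> pool n" if "m \<le> n" for m n
    by (rule lift_Suc_mono_le[of pool, OF _ that]) (auto simp: grow)
  have init: "v \<in> U" "Leaf \<in> U" "Grade 0 \<in> U" "Grade 1 \<in> U"
    by (auto simp: U_def pool_def intro!: exI[of _ 0])
  have proj: "tfst a \<in> U" "tsnd a \<in> U" if a: "a \<in> U" for a
  proof -
    obtain n where "a \<in> pool n" using a by (auto simp: U_def)
    then have "tfst a \<in> pool (Suc n)" "tsnd a \<in> pool (Suc n)" by (auto simp: grow)
    then show "tfst a \<in> U" "tsnd a \<in> U" by (auto simp: U_def)
  qed
  have pair: "set (grow_pair a b) \<subseteq> U" if ab: "a \<in> U" "b \<in> U" for a b
  proof -
    obtain m n where "a \<in> pool m" "b \<in> pool n" using ab by (auto simp: U_def)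
    then have "a \<in> pool (max m n)" "b \<in> pool (max m n)"
        using mono by (meson max.cobounded1 max.cobounded2 subsetD)+
    then have "set (grow_pair a b) \<subseteq> pool (Suc (max m n))" by (auto simp: grow)
    then show ?thesis by (auto simp: U_def)
  qed
  have leaf: "Grade g \<in> U" if "g \<in> set_tree t" "t \<in> U" for g t
    using that
  proof (induction t)
    case (Pair t u)
    then show ?case using proj[of "Pair t u"] by auto
  qed auto
  have grade: "Grade g \<in> U" if "g \<in> generated (set_tree v)" for g
    using that
  proof induction
    case (4 r s)
    then show ?case using pair[of "Grade r" "Grade s"] by (simp add: grow_pair_def)
  next
    case (5 r s)
    then show ?case using pair[of "Grade r" "Grade s"] by (simp add: grow_pair_def)
  qed (use init leaf in auto)
  have "c \<in> U"
    using assms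
  proof (induction c)
    case (Pair t u)
    then show ?case using pair[of t u] by (auto simp: grow_pair_def)
  qed (use init grade in auto)
  then show ?thesis by (auto simp: U_def pool_def)
qed

lemma set_tree_of_list: "set_tree (tree_of_list ts) = (\<Union>t\<in>set ts. set_tree t)"
  by (induction ts) (auto simp: tree_of_list_def)

lemma set_node: "set_tree (node k ts) = (\<Union>t\<in>set ts. set_tree t)"
proof -
  have "set_tree (tree_of_list (replicate k Leaf)) = {}" by (auto simp: set_tree_of_list)
  then show ?thesis by (simp add: node_def set_tree_of_list)
qed

lemma set_tree_of_form:
  fixes X :: "'r gform" and A :: "'r lform"
  shows "set_tree (tree_of_gform X) = set_gform X" "set_tree (tree_of_lform A) = set_lform A"
  by (induction X and A rule: gform.induct lform.induct) (auto simp: set_node)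

lemma set_tree_of_gctx:
  "set_tree (tree_of_gctx \<Xi>) = (\<Union>p\<in>set \<Xi>. Basic_BNFs.fsts p \<union> (\<Union>X\<in>Basic_BNFs.snds p. set_gform X))"
  by (induction \<Xi>) (auto simp: set_tree_of_form fsts.simps snds.simps)

lemma set_tree_of_sequent: "set_tree (tree_of_sequent S) = set_sequent S"
  by (cases S) (auto simp: set_node set_tree_of_gctx set_tree_of_form set_tree_of_list)

lemma set_tree_of_derivation: "set_tree (tree_of_derivation \<Pi>) = set_derivation \<Pi>"
  by (induction \<Pi>) (auto simp: set_node set_tree_of_sequent set_tree_of_form set_tree_of_list)

lemma proof_of_endseq: "proof_of \<Pi> S \<Longrightarrow> endseq \<Pi> = S"
  by (erule proof_of.cases) auto

theorem theorem11:
  shows "\<exists>algorithm :: program. \<forall>(\<Pi> :: 'r::preordered_semiring derivation) S.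
    proof_of \<Pi> S \<and> CutRank \<Pi> > 0 \<longrightarrow>
    (\<exists>\<Pi>'. computes algorithm (tree_of_derivation \<Pi>) (tree_of_derivation \<Pi>') \<and>
      proof_of \<Pi>' S \<and> cut_free \<Pi>')"
proof (intro exI[of _ search_program] allI impI)
  fix \<Pi> :: "'r derivation" and S
  assume "proof_of \<Pi> S \<and> CutRank \<Pi> > 0"
  then have \<Pi>: "proof_of \<Pi> S" by simp
  let ?v = "tree_of_derivation \<Pi>"
  \<comment> \<open>The smallest subsemiring containing the grades of the input is taken, since
    every certificate over it is reached by the enumeration.\<close>
  interpret grades "generated (set_tree ?v)" by (rule grades_generated)
  have "cut_free_derivable S"
    using \<Pi> by (rule proof_cut_free_derivable) (auto simp: set_tree_of_derivation intro:
        generated.intros(1))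
  then obtain c where c: "set_tree c \<subseteq> generated (set_tree ?v)" "endseq (build c) = S"
    using cut_free_derivable_build by blast
  then obtain n where "c \<in> set ((grow ^^ n) [?v, Leaf, Grade 0, Grade 1])"
      using pool_complete by blast
  then obtain c' where c': "endseq (build c') = S"
    "ev search_program [tree_of_list [?v, Leaf, Grade 0, Grade 1], tree_of_list [?v, Leaf, Grade
        0, Grade 1],
      tree_of_sequent S] (search_program ! 20) = Some (tree_of_derivation (build c'))"
    using ev_search c(2) by blast
  have 0: "search_program ! 0 = Call 20 [elist [Arg 0, ELeaf, EZero, EOne], elist [Arg 0, ELeaf,
      EZero, EOne], Call 19 [Arg 0]]"
    by (simp add: search_program_def)
  have "ev search_program [?v] (search_program ! 0) = Some (tree_of_derivation (build c'))"
    unfolding 0 using c'(2) by (simp add: proof_of_endseq[OF \<Pi>])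
  moreover have "search_program \<noteq> []" by (simp add: search_program_def)
  ultimately have "computes search_program ?v (tree_of_derivation (build c'))"
    unfolding computes_def ev_eq_Some by blast
  moreover have "cut_free_proof (build c')" by (rule build_cut_free_proof)
  ultimately show "\<exists>\<Pi>'. computes search_program ?v (tree_of_derivation \<Pi>') \<and> proof_of \<Pi>' S \<and>
      cut_free \<Pi>'"
    using c'(1) by (auto simp: cut_free_proof_def)
qed

end
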